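(* For BSTSO, with $k$ the maximum size of a tree in the instance: (i) there is a polynomial-time $\tfrac43$-approximation algorithm for instances with $k=3$; (ii) there is a polynomial-time $1.9$-approximation algorithm for instances with $k=4$; (iii) for general $k$, there is a polynomial-time $\tfrac23 k$-approximation algorithm.
   Context: BSTSO: Fix an associative, commutative binary operator $\circ\colon\{0,1\}^2\to\{0,1\}$. An instance is a finite family $\mathcal{T}$ of subsets of $\{1,\dots,n\}$ (trees). A circuit is a directed acyclic graph whose vertices are inputs (in-degree $0$, each associated with one variable $x_i$) and gates (in-degree exactly $2$). Every vertex $v$ carries a variable set $S(v)$: $S(v)=\{i\}$ for the input of $x_i$, and for a gate $v$ with predecessors $u,w$ one requires $S(u)\cap S(w)=\emptyset$ and $S(v)=S(u)\cup S(w)$; $v$ then computes $\bigcirc_{i\in S(v)}x_i$. A circuit is a solution for $\mathcal{T}$ if for every $T\in\mathcal{T}$ some vertex $v$ has $S(v)=T$. Size = number of gates; $\mathrm{opt}(\mathcal{T})$ = minimum size of a solution. An $\alpha$-approximation algorithm is a polynomial-time algorithm returning a solution of size at most $\alpha\cdot\mathrm{opt}(\mathcal{T})$. $k:=\max\{|T|:T\in\mathcal{T}\}$. *)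

theory Defs
  imports Complex_Main "HOL-Computational_Algebra.Polynomial"
begin

section \<open>Circuits\<close>

text \<open>
  A circuit is the list of its vertices, which are referred to by their positions. The list
  need not be topologically sorted; acyclicity is imposed on the edge relation.
\<close>

datatype vertex = Input nat | Gate nat nat

type_synonym circuit = "vertex list"

definition edges :: "circuit \<Rightarrow> (nat \<times> nat) set" where
  "edges C = {(u, v). v < length C \<and> (\<exists>a b. C ! v = Gate a b \<and> (u = a \<or> u = b))}"

definition is_dag :: "circuit \<Rightarrow> bool" where
  "is_dag C \<longleftrightarrow> edges C \<subseteq> {..<length C} \<times> {..<length C} \<and> acyclic (edges C)"

text \<open>
  The variable sets S(v). On an acyclic circuit there is at most one such labelling of the vertices.
  Since all labels are nonempty, disjointness also forces the two predecessors of a gate to be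
  distinct vertices.
\<close>

definition variable_sets :: "circuit \<Rightarrow> (nat \<Rightarrow> nat set) \<Rightarrow> bool" where
  "variable_sets C S \<longleftrightarrow> (\<forall>v < length C. case C ! v of
      Input i \<Rightarrow> S v = {i}
    | Gate u w \<Rightarrow> S u \<inter> S w = {} \<and> S v = S u \<union> S w)"

definition is_solution :: "nat \<Rightarrow> nat set set \<Rightarrow> circuit \<Rightarrow> bool" where
  "is_solution n \<T> C \<longleftrightarrow>
     is_dag C \<and> (\<forall>i. Input i \<in> set C \<longrightarrow> i \<in> {1..n}) \<and>
     (\<exists>S. variable_sets C S \<and> (\<forall>T\<in>\<T>. \<exists>v < length C. S v = T))"

definition num_gates :: "circuit \<Rightarrow> nat" where
  "num_gates C = card {v. v < length C \<and> (\<exists>a b. C ! v = Gate a b)}"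

definition opt :: "nat \<Rightarrow> nat set set \<Rightarrow> nat" where
  "opt n \<T> = (LEAST m. \<exists>C. is_solution n \<T> C \<and> num_gates C = m)"

text \<open>The empty set is excluded as a tree, because no vertex of a circuit has an empty label.\<close>

definition is_instance :: "nat \<Rightarrow> nat set set \<Rightarrow> bool" where
  "is_instance n \<T> \<longleftrightarrow> (\<forall>T\<in>\<T>. T \<noteq> {} \<and> T \<subseteq> {1..n})"

text \<open>The parameter k; inserting 0 only fixes the value for the empty family.\<close>

definition max_tree_size :: "nat set set \<Rightarrow> nat" where
  "max_tree_size \<T> = Max (insert 0 (card ` \<T>))"

section \<open>What the vertices compute\<close>

text \<open>
  The operator enters the problem only through the following fact: if it is associative and
  commutative, then a vertex labelled S(v) computes the combination of the variables in S(v).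
\<close>

definition big_op :: "(bool \<Rightarrow> bool \<Rightarrow> bool) \<Rightarrow> (nat \<Rightarrow> bool) \<Rightarrow> nat set \<Rightarrow> bool" where
  "big_op f x A = Finite_Set.fold (\<lambda>i. f (x i)) (x (Min A)) (A - {Min A})"

definition vertex_values ::
    "(bool \<Rightarrow> bool \<Rightarrow> bool) \<Rightarrow> circuit \<Rightarrow> (nat \<Rightarrow> bool) \<Rightarrow> (nat \<Rightarrow> bool) \<Rightarrow> bool" where
  "vertex_values f C x y \<longleftrightarrow> (\<forall>v < length C. case C ! v of
      Input i \<Rightarrow> y v = x i
    | Gate u w \<Rightarrow> y v = f (y u) (y w))"

lemma big_op_insert:
  assumes f: "abel_semigroup f" and A: "finite A" "A \<noteq> {}" "i \<notin> A"
  shows "big_op f x (insert i A) = f (x i) (big_op f x A)"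
proof -
  interpret f: abel_semigroup f by (fact f)
  interpret F: comp_fun_commute "\<lambda>i. f (x i)"
    by unfold_locales (auto simp: fun_eq_iff f.left_commute)
  define m where "m = Min A"
  have m: "m \<in> A" using A by (simp add: m_def)
  show ?thesis
  proof (cases "i < m")
    case True
    then have "Min (insert i A) = i"
      using A by (simp add: m_def)
    moreover have "Finite_Set.fold (\<lambda>i. f (x i)) (x i) A
        = f (x m) (Finite_Set.fold (\<lambda>i. f (x i)) (x i) (A - {m}))"
      using A m by (simp add: F.fold_rec)
    moreover have "f (x m) (Finite_Set.fold (\<lambda>i. f (x i)) (x i) B)
        = f (x i) (Finite_Set.fold (\<lambda>i. f (x i)) (x m) B)" if "finite B" for B
      using that
    proof induction
      case empty
      show ?case unfolding fold_empty by (rule f.commute)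
    next
      case (insert j B)
      show ?case
        unfolding F.fold_insert[OF insert.hyps]
        unfolding f.left_commute[of "x m" "x j"] f.left_commute[of "x i" "x j"] insert.IH ..
    qed
    ultimately show ?thesis
      using A by (simp add: big_op_def m_def)
  next
    case False
    then have "Min (insert i A) = m" "insert i A - {m} = insert i (A - {m})"
      using A m by (auto simp: m_def[symmetric] min_def)
    then show ?thesis
      using A by (simp add: big_op_def m_def)
  qed
qed

lemma big_op_union:
  assumes f: "abel_semigroup f" and B: "finite B" "B \<noteq> {}"
    and A: "finite A" "A \<noteq> {}" "A \<inter> B = {}"
  shows "big_op f x (A \<union> B) = f (big_op f x A) (big_op f x B)"
proof -
  interpret f: abel_semigroup f by (fact f)
  show ?thesis using A
  proof (induction rule: finite_ne_induct)
    case (singleton i)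
    then show ?case
      using B by (simp add: big_op_insert[OF f]) (simp add: big_op_def)
  next
    case (insert i A)
    then show ?case
      using B by (simp add: big_op_insert[OF f] f.assoc)
  qed
qed

lemma vertex_computes_big_op:
  assumes f: "abel_semigroup f" and C: "is_dag C" "variable_sets C S" "vertex_values f C x y"
    and v: "v < length C"
  shows "y v = big_op f x (S v)"
proof -
  have "finite (edges C)"
    using C(1) by (auto simp: is_dag_def intro: finite_subset)
  then have "wf (edges C)"
    using C(1) by (simp add: is_dag_def finite_acyclic_wf)
  then have "finite (S v) \<and> S v \<noteq> {} \<and> y v = big_op f x (S v)" using v
  proof (induction v rule: wf_induct_rule)
    case (less v)
    show ?case
    proof (cases "C ! v")
      case (Input i)
      then show ?thesis
        using C(2,3)[unfolded variable_sets_def vertex_values_def, rule_format, OF less.prems]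
        by (simp add: big_op_def)
    next
      case (Gate u w)
      then have e: "(u, v) \<in> edges C" "(w, v) \<in> edges C"
        using less.prems by (auto simp: edges_def)
      then have "u < length C" "w < length C"
        using C(1) by (auto simp: is_dag_def)
      with less.IH e have IH: "finite (S u) \<and> S u \<noteq> {} \<and> y u = big_op f x (S u)"
        "finite (S w) \<and> S w \<noteq> {} \<and> y w = big_op f x (S w)"
        by blast+
      have "S u \<inter> S w = {}" "S v = S u \<union> S w" "y v = f (y u) (y w)"
        using C(2,3)[unfolded variable_sets_def vertex_values_def, rule_format, OF less.prems] Gate
        by simp_all
      with IH show ?thesis
        using big_op_union[OF f] by auto
    qed
  qed
  then show ?thesis by blast
qed

section \<open>Polynomial-time computation\<close>

text \<open>
  Algorithms are programs of a WHILE language whose values are binary trees (Jones,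
  \<^emph>\<open>Computability and Complexity\<close>, extended by an equality test). Evaluating an expression costs the
  total size of the values of all its subexpressions, so that no value larger than the elapsed
  time can be built and the model is polynomially equivalent to Turing machines.
\<close>

datatype data = Leaf | Node data data

primrec dsize :: "data \<Rightarrow> nat" where
  "dsize Leaf = 1"
| "dsize (Node d e) = dsize d + dsize e + 1"

datatype exp = Var nat | Nil_exp | Cons_exp exp exp | Hd exp | Tl exp | Eq exp exp

type_synonym state = "nat \<Rightarrow> data"

primrec hd_data :: "data \<Rightarrow> data" where
  "hd_data Leaf = Leaf"
| "hd_data (Node d e) = d"

primrec tl_data :: "data \<Rightarrow> data" where
  "tl_data Leaf = Leaf"
| "tl_data (Node d e) = e"

definition enc_bool :: "bool \<Rightarrow> data" where
  "enc_bool b = (if b then Node Leaf Leaf else Leaf)"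

primrec eval_exp :: "exp \<Rightarrow> state \<Rightarrow> data" where
  "eval_exp (Var x) s = s x"
| "eval_exp Nil_exp s = Leaf"
| "eval_exp (Cons_exp e1 e2) s = Node (eval_exp e1 s) (eval_exp e2 s)"
| "eval_exp (Hd e) s = hd_data (eval_exp e s)"
| "eval_exp (Tl e) s = tl_data (eval_exp e s)"
| "eval_exp (Eq e1 e2) s = enc_bool (eval_exp e1 s = eval_exp e2 s)"

fun exp_cost :: "exp \<Rightarrow> state \<Rightarrow> nat" where
  "exp_cost (Var x) s = dsize (s x)"
| "exp_cost Nil_exp s = 1"
| "exp_cost (Cons_exp e1 e2) s = exp_cost e1 s + exp_cost e2 s + dsize (eval_exp (Cons_exp e1 e2) s)"
| "exp_cost (Hd e) s = exp_cost e s + dsize (eval_exp (Hd e) s)"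
| "exp_cost (Tl e) s = exp_cost e s + dsize (eval_exp (Tl e) s)"
| "exp_cost (Eq e1 e2) s = exp_cost e1 s + exp_cost e2 s + dsize (eval_exp (Eq e1 e2) s)"

datatype com = Skip | Assign nat exp | Seq com com | Cond exp com com | While exp com

text \<open>exec c s t s' means that c, started in state s, terminates in state s' after time t.\<close>

inductive exec :: "com \<Rightarrow> state \<Rightarrow> nat \<Rightarrow> state \<Rightarrow> bool" where
  Skip: "exec Skip s 1 s"
| Assign: "exec (Assign x e) s (1 + exp_cost e s) (s(x := eval_exp e s))"
| Seq: "exec c1 s t1 s1 \<Longrightarrow> exec c2 s1 t2 s2 \<Longrightarrow> exec (Seq c1 c2) s (1 + t1 + t2) s2"
| CondTrue: "eval_exp e s \<noteq> Leaf \<Longrightarrow> exec c1 s t s1 \<Longrightarrow>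
    exec (Cond e c1 c2) s (1 + exp_cost e s + t) s1"
| CondFalse: "eval_exp e s = Leaf \<Longrightarrow> exec c2 s t s1 \<Longrightarrow>
    exec (Cond e c1 c2) s (1 + exp_cost e s + t) s1"
| WhileFalse: "eval_exp e s = Leaf \<Longrightarrow> exec (While e c) s (1 + exp_cost e s) s"
| WhileTrue: "eval_exp e s \<noteq> Leaf \<Longrightarrow> exec c s t1 s1 \<Longrightarrow> exec (While e c) s1 t2 s2 \<Longrightarrow>
    exec (While e c) s (1 + exp_cost e s + t1 + t2) s2"

text \<open>Input and output are held in variable 0.\<close>

definition returns :: "com \<Rightarrow> data \<Rightarrow> nat \<Rightarrow> data \<Rightarrow> bool" where
  "returns c d t d' \<longleftrightarrow> (\<exists>s. exec c ((\<lambda>_. Leaf)(0 := d)) t s \<and> s 0 = d')"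

section \<open>Encodings and approximation algorithms\<close>

text \<open>Numbers are encoded in binary, least significant bit first.\<close>

fun enc_nat :: "nat \<Rightarrow> data" where
  "enc_nat m = (if m = 0 then Leaf else Node (enc_bool (odd m)) (enc_nat (m div 2)))"

declare enc_nat.simps [simp del]

primrec enc_list :: "('a \<Rightarrow> data) \<Rightarrow> 'a list \<Rightarrow> data" where
  "enc_list f [] = Leaf"
| "enc_list f (x # xs) = Node (f x) (enc_list f xs)"

primrec enc_vertex :: "vertex \<Rightarrow> data" where
  "enc_vertex (Input i) = Node (enc_bool False) (enc_nat i)"
| "enc_vertex (Gate a b) = Node (enc_bool True) (Node (enc_nat a) (enc_nat b))"

definition enc_circuit :: "circuit \<Rightarrow> data" where
  "enc_circuit C = enc_list enc_vertex C"

definition enc_instance :: "nat \<Rightarrow> nat list list \<Rightarrow> data" where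
  "enc_instance n Ts = Node (enc_nat n) (enc_list (enc_list enc_nat) Ts)"

text \<open>Ts lists the trees, each given as a list of its elements, in any order and without repetition.\<close>

definition represents :: "nat list list \<Rightarrow> nat set set \<Rightarrow> bool" where
  "represents Ts \<T> \<longleftrightarrow>
     (\<forall>T\<in>set Ts. distinct T) \<and> distinct (map set Ts) \<and> set (map set Ts) = \<T>"

text \<open>
  There is a polynomial-time \<alpha>-approximation algorithm for the instances satisfying P, where the
  guarantee \<alpha> may depend on the instance. The program and the polynomial are the same for all
  instances.
\<close>

definition poly_time_approximable ::
    "(nat set set \<Rightarrow> bool) \<Rightarrow> (nat set set \<Rightarrow> real) \<Rightarrow> bool" where
  "poly_time_approximable P \<alpha> \<longleftrightarrow>
     (\<exists>(c :: com) (p :: nat poly). \<forall>n \<T> Ts.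
        is_instance n \<T> \<and> P \<T> \<and> represents Ts \<T> \<longrightarrow>
        (\<exists>t C. returns c (enc_instance n Ts) t (enc_circuit C) \<and>
               t \<le> poly p (dsize (enc_instance n Ts)) \<and>
               is_solution n \<T> C \<and>
               real (num_gates C) \<le> \<alpha> \<T> * real (opt n \<T>)))"

end

theory Submission imports Defs begin

text \<open>
  A solution is described by a list of instructions (A, B), each asking for a gate with label
  A \<union> B; its size is the number of instructions. The lower bounds only use the set \<Gamma> of gate labels
  of an optimal solution: it contains the trees, and each of its members is a disjoint union of two
  sets that are singletons or again in \<Gamma>.

  For general k, a tree that contains another tree of at least half its size is built from that one.
  The other trees are grouped greedily into triples whose common intersection contains at least half
  of each of them; a triple costs at most 2k gates. For the u trees that remain, no label outside the
  family can be the larger child of three of them, so \<Gamma> has at least u/2 labels that are not trees,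
  and this pays for building these u trees from scratch.

  For k \<le> 4, the quadruples without a triple among the trees are treated in three phases. First,
  triples contained in at least three remaining quadruples are built and these quadruples are put on
  top of them. Second, starting from all pairs, pairs that are completed to a remaining quadruple by
  fewer than five available partners are discarded until the family is stable. Double counting
  bounds the number of surviving pairs, and a degeneracy argument bounds how many quadruples an
  optimal solution splits into two pairs that do not both survive. Third, the trees that still
  contain no available pair are covered by pairs that contain 5, 4, 3, 2 and finally 1 of the
  uncovered trees. The price 1/j of a tree covered at threshold j is charged to the pairs of \<Gamma>; a
  quadruple that \<Gamma> splits into two pairs charges half to each.
\<close>

section \<open>Polynomial-time computable functions\<close>

text \<open>Every solution has a gate for each tree with at least two elements, so the last gate of
  a tree is never wasted. What must be compared are the other labels; those in
  \<open>\<Gamma>\<close> are called hidden below. The difficult quadruples are the ones that an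
  optimal solution splits into two pairs: each such pair may serve many quadruples, whereas a single
  covering pair forces a second gate on every quadruple above it. So pairs are bought in bulk, with
  both halves of a quadruple present, at no more than 6/5 pairs outside the optimal solution per
  completed quadruple. The threshold five balances this price against the losses. As 1/2 + 1/3 + 1/4
  + 1/5 = 77/60, a hidden pair that does not survive owes half of this, 77/120, for the cover and
  3/10 for each of four lost quadruples, which stays below 19/10; a hidden triple owes 1/2 plus
  twice 3/5. The value 19/10 itself is the allowance of a remaining quadruple, one gate plus 9/10,
  while a quadruple of the first phase costs 5/3. For k = 3 the same program is used: only the cover
  is active, and no rate exceeds 77/60 < 4/3.\<close>

class enc =
  fixes enc :: "'a \<Rightarrow> data"
  assumes enc_inject: "enc x = enc y \<longleftrightarrow> x = y"

lemma enc_bool_inject: "enc_bool b = enc_bool c \<longleftrightarrow> b = c"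
  by (simp add: enc_bool_def)

lemma enc_nat_inject: "enc_nat m = enc_nat n \<longleftrightarrow> m = n"
proof (induction m arbitrary: n rule: less_induct)
  case (less m)
  show ?case
  proof (cases "m = 0 \<or> n = 0")
    case True
    then show ?thesis by (auto simp: enc_nat.simps[of m] enc_nat.simps[of n])
  next
    case False
    then have "enc_nat (m div 2) = enc_nat (n div 2) \<longleftrightarrow> m div 2 = n div 2"
      by (intro less.IH) simp
    then have "enc_nat m = enc_nat n \<longleftrightarrow> odd m = odd n \<and> m div 2 = n div 2"
      using False by (simp add: enc_nat.simps[of m] enc_nat.simps[of n] enc_bool_inject)
    also have "\<dots> \<longleftrightarrow> m = n"
      by (metis dvd_mult_div_cancel odd_two_times_div_two_succ)
    finally show ?thesis .
  qed
qed

lemma enc_list_inject: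
  assumes "\<And>x y. f x = f y \<longleftrightarrow> x = y"
  shows "enc_list f xs = enc_list f ys \<longleftrightarrow> xs = ys"
proof (induction xs arbitrary: ys)
  case Nil
  then show ?case by (cases ys) auto
next
  case (Cons x xs)
  then show ?case by (cases ys) (auto simp: assms)
qed

instantiation bool :: enc
begin
definition bool_enc: "enc = enc_bool"
instance by standard (simp add: bool_enc enc_bool_inject)
end

instantiation nat :: enc
begin
definition nat_enc: "enc = enc_nat"
instance by standard (simp add: nat_enc enc_nat_inject)
end

instantiation prod :: (enc, enc) enc
begin
primrec enc_prod :: "'a \<times> 'b \<Rightarrow> data" where "enc_prod (a, b) = Node (enc a) (enc b)"
instance by standard (auto simp: enc_inject split: prod.splits)
end

instantiation list :: (enc) enc
begin
definition list_enc: "enc = enc_list enc"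
instance by standard (simp add: list_enc enc_list_inject enc_inject)
end


instantiation vertex :: enc
begin
definition vertex_enc: "enc = enc_vertex"
instance
proof
  fix v w :: vertex
  show "enc v = enc w \<longleftrightarrow> v = w"
    by (cases v; cases w) (auto simp: vertex_enc enc_nat_inject enc_bool_inject)
qed
end

lemma enc_Nil [simp]: "enc [] = Leaf" and enc_Cons [simp]: "enc (x # xs) = Node (enc x) (enc xs)"
  by (simp_all add: list_enc)

lemma enc_True [simp]: "enc True = Node Leaf Leaf" and enc_False [simp]: "enc False = Leaf"
  by (simp_all add: bool_enc enc_bool_def)

section \<open>Sizes of encodings and polynomially bounded functions\<close>

abbreviation esize :: "'a::enc \<Rightarrow> nat" where
  "esize a \<equiv> dsize (enc a)"

lemma dsize_pos [simp]: "0 < dsize d"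
  by (cases d) auto

definition poly_bounded :: "(nat \<Rightarrow> nat) \<Rightarrow> bool" where
  "poly_bounded g \<longleftrightarrow> (\<exists>p :: nat poly. \<forall>n. g n \<le> poly p n)"

lemma poly_nat_mono: "m \<le> n \<Longrightarrow> poly p m \<le> poly p n" for p :: "nat poly"
  by (induction p) (auto intro!: add_mono mult_mono)

lemma poly_bounded_const: "poly_bounded (\<lambda>_. c)"
  unfolding poly_bounded_def by (rule exI[of _ "[:c:]"]) simp

lemma poly_bounded_id: "poly_bounded (\<lambda>n. n)"
  unfolding poly_bounded_def by (rule exI[of _ "[:0, 1:]"]) simp

lemma poly_bounded_add: "poly_bounded f \<Longrightarrow> poly_bounded g \<Longrightarrow> poly_bounded (\<lambda>n. f n + g n)"
  unfolding poly_bounded_def by (metis add_mono poly_add)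

lemma poly_bounded_mult: "poly_bounded f \<Longrightarrow> poly_bounded g \<Longrightarrow> poly_bounded (\<lambda>n. f n * g n)"
  unfolding poly_bounded_def by (metis mult_le_mono poly_mult)

lemma poly_bounded_poly: "poly_bounded g \<Longrightarrow> poly_bounded (\<lambda>n. poly p (g n))"
  unfolding poly_bounded_def by (metis order_trans poly_nat_mono poly_pcompose)

lemma poly_bounded_Suc: "poly_bounded f \<Longrightarrow> poly_bounded (\<lambda>n. Suc (f n))"
  using poly_bounded_add[OF poly_bounded_const[of 1]] by simp

lemmas poly_bounded_intros = poly_bounded_const poly_bounded_id poly_bounded_add
  poly_bounded_mult poly_bounded_poly poly_bounded_Suc

text \<open>The bound \<open>b\<close> covers the running time together with the size of the result,
  so one polynomial also controls the input of whatever runs next.\<close>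

abbreviation leaves :: "com \<Rightarrow> state \<Rightarrow> nat \<Rightarrow> data \<Rightarrow> nat \<Rightarrow> bool" where
  "leaves c s k d b \<equiv>
     \<exists>t s'. exec c s t s' \<and> s' k = d \<and> (\<forall>x<k. s' x = s x) \<and> t + dsize d \<le> b"

abbreviation computes :: "com \<Rightarrow> nat \<Rightarrow> nat \<Rightarrow> ('a::enc \<Rightarrow> 'b::enc) \<Rightarrow> (nat \<Rightarrow> nat) \<Rightarrow> bool" where
  "computes c k m f g \<equiv> \<forall>s a. s k = enc a \<longrightarrow> leaves c s m (enc (f a)) (g (esize a))"

text \<open>
  For every register the function has a program that works on that register in place, uses only
  larger registers as scratch memory and preserves all smaller ones. The quantification over the
  register is what makes programs composable.
\<close>

definition ptime :: "('a::enc \<Rightarrow> 'b::enc) \<Rightarrow> bool" where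
  "ptime f \<longleftrightarrow> (\<exists>p :: nat poly. \<forall>k. \<exists>c. computes c k k f (poly p))"

lemma ptimeI:
  assumes "poly_bounded g"
    and "\<And>k. \<exists>c. computes c k k f g"
  shows "ptime f"
proof -
  from assms(1) obtain p :: "nat poly" where p: "\<And>n. g n \<le> poly p n"
    by (auto simp: poly_bounded_def)
  show ?thesis
    unfolding ptime_def
  proof (intro exI[of _ p] allI)
    fix k
    show "\<exists>c. computes c k k f (poly p)"
      using assms(2)[of k] p by (meson order_trans)
  qed
qed

text \<open>Copying the argument to a larger register first keeps the original intact. This is how
  several functions of the same argument are evaluated one after another.\<close>

lemma ptime_into:
  fixes f :: "'a::enc \<Rightarrow> 'b::enc"
  assumes "ptime f"
  obtains p :: "nat poly" where "\<And>k m. k < m \<Longrightarrow> \<exists>c. computes c k m f (poly p)"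
proof -
  from assms obtain q :: "nat poly" where q: "\<And>k. \<exists>c. computes c k k f (poly q)"
    unfolding ptime_def by blast
  \<comment> \<open>\<open>[:2, 1:]\<close> is the polynomial 2 + n: 1 + n for the copy and 1 for
    the sequencing.\<close>
  show thesis
  proof (rule that[of "q + [:2, 1:]"])
    fix k m :: nat
    assume "k < m"
    from q[of m] obtain c where c: "\<And>s a. s m = enc a \<Longrightarrow>
     leaves c s m (enc (f a)) (poly q (esize a))" by blast
    show "\<exists>c. \<forall>s a. s k = enc a \<longrightarrow>
     leaves c s m (enc (f a)) (poly (q + [:2, 1:]) (esize a))"
    proof (intro exI[of _ "Seq (Assign m (Var k)) c"] allI impI)
      fix s :: state and a :: 'a
      assume s: "s k = enc a"
      define s1 where "s1 = s(m := enc a)"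
      have 1: "exec (Assign m (Var k)) s (1 + esize a) s1"
        using Assign[of m "Var k" s] by (simp add: s s1_def)
      obtain t s' where t: "exec c s1 t s'" "s' m = enc (f a)" "\<forall>x<m. s' x = s1 x"
        "t + esize (f a) \<le> poly q (esize a)"
        using c[of s1 a] by (auto simp: s1_def)
      show "leaves (Seq (Assign m (Var k)) c) s m (enc (f a)) (poly (q + [:2, 1:]) (esize a))"
        using exec.Seq[OF 1 t(1)] t
        by (intro exI conjI) (assumption, auto simp: s1_def)
    qed
  qed
qed

text \<open>Programs only see encodings. Hence a function may be exchanged for one of another type
  with equal encodings, such as a vertex for a tagged tuple or a number for its list of
  bits.\<close>

lemma ptime_coerce: "ptime f \<Longrightarrow> (\<And>a. enc (g a) = enc (f a)) \<Longrightarrow> ptime g"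
  unfolding ptime_def by simp

lemma ptime_id: "ptime (\<lambda>a. a)"
proof (rule ptimeI[where g = "\<lambda>n. 1 + n"])
  fix k
  show "\<exists>c. \<forall>s a. s k = enc a \<longrightarrow>
     leaves c s k (enc a) (1 + esize a)"
    by (intro exI[of _ Skip] allI impI exI conjI) (rule Skip, auto)
qed (intro poly_bounded_intros)

lemma ptime_comp:
  fixes f :: "'a::enc \<Rightarrow> 'b::enc" and g :: "'b \<Rightarrow> 'c::enc"
  assumes g: "ptime g" and f: "ptime f"
  shows "ptime (\<lambda>a. g (f a))"
proof -
  from g obtain p :: "nat poly" where p: "\<And>k. \<exists>c. computes c k k g (poly p)"
    unfolding ptime_def by blast
  from f obtain q :: "nat poly" where q: "\<And>k. \<exists>c. computes c k k f (poly q)"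
    unfolding ptime_def by blast
  show ?thesis
  proof (rule ptimeI[where g = "\<lambda>n. 1 + poly q n + poly p (poly q n)"])
    fix k
    from p[of k] obtain cg where cg: "\<And>s a. s k = enc a \<Longrightarrow>
      leaves cg s k (enc (g a)) (poly p (esize a))" by blast
    from q[of k] obtain cf where cf: "\<And>s a. s k = enc a \<Longrightarrow>
      leaves cf s k (enc (f a)) (poly q (esize a))" by blast
    show "\<exists>c. \<forall>s a. s k = enc a \<longrightarrow>
     leaves c s k (enc (g (f a))) (1 + poly q (esize a) + poly p (poly q (esize a)))"
    proof (intro exI[of _ "Seq cf cg"] allI impI)
      fix s :: state and a :: 'a
      assume "s k = enc a"
      from cf[of s a, OF this] obtain t1 s1 where 1: "exec cf s t1 s1" "s1 k = enc (f a)"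
        "\<forall>x<k. s1 x = s x" "t1 + esize (f a) \<le> poly q (esize a)" by blast
      from cg[of s1 "f a", OF 1(2)] obtain t2 s2 where 2: "exec cg s1 t2 s2" "s2 k = enc (g (f a))"
        "\<forall>x<k. s2 x = s1 x" "t2 + esize (g (f a)) \<le> poly p (esize (f a))" by blast
      have "poly p (esize (f a)) \<le> poly p (poly q (esize a))"
        using 1(4) by (intro poly_nat_mono) simp
      then show "leaves (Seq cf cg) s k
          (enc (g (f a))) (1 + poly q (esize a) + poly p (poly q (esize a)))"
        using exec.Seq[OF 1(1) 2(1)] 1 2
        by (intro exI conjI) (assumption, auto)
    qed
  qed (intro poly_bounded_intros)
qed

text \<open>One program scheme for all primitive expressions: the operands are computed into
  registers \<open>k + 1\<close> and \<open>k + 2\<close> and combined by \<open>E\<close>. Unary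
  primitives and the constant fit in by ignoring operands; the factor 4 is generous enough for each
  of them.\<close>

lemma ptime_exp:
  fixes f :: "'a::enc \<Rightarrow> 'b::enc" and g :: "'a \<Rightarrow> 'c::enc" and r :: "'a \<Rightarrow> 'd::enc"
  assumes f: "ptime f" and g: "ptime g"
    and ev: "\<And>i j s. eval_exp (E i j) s = h (s i) (s j)"
    and cost: "\<And>i j s. exp_cost (E i j) s \<le> 4 * (dsize (s i) + dsize (s j))"
    and hsize: "\<And>d d'. dsize (h d d') \<le> 4 * (dsize d + dsize d')"
    and r: "\<And>a. enc (r a) = h (enc (f a)) (enc (g a))"
  shows "ptime r"
proof -
  from ptime_into[OF f] obtain p :: "nat poly" where p: "\<And>k m. k < m \<Longrightarrow> \<exists>c. computes c k m f (poly p)" by blast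
  from ptime_into[OF g] obtain q :: "nat poly" where q: "\<And>k m. k < m \<Longrightarrow> \<exists>c. computes c k m g (poly q)" by blast
  show ?thesis
  proof (rule ptimeI[where g = "\<lambda>n. 3 + 8 * (poly p n + poly q n)"])
    fix k
    from p[of k "k + 1"] obtain cf where cf: "\<And>s a. s k = enc a \<Longrightarrow>
      leaves cf s (k + 1) (enc (f a)) (poly p (esize a))" by auto
    from q[of k "k + 2"] obtain cg where cg: "\<And>s a. s k = enc a \<Longrightarrow>
      leaves cg s (k + 2) (enc (g a)) (poly q (esize a))" by auto
    show "\<exists>c. \<forall>s a. s k = enc a \<longrightarrow>
     leaves c s k (enc (r a)) (3 + 8 * (poly p (esize a) + poly q (esize a)))"
    proof (intro exI[of _ "Seq cf (Seq cg (Assign k (E (k + 1) (k + 2))))"] allI impI)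
      fix s :: state and a :: 'a
      assume s: "s k = enc a"
      from cf[of s a, OF s] obtain t1 s1 where 1: "exec cf s t1 s1" "s1 (k + 1) = enc (f a)"
        "\<forall>x<k+1. s1 x = s x" "t1 + esize (f a) \<le> poly p (esize a)" by blast
      then have "s1 k = enc a" using s by simp
      from cg[of s1 a, OF this] obtain t2 s2 where 2: "exec cg s1 t2 s2" "s2 (k + 2) = enc (g a)"
        "\<forall>x<k+2. s2 x = s1 x" "t2 + esize (g a) \<le> poly q (esize a)" by blast
      have s2: "s2 (k + 1) = enc (f a)" using 1 2 by simp
      define s3 where "s3 = s2(k := enc (r a))"
      have 3: "exec (Assign k (E (k + 1) (k + 2))) s2 (1 + exp_cost (E (k + 1) (k + 2)) s2) s3"
        using Assign[of k "E (k + 1) (k + 2)" s2] 2 s2 by (simp add: s3_def ev r)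
      have "exp_cost (E (k + 1) (k + 2)) s2 \<le> 4 * (esize (f a) + esize (g a))"
        using cost[of "k + 1" "k + 2" s2] 2 s2 by simp
      moreover have "esize (r a) \<le> 4 * (esize (f a) + esize (g a))"
        unfolding r by (rule hsize)
      ultimately show "leaves (Seq cf (Seq cg (Assign k (E (k + 1) (k + 2))))) s k
          (enc (r a)) (3 + 8 * (poly p (esize a) + poly q (esize a)))"
        using exec.Seq[OF 1(1) exec.Seq[OF 2(1) 3]] 1 2
        by (intro exI conjI) (assumption, auto simp: s3_def)
    qed
  qed (intro poly_bounded_intros)
qed

section \<open>Primitive operations and branching\<close>

lemma dsize_hd_data: "dsize (hd_data d) \<le> dsize d"
  by (cases d) auto

lemma dsize_tl_data: "dsize (tl_data d) \<le> dsize d"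
  by (cases d) auto

lemma ptime_hd_data: "ptime f \<Longrightarrow> (\<And>a. enc (r a) = hd_data (enc (f a))) \<Longrightarrow> ptime r"
  by (rule ptime_exp[where f = f and g = f and E = "\<lambda>i j. Hd (Var i)" and h = "\<lambda>d d'. hd_data d"])
    (auto intro: order_trans[OF add_mono[OF le_refl dsize_hd_data]] order_trans[OF dsize_hd_data])

lemma ptime_tl_data: "ptime f \<Longrightarrow> (\<And>a. enc (r a) = tl_data (enc (f a))) \<Longrightarrow> ptime r"
  by (rule ptime_exp[where f = f and g = f and E = "\<lambda>i j. Tl (Var i)" and h = "\<lambda>d d'. tl_data d"])
    (auto intro: order_trans[OF add_mono[OF le_refl dsize_tl_data]] order_trans[OF dsize_tl_data])

lemma ptime_Node:
  "ptime f \<Longrightarrow> ptime g \<Longrightarrow> (\<And>a. enc (r a) = Node (enc (f a)) (enc (g a))) \<Longrightarrow> ptime r"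
proof (rule ptime_exp[where f = f and g = g and E = "\<lambda>i j. Cons_exp (Var i) (Var j)" and h = Node])
  fix i j and s :: state
  show "exp_cost (Cons_exp (Var i) (Var j)) s \<le> 4 * (dsize (s i) + dsize (s j))"
    using dsize_pos[of "s i"] by (simp del: dsize_pos)
next
  fix d d'
  show "dsize (Node d d') \<le> 4 * (dsize d + dsize d')"
    using dsize_pos[of d] by (simp del: dsize_pos)
qed auto

lemma ptime_Leaf: "(\<And>a. enc (r a) = Leaf) \<Longrightarrow> ptime r"
  by (rule ptime_exp[OF ptime_id ptime_id, where E = "\<lambda>i j. Nil_exp" and h = "\<lambda>_ _. Leaf"])
    (auto simp: Suc_le_eq)

lemma ptime_eq: "ptime f \<Longrightarrow> ptime g \<Longrightarrow> ptime (\<lambda>a. f a = g a)"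
proof (rule ptime_exp[where f = f and g = g and E = "\<lambda>i j. Eq (Var i) (Var j)"
      and h = "\<lambda>d d'. enc_bool (d = d')"])
  fix i j and s :: state
  show "exp_cost (Eq (Var i) (Var j)) s \<le> 4 * (dsize (s i) + dsize (s j))"
    using dsize_pos[of "s i"] dsize_pos[of "s j"]
    by (cases "s i = s j") (auto simp: enc_bool_def simp del: dsize_pos)
next
  fix d d'
  show "dsize (enc_bool (d = d')) \<le> 4 * (dsize d + dsize d')"
    using dsize_pos[of d] dsize_pos[of d']
    by (cases "d = d'") (auto simp: enc_bool_def simp del: dsize_pos)
qed (auto simp: bool_enc enc_inject)

lemma ptime_if:
  fixes f :: "'a::enc \<Rightarrow> 'b::enc"
  assumes b: "ptime b" and f: "ptime f" and g: "ptime g"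
  shows "ptime (\<lambda>a. if b a then f a else g a)"
proof -
  from ptime_into[OF b] obtain pb :: "nat poly" where pb: "\<And>k m. k < m \<Longrightarrow> \<exists>c. computes c k m b (poly pb)" by blast
  from f obtain p :: "nat poly" where p: "\<And>k. \<exists>c. computes c k k f (poly p)"
    unfolding ptime_def by blast
  from g obtain q :: "nat poly" where q: "\<And>k. \<exists>c. computes c k k g (poly q)"
    unfolding ptime_def by blast
  show ?thesis
  proof (rule ptimeI[where g = "\<lambda>n. 2 + poly pb n + poly p n + poly q n"])
    fix k
    from pb[of k "k + 1"] obtain cb where cb: "\<And>s a. s k = enc a \<Longrightarrow>
      leaves cb s (k + 1) (enc (b a)) (poly pb (esize a))" by auto
    from p[of k] obtain cf where cf: "\<And>s a. s k = enc a \<Longrightarrow>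
      leaves cf s k (enc (f a)) (poly p (esize a))" by blast
    from q[of k] obtain cg where cg: "\<And>s a. s k = enc a \<Longrightarrow>
      leaves cg s k (enc (g a)) (poly q (esize a))" by blast
    show "\<exists>c. \<forall>s a. s k = enc a \<longrightarrow>
     leaves c s k (enc (if b a then f a else g a)) (2 + poly pb (esize a) + poly p (esize a) + poly q (esize a))"
    proof (intro exI[of _ "Seq cb (Cond (Var (k + 1)) cf cg)"] allI impI)
      fix s :: state and a :: 'a
      assume s: "s k = enc a"
      from cb[of s a, OF s] obtain t1 s1 where 1: "exec cb s t1 s1" "s1 (k + 1) = enc (b a)"
        "\<forall>x<k+1. s1 x = s x" "t1 + esize (b a) \<le> poly pb (esize a)" by blast
      then have s1: "s1 k = enc a" using s by simp
      show "leaves (Seq cb (Cond (Var (k + 1)) cf cg)) s k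
          (enc (if b a then f a else g a)) (2 + poly pb (esize a) + poly p (esize a) + poly q (esize a))"
      proof (cases "b a")
        case True
        from cf[of s1 a, OF s1] obtain t2 s2 where 2: "exec cf s1 t2 s2" "s2 k = enc (f a)"
          "\<forall>x<k. s2 x = s1 x" "t2 + esize (f a) \<le> poly p (esize a)" by blast
        have "exec (Cond (Var (k + 1)) cf cg) s1 (1 + exp_cost (Var (k + 1)) s1 + t2) s2"
          by (rule CondTrue) (use 1 2 True in auto)
        from exec.Seq[OF 1(1) this] show ?thesis
          using 1 2 True by (intro exI conjI) (assumption, auto)
      next
        case False
        from cg[of s1 a, OF s1] obtain t2 s2 where 2: "exec cg s1 t2 s2" "s2 k = enc (g a)"
          "\<forall>x<k. s2 x = s1 x" "t2 + esize (g a) \<le> poly q (esize a)" by blast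
        have "exec (Cond (Var (k + 1)) cf cg) s1 (1 + exp_cost (Var (k + 1)) s1 + t2) s2"
          by (rule CondFalse) (use 1 2 False in auto)
        from exec.Seq[OF 1(1) this] show ?thesis
          using 1 2 False by (intro exI conjI) (assumption, auto)
      qed
    qed
  qed (intro poly_bounded_intros)
qed

section \<open>Loops whose accumulators stay small\<close>

lemma length_le_dsize: "length xs \<le> esize xs"
  by (induction xs) auto

lemma dsize_enc_mem: "x \<in> set xs \<Longrightarrow> esize x \<le> esize xs"
  by (induction xs) auto

text \<open>Register \<open>k\<close> holds the environment, \<open>k + 1\<close> the unread part of
  the list, \<open>k + 2\<close> the accumulator, and \<open>k + 3\<close> first the argument and
  then the result of a step.\<close>

definition fold_body :: "nat \<Rightarrow> com \<Rightarrow> com" where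
  "fold_body k c = Seq (Assign (k + 3) (Cons_exp (Var k) (Cons_exp (Hd (Var (k + 1))) (Var (k + 2)))))
     (Seq c (Seq (Assign (k + 2) (Var (k + 3))) (Assign (k + 1) (Tl (Var (k + 1))))))"

text \<open>\<open>X\<close> bounds the unread list and \<open>G\<close> every accumulator that
  really occurs, so each round costs at most the amount in brackets. The extra round in
  \<open>length xs + 1\<close> pays for the final test.\<close>

lemma exec_fold:
  assumes c: "\<And>s x a. s (k + 3) = enc (e, x, a) \<Longrightarrow>
      leaves c s (k + 3) (enc (F e x a)) (poly p (esize (e, x, a)))"
    and "\<And>i. i \<le> length xs \<Longrightarrow> esize (fold (F e) (take i xs) a) \<le> G"
    and "esize xs \<le> X"
    and "s k = enc e" "s (k + 1) = enc xs" "s (k + 2) = enc a"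
  shows "\<exists>t s'. exec (While (Var (k + 1)) (fold_body k c)) s t s' \<and>
     s' (k + 2) = enc (fold (F e) xs a) \<and> (\<forall>y\<le>k. s' y = s y) \<and>
     t \<le> (length xs + 1) * (20 + 2 * esize e + 8 * X + 5 * G + poly p (esize e + X + G + 2))"
  using assms(2-6)
proof (induction xs arbitrary: a s)
  case Nil
  have "exec (While (Var (k + 1)) (fold_body k c)) s (1 + exp_cost (Var (k + 1)) s) s"
    by (rule WhileFalse) (use Nil in auto)
  then show ?case
    using Nil by (intro exI conjI) (assumption, auto)
next
  case (Cons x xs)
  define B where
    "B = 20 + 2 * esize e + 8 * X + 5 * G + poly p (esize e + X + G + 2)"
  note X = Cons.prems(2)
  have xX: "esize x \<le> X" "esize xs \<le> X" using X by auto
  have aG: "esize a \<le> G" using Cons.prems(1)[of 0] by simp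
  have G': "esize (F e x a) \<le> G" using Cons.prems(1)[of 1] by simp
  define s1 where "s1 = s(k + 3 := enc (e, x, a))"
  have 1: "exec (Assign (k + 3) (Cons_exp (Var k) (Cons_exp (Hd (Var (k + 1))) (Var (k + 2))))) s
     (1 + exp_cost (Cons_exp (Var k) (Cons_exp (Hd (Var (k + 1))) (Var (k + 2)))) s) s1"
    using Assign[of "k + 3" "Cons_exp (Var k) (Cons_exp (Hd (Var (k + 1))) (Var (k + 2)))" s]
      Cons.prems by (simp add: s1_def)
  from c[of s1] obtain t2 s2 where 2: "exec c s1 t2 s2" "s2 (k + 3) = enc (F e x a)"
    "\<forall>y<k+3. s2 y = s1 y" "t2 + esize (F e x a) \<le> poly p (esize (e, x, a))"
    by (fastforce simp: s1_def)
  have t2: "t2 \<le> poly p (esize e + X + G + 2)"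
    using 2(4) poly_nat_mono[of "esize (e, x, a)" "esize e + X + G + 2" p] xX aG by auto
  define s3 where "s3 = s2(k + 2 := enc (F e x a))"
  have 3: "exec (Assign (k + 2) (Var (k + 3))) s2 (1 + esize (F e x a)) s3"
    using Assign[of "k + 2" "Var (k + 3)" s2] 2 by (simp add: s3_def)
  define s4 where "s4 = s3(k + 1 := enc xs)"
  have s3k: "s3 (k + 1) = enc (x # xs)"
    using 2(3) Cons.prems by (simp add: s3_def s1_def)
  have 4: "exec (Assign (k + 1) (Tl (Var (k + 1)))) s3 (1 + exp_cost (Tl (Var (k + 1))) s3) s4"
    using Assign[of "k + 1" "Tl (Var (k + 1))" s3] s3k by (simp add: s4_def)
  define tb where "tb = 1 + (1 + exp_cost (Cons_exp (Var k) (Cons_exp (Hd (Var (k + 1))) (Var (k + 2)))) s) +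
      (1 + t2 + (1 + (1 + esize (F e x a)) + (1 + exp_cost (Tl (Var (k + 1))) s3)))"
  have body: "exec (fold_body k c) s tb s4"
    unfolding fold_body_def tb_def by (rule exec.Seq[OF 1 exec.Seq[OF 2(1) exec.Seq[OF 3 4]]])
  have "s4 k = enc e" "s4 (k + 1) = enc xs" "s4 (k + 2) = enc (F e x a)"
    using Cons.prems 2 by (auto simp: s4_def s3_def s1_def)
  moreover have "esize (fold (F e) (take i xs) (F e x a)) \<le> G" if "i \<le> length xs" for i
    using Cons.prems(1)[of "Suc i"] that by simp
  ultimately obtain t5 s5 where 5: "exec (While (Var (k + 1)) (fold_body k c)) s4 t5 s5"
     "s5 (k + 2) = enc (fold (F e) xs (F e x a))" "\<forall>y\<le>k. s5 y = s4 y"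
     "t5 \<le> (length xs + 1) * B"
    using Cons.IH[of "F e x a" s4] xX unfolding B_def by blast
  have W: "exec (While (Var (k + 1)) (fold_body k c)) s (1 + exp_cost (Var (k + 1)) s + tb + t5) s5"
    by (rule WhileTrue[OF _ body 5(1)]) (use Cons.prems in auto)
  have "1 + exp_cost (Var (k + 1)) s + tb \<le> B"
    using Cons.prems(2-) s3k xX aG G' t2 unfolding B_def tb_def by simp
  then have "1 + exp_cost (Var (k + 1)) s + tb + t5 \<le> (length (x # xs) + 1) * B"
    using 5(4) by simp
  moreover have "\<forall>y\<le>k. s5 y = s y"
    using 5(3) 2(3) by (auto simp: s4_def s3_def s1_def)
  ultimately show ?case
    using W 5(2) unfolding B_def by (intro exI conjI) (assumption, auto)
qed

text \<open>Iterating a polynomial-time step need not be polynomial, since the accumulator could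
  grow geometrically. The bound after every prefix excludes exactly this.\<close>

lemma ptime_fold_bound:
  fixes xs :: "'e::enc \<Rightarrow> 'a::enc list" and a :: "'e \<Rightarrow> 'b::enc"
  assumes F: "ptime (\<lambda>p. F (fst p) (fst (snd p)) (snd (snd p)))" and xs: "ptime xs" and a: "ptime a"
    and g: "poly_bounded g"
    and bound: "\<And>e i. i \<le> length (xs e) \<Longrightarrow>
      esize (fold (F e) (take i (xs e)) (a e)) \<le> g (esize e)"
  shows "ptime (\<lambda>e. fold (F e) (xs e) (a e))"
proof -
  from F obtain p :: "nat poly" where p: "\<And>k. \<exists>c. \<forall>s a. s k = enc a \<longrightarrow>
     leaves c s k (enc (F (fst a) (fst (snd a)) (snd (snd a)))) (poly p (esize a))"
    unfolding ptime_def by blast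
  from ptime_into[OF xs] obtain q :: "nat poly" where q: "\<And>k m. k < m \<Longrightarrow> \<exists>c. computes c k m xs (poly q)" by blast
  from ptime_into[OF a] obtain r :: "nat poly" where r: "\<And>k m. k < m \<Longrightarrow> \<exists>c. computes c k m a (poly r)" by blast
  from g obtain G :: "nat poly" where G: "\<And>n. g n \<le> poly G n"
    by (auto simp: poly_bounded_def)
  let ?g = "\<lambda>n. 4 + 2 * poly G n + poly q n + poly r n + (poly q n + 1) *
    (20 + 2 * n + 8 * poly q n + 5 * poly G n + poly p (n + poly q n + poly G n + 2))"
  show ?thesis
  proof (rule ptimeI[where g = ?g])
    fix k
    from p[of "k + 3"] obtain c where "\<And>s a. s (k + 3) = enc a \<Longrightarrow>
      leaves c s (k + 3) (enc (F (fst a) (fst (snd a)) (snd (snd a)))) (poly p (esize a))" by blast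
    from this[of _ "(e, x, a)" for e x a] have c: "\<And>s e x a. s (k + 3) = enc (e, x, a) \<Longrightarrow>
      leaves c s (k + 3) (enc (F e x a)) (poly p (esize (e, x, a)))" by simp
    from q[of k "k + 1"] obtain cx where cx: "\<And>s e. s k = enc e \<Longrightarrow>
      leaves cx s (k + 1) (enc (xs e)) (poly q (esize e))" by auto
    from r[of k "k + 2"] obtain ca where ca: "\<And>s e. s k = enc e \<Longrightarrow>
      leaves ca s (k + 2) (enc (a e)) (poly r (esize e))" by auto
    let ?W = "While (Var (k + 1)) (fold_body k c)"
    show "\<exists>c. \<forall>s e. s k = enc e \<longrightarrow>
     leaves c s k (enc (fold (F e) (xs e) (a e))) (?g (esize e))"
    proof (intro exI[of _ "Seq cx (Seq ca (Seq ?W (Assign k (Var (k + 2)))))"] allI impI)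
      fix s :: state and e :: 'e
      assume s: "s k = enc e"
      define D where "D = esize e"
      define B where "B = 20 + 2 * D + 8 * poly q D + 5 * poly G D + poly p (D + poly q D + poly G D + 2)"
      from cx[of s e, OF s] obtain t1 s1 where 1: "exec cx s t1 s1" "s1 (k + 1) = enc (xs e)"
        "\<forall>x<k+1. s1 x = s x" "t1 + esize (xs e) \<le> poly q D" unfolding D_def by blast
      then have s1: "s1 k = enc e" using s by simp
      from ca[of s1 e, OF s1] obtain t2 s2 where 2: "exec ca s1 t2 s2" "s2 (k + 2) = enc (a e)"
        "\<forall>x<k+2. s2 x = s1 x" "t2 + esize (a e) \<le> poly r D" unfolding D_def by blast
      have s2: "s2 k = enc e" "s2 (k + 1) = enc (xs e)" using 1 2 s1 by simp_all
      have bd: "esize (fold (F e) (take i (xs e)) (a e)) \<le> poly G D" if "i \<le> length (xs e)" for i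
        using bound[OF that] G[of D] by (simp add: D_def)
      obtain t3 s3 where 3: "exec ?W s2 t3 s3" "s3 (k + 2) = enc (fold (F e) (xs e) (a e))"
        "\<forall>y\<le>k. s3 y = s2 y" "t3 \<le> (length (xs e) + 1) * B"
        using exec_fold[of k e c F p "xs e" "a e" "poly G D" "poly q D" s2, OF c bd] 1(4) s2 2(2)
        unfolding B_def D_def by (metis add_leD2)
      define s4 where "s4 = s3(k := enc (fold (F e) (xs e) (a e)))"
      have 4: "exec (Assign k (Var (k + 2))) s3 (1 + esize (fold (F e) (xs e) (a e))) s4"
        using Assign[of k "Var (k + 2)" s3] 3 by (simp add: s4_def)
      have sz: "esize (fold (F e) (xs e) (a e)) \<le> poly G D"
        using bd[of "length (xs e)"] by simp
      have "length (xs e) \<le> poly q D" using 1(4) length_le_dsize[of "xs e"] by simp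
      then have "(length (xs e) + 1) * B \<le> (poly q D + 1) * B" by (intro mult_right_mono) auto
      with 3(4) have t3: "t3 \<le> (poly q D + 1) * B" by (rule order_trans)
      have "leaves (Seq cx (Seq ca (Seq ?W (Assign k (Var (k + 2)))))) s k
          (enc (fold (F e) (xs e) (a e))) (4 + 2 * poly G D + poly q D + poly r D + (poly q D + 1) * B)"
        using exec.Seq[OF 1(1) exec.Seq[OF 2(1) exec.Seq[OF 3(1) 4]]] 1 2 3 sz t3
        by (intro exI conjI) (assumption, auto simp: s4_def)
      then show "leaves (Seq cx (Seq ca (Seq ?W (Assign k (Var (k + 2)))))) s k
          (enc (fold (F e) (xs e) (a e))) (?g (esize e))"
        unfolding B_def D_def .
    qed
  qed (intro poly_bounded_intros)
qed

named_theorems ptime_intros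

declare ptime_id [ptime_intros] ptime_eq [ptime_intros] ptime_if [ptime_intros]

lemma ptime_pair [ptime_intros]: "ptime f \<Longrightarrow> ptime g \<Longrightarrow> ptime (\<lambda>a. (f a, g a))"
  by (rule ptime_Node[of f g]) auto

lemma ptime_fst [ptime_intros]: "ptime f \<Longrightarrow> ptime (\<lambda>a. fst (f a))"
proof (rule ptime_hd_data[of f])
  show "enc (fst (f a)) = hd_data (enc (f a))" for a by (cases "f a") simp
qed

lemma ptime_snd [ptime_intros]: "ptime f \<Longrightarrow> ptime (\<lambda>a. snd (f a))"
proof (rule ptime_tl_data[of f])
  show "enc (snd (f a)) = tl_data (enc (f a))" for a by (cases "f a") simp
qed

lemma ptime_Nil [ptime_intros]: "ptime (\<lambda>_. [])"
  by (rule ptime_Leaf) simp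

lemma ptime_Cons [ptime_intros]: "ptime f \<Longrightarrow> ptime g \<Longrightarrow> ptime (\<lambda>a. f a # g a)"
  by (rule ptime_Node[of f g]) auto

lemma ptime_tl [ptime_intros]: "ptime f \<Longrightarrow> ptime (\<lambda>a. tl (f a))"
proof (rule ptime_tl_data[of f])
  show "enc (tl (f a)) = tl_data (enc (f a))" for a by (cases "f a") simp_all
qed

lemma ptime_False [ptime_intros]: "ptime (\<lambda>_. False)"
  by (rule ptime_Leaf) simp

lemma ptime_True [ptime_intros]: "ptime (\<lambda>_. True)"
  by (rule ptime_Node[OF ptime_False ptime_False]) simp

lemma ptime_not [ptime_intros]: "ptime f \<Longrightarrow> ptime (\<lambda>a. \<not> f a)"
  by (rule ptime_coerce[of "\<lambda>a. if f a then False else True"]) ((intro ptime_intros)+, auto)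

lemma ptime_conj [ptime_intros]: "ptime f \<Longrightarrow> ptime g \<Longrightarrow> ptime (\<lambda>a. f a \<and> g a)"
  by (rule ptime_coerce[of "\<lambda>a. if f a then g a else False"]) ((intro ptime_intros)+, auto)

lemma ptime_disj [ptime_intros]: "ptime f \<Longrightarrow> ptime g \<Longrightarrow> ptime (\<lambda>a. f a \<or> g a)"
  by (rule ptime_coerce[of "\<lambda>a. if f a then True else g a"]) ((intro ptime_intros)+, auto)

text \<open>Curried functions are treated in tupled form; this rule substitutes computed arguments
  into them and thereby makes the composition rules applicable to definitions with
  parameters.\<close>

lemma ptime2:
  "ptime (\<lambda>p. h (fst p) (snd p)) \<Longrightarrow> ptime f \<Longrightarrow> ptime g \<Longrightarrow> ptime (\<lambda>a. h (f a) (g a))"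
  using ptime_comp[of "\<lambda>p. h (fst p) (snd p)" "\<lambda>a. (f a, g a)"] ptime_pair by fastforce

lemma ptime3:
  assumes "ptime (\<lambda>p. h (fst p) (fst (snd p)) (snd (snd p)))" "ptime f" "ptime g" "ptime k"
  shows "ptime (\<lambda>a. h (f a) (g a) (k a))"
  using ptime_comp[OF assms(1) ptime_pair[OF assms(2) ptime_pair[OF assms(3,4)]]] by simp

lemma ptime_dsize:
  assumes "ptime f"
  obtains p :: "nat poly" where "\<And>a. esize (f a) \<le> poly p (esize a)"
proof -
  from assms obtain p :: "nat poly" and c where p: "\<And>s a. s 0 = enc a \<Longrightarrow>
     leaves c s 0 (enc (f a)) (poly p (esize a))"
    unfolding ptime_def by blast
  show thesis
  proof (rule that)
    fix a
    show "esize (f a) \<le> poly p (esize a)"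
      using p[of "\<lambda>_. enc a" a] by auto
  qed
qed

text \<open>If each step adds an amount that depends on the environment alone, the total growth is
  at most that amount times the length of the list, hence polynomial.\<close>

lemma ptime_fold:
  assumes F: "ptime (\<lambda>p. F (fst p) (fst (snd p)) (snd (snd p)))" and xs: "ptime xs" and a: "ptime a"
    and g: "poly_bounded g"
    and bound: "\<And>e x acc. x \<in> set (xs e) \<Longrightarrow>
      esize (F e x acc) \<le> esize acc + g (esize e)"
  shows "ptime (\<lambda>e. fold (F e) (xs e) (a e))"
proof -
  obtain q :: "nat poly" where q: "\<And>e. esize (xs e) \<le> poly q (esize e)"
    using ptime_dsize[OF xs] by blast
  obtain r :: "nat poly" where r: "\<And>e. esize (a e) \<le> poly r (esize e)"
    using ptime_dsize[OF a] by blast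
  show ?thesis
  proof (rule ptime_fold_bound[OF F xs a, where g = "\<lambda>n. poly r n + poly q n * g n"])
    show "poly_bounded (\<lambda>n. poly r n + poly q n * g n)"
      by (intro poly_bounded_intros g)
    fix e i
    assume i: "i \<le> length (xs e)"
    have "esize (fold (F e) ys acc) \<le> esize acc + length ys * g (esize e)"
      if "set ys \<subseteq> set (xs e)" for ys acc
      using that
    proof (induction ys arbitrary: acc)
      case (Cons y ys)
      have "esize (fold (F e) ys (F e y acc)) \<le>
          esize (F e y acc) + length ys * g (esize e)"
        using Cons.prems by (intro Cons.IH) auto
      also have "\<dots> \<le> esize acc + g (esize e) + length ys * g (esize e)"
        using Cons.prems bound by (intro add_right_mono) auto
      finally show ?case by simp
    qed simp
    from this[of "take i (xs e)" "a e"]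
    have "esize (fold (F e) (take i (xs e)) (a e)) \<le> esize (a e) + i * g (esize e)"
      using i by (auto simp: set_take_subset)
    also have "\<dots> \<le> poly r (esize e) + poly q (esize e) * g (esize e)"
      using i r[of e] q[of e] length_le_dsize[of "xs e"] by (intro add_mono mult_right_mono) auto
    finally show "esize (fold (F e) (take i (xs e)) (a e)) \<le> \<dots>" .
  qed
qed

lemma poly_bounded_dsize:
  assumes "ptime f"
  obtains g where "poly_bounded g" "\<And>a. esize (f a) \<le> g (esize a)" "mono g"
proof -
  from ptime_dsize[OF assms] obtain p :: "nat poly"
    where "\<And>a. esize (f a) \<le> poly p (esize a)" by blast
  moreover have "poly_bounded (poly p)"
    by (intro poly_bounded_intros)
  ultimately show thesis
    using that[of "poly p"] by (simp add: monoI poly_nat_mono)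
qed

lemma ptime_fold_const:
  assumes F: "ptime (\<lambda>p. F (fst p) (fst (snd p)) (snd (snd p)))" and xs: "ptime xs" and a: "ptime a"
    and bound: "\<And>e x acc. esize (F e x acc) \<le> esize acc + esize x + c"
  shows "ptime (\<lambda>e. fold (F e) (xs e) (a e))"
proof -
  obtain g where g: "poly_bounded g" "\<And>e. esize (xs e) \<le> g (esize e)"
    using poly_bounded_dsize[OF xs] by blast
  show ?thesis
  proof (rule ptime_fold[OF F xs a, where g = "\<lambda>n. g n + c"])
    show "poly_bounded (\<lambda>n. g n + c)" by (intro poly_bounded_intros g)
    fix e x acc
    assume "x \<in> set (xs e)"
    then have "esize x \<le> g (esize e)"
      using dsize_enc_mem g(2) order_trans by blast
    then show "esize (F e x acc) \<le> esize acc + (g (esize e) + c)"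
      using bound[of e x acc] by simp
  qed
qed

section \<open>List functions obtained by folding\<close>

lemma ptime_rev [ptime_intros]:
  assumes "ptime xs"
  shows "ptime (\<lambda>e. rev (xs e))"
proof -
  have "ptime (\<lambda>e. fold (\<lambda>x acc. x # acc) (xs e) [])"
    by (rule ptime_fold_const[where c = 1]) ((intro ptime_intros assms)+, simp)
  then show ?thesis by (simp add: fold_Cons_rev)
qed

lemma ptime_append [ptime_intros]:
  assumes "ptime xs" "ptime ys"
  shows "ptime (\<lambda>e. xs e @ ys e)"
proof -
  have "ptime (\<lambda>e. fold (\<lambda>x acc. x # acc) (rev (xs e)) (ys e))"
    by (rule ptime_fold_const[where c = 1]) ((intro ptime_intros assms)+, simp)
  then show ?thesis by (simp add: fold_Cons_rev)
qed

lemma dsize_enc_append: "esize (xs @ ys) + 1 = esize xs + esize ys"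
  by (induction xs) auto

lemma dsize_enc_filter: "esize (filter P xs) \<le> esize xs"
  by (induction xs) auto

lemma ptime_concat [ptime_intros]:
  assumes "ptime xs"
  shows "ptime (\<lambda>e. concat (xs e))"
proof -
  have "ptime (\<lambda>e. fold (\<lambda>x acc. acc @ x) (xs e) [])"
  proof (rule ptime_fold_const[where c = 0])
    fix x acc :: "'b list"
    show "esize (acc @ x) \<le> esize acc + esize x + 0"
      using dsize_enc_append[of acc x] by simp
  qed (intro ptime_intros assms)+
  moreover have "fold (\<lambda>x acc. acc @ x) xss acc = acc @ concat xss" for xss and acc :: "'b list"
    by (induction xss arbitrary: acc) auto
  ultimately show ?thesis by simp
qed

lemma ptime_map [ptime_intros]:
  assumes F: "ptime (\<lambda>p. F (fst p) (snd p))" and xs: "ptime xs"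
  shows "ptime (\<lambda>e. map (F e) (xs e))"
proof -
  obtain g where g: "poly_bounded g" "\<And>e. esize (xs e) \<le> g (esize e)"
    using poly_bounded_dsize[OF xs] by blast
  obtain h :: "nat poly" where h: "\<And>p. esize (F (fst p) (snd p)) \<le> poly h (esize p)"
    using ptime_dsize[OF F] by blast
  have "ptime (\<lambda>e. fold (\<lambda>x acc. F e x # acc) (xs e) [])"
  proof (rule ptime_fold[where g = "\<lambda>n. poly h (n + g n + 1) + 1"])
    show "poly_bounded (\<lambda>n. poly h (n + g n + 1) + 1)" by (intro poly_bounded_intros g)
    show "ptime (\<lambda>p. F (fst p) (fst (snd p)) # snd (snd p))"
      by (intro ptime_intros ptime2[OF F])
    fix e x acc
    assume "x \<in> set (xs e)"
    then have "esize x \<le> g (esize e)"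
      using dsize_enc_mem g(2) order_trans by blast
    then have "poly h (esize (e, x)) \<le> poly h (esize e + g (esize e) + 1)"
      by (intro poly_nat_mono) simp
    then show "esize (F e x # acc) \<le>
        esize acc + (poly h (esize e + g (esize e) + 1) + 1)"
      using h[of "(e, x)"] by simp
  qed (intro ptime_intros xs)+
  then have "ptime (\<lambda>e. rev (fold (\<lambda>x acc. F e x # acc) (xs e) []))"
    by (rule ptime_rev)
  moreover have "fold (\<lambda>x acc. F e x # acc) ys acc = rev (map (F e) ys) @ acc" for e ys acc
    by (induction ys arbitrary: acc) auto
  ultimately show ?thesis by simp
qed

lemma ptime_filter [ptime_intros]:
  assumes P: "ptime (\<lambda>p. P (fst p) (snd p))" and xs: "ptime xs"
  shows "ptime (\<lambda>e. filter (P e) (xs e))"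
proof -
  have "ptime (\<lambda>e. rev (fold (\<lambda>x acc. if P e x then x # acc else acc) (xs e) []))"
    by (rule ptime_rev, rule ptime_fold_const[where c = 1]) ((intro ptime_intros ptime2[OF P] xs)+, simp)
  moreover have "fold (\<lambda>x acc. if P e x then x # acc else acc) ys acc = rev (filter (P e) ys) @ acc"
    for e ys acc
    by (induction ys arbitrary: acc) auto
  ultimately show ?thesis by simp
qed

lemma ptime_ball [ptime_intros]:
  assumes "ptime (\<lambda>p. P (fst p) (snd p))" and "ptime xs"
  shows "ptime (\<lambda>e. \<forall>x\<in>set (xs e). P e x)"
  by (rule ptime_coerce[of "\<lambda>e. filter (\<lambda>x. \<not> P e x) (xs e) = []"])
    ((intro ptime_intros assms)+, simp add: filter_empty_conv)

lemma ptime_bex [ptime_intros]: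
  assumes "ptime (\<lambda>p. P (fst p) (snd p))" and "ptime xs"
  shows "ptime (\<lambda>e. \<exists>x\<in>set (xs e). P e x)"
  by (rule ptime_coerce[of "\<lambda>e. \<not> (filter (P e) (xs e) = [])"])
    ((intro ptime_intros assms)+, simp add: filter_empty_conv)

lemma ptime_member [ptime_intros]:
  assumes x: "ptime x" and xs: "ptime xs"
  shows "ptime (\<lambda>e. x e \<in> set (xs e))"
  by (rule ptime_coerce[of "\<lambda>e. \<exists>y\<in>set (xs e). y = x e"])
    ((intro ptime_intros assms ptime_comp[OF x])+, simp)

lemma ptime_subset [ptime_intros]:
  assumes xs: "ptime xs" and ys: "ptime ys"
  shows "ptime (\<lambda>e. set (xs e) \<subseteq> set (ys e))"
  by (rule ptime_coerce[of "\<lambda>e. \<forall>x\<in>set (xs e). x \<in> set (ys e)"])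
    ((intro ptime_intros xs ptime_comp[OF ys])+, simp add: subset_eq)

lemma ptime_set_eq [ptime_intros]:
  assumes xs: "ptime xs" and ys: "ptime ys"
  shows "ptime (\<lambda>e. set (xs e) = set (ys e))"
  by (rule ptime_coerce[of "\<lambda>e. set (xs e) \<subseteq> set (ys e) \<and> set (ys e) \<subseteq> set (xs e)"])
    ((intro ptime_intros xs ys)+, simp add: set_eq_subset)

lemma ptime_take_1 [ptime_intros]:
  assumes xs: "ptime xs"
  shows "ptime (\<lambda>e. take 1 (xs e))"
proof -
  have "ptime (\<lambda>e. fold (\<lambda>x acc. if acc = [] then [x] else acc) (xs e) [])"
    by (rule ptime_fold_const[where c = 1]) ((intro ptime_intros xs)+, simp)
  moreover have "fold (\<lambda>x acc. if acc = [] then [x] else acc) ys [] = take 1 ys"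
    for ys :: "'b list"
  proof (cases ys)
    case (Cons y zs)
    have "fold (\<lambda>x acc. if acc = [] then [x] else acc) zs [y] = [y]" by (induction zs) auto
    then show ?thesis using Cons by simp
  qed simp
  ultimately show ?thesis by simp
qed

lemma ptime_length_ge [ptime_intros]:
  assumes xs: "ptime xs"
  shows "ptime (\<lambda>e. n \<le> length (xs e))"
proof -
  have d: "ptime (\<lambda>e. drop n (xs e))" for n
  proof (induction n)
    case (Suc n)
    then have "ptime (\<lambda>e. tl (drop n (xs e)))" by (rule ptime_tl)
    then show ?case by (simp add: drop_Suc tl_drop)
  qed (simp add: xs)
  show ?thesis
  proof (cases n)
    case 0
    then show ?thesis by (simp add: ptime_True)
  next
    case (Suc m)
    show ?thesis
      by (rule ptime_coerce[of "\<lambda>e. \<not> (drop m (xs e) = [])"])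
        ((intro ptime_intros d)+, simp add: Suc not_le Suc_le_eq)
  qed
qed

text \<open>Lengths are compared in unary: one element of the first list is dropped for each element
  of the second.\<close>

lemma ptime_length_le_length [ptime_intros]:
  assumes xs: "ptime xs" and ys: "ptime ys"
  shows "ptime (\<lambda>e. length (xs e) \<le> length (ys e))"
proof -
  have "ptime (\<lambda>e. fold (\<lambda>_ r. tl r) (ys e) (xs e) = [])"
  proof (rule ptime_eq[OF ptime_fold_const[where c = 0]])
    fix x :: 'c and acc :: "'b list"
    show "esize (tl acc) \<le> esize acc + esize x + 0" by (cases acc) auto
  qed (intro ptime_intros xs ys)+
  moreover have "fold (\<lambda>_ r. tl r) as bs = drop (length as) bs" for as :: "'c list" and bs :: "'b list"
    by (induction as arbitrary: bs) (simp_all add: drop_Suc)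
  ultimately show ?thesis by simp
qed

lemma ptime_length_eq [ptime_intros]:
  assumes xs: "ptime xs"
  shows "ptime (\<lambda>e. length (xs e) = n)"
  by (rule ptime_coerce[of "\<lambda>e. n \<le> length (xs e) \<and> \<not> Suc n \<le> length (xs e)"])
    ((intro ptime_intros xs)+, rule arg_cong[of _ _ enc], linarith)

lemma ptime_subtract [ptime_intros]:
  assumes xs: "ptime xs" and ys: "ptime ys"
  shows "ptime (\<lambda>e. filter (\<lambda>x. x \<notin> set (ys e)) (xs e))"
  by (intro ptime_intros xs ptime_comp[OF ys])

primrec sfx :: "'a list \<Rightarrow> 'a list list" where
  "sfx [] = []"
| "sfx (x # xs) = (x # xs) # sfx xs"

lemma length_sfx [simp]: "length (sfx xs) = length xs"
  by (induction xs) auto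

text \<open>Each round stores a whole suffix, and the amount added depends on the accumulator
  itself. So the bound is stated for the prefixes that occur, where it is quadratic in the size of
  the list, which serves as the round counter as well.\<close>

lemma ptime_sfx [ptime_intros]:
  assumes xs: "ptime xs"
  shows "ptime (\<lambda>e. sfx (xs e))"
proof -
  let ?F = "\<lambda>_ p. (tl (fst p), fst p # snd p)"
  obtain g where g: "poly_bounded g" "\<And>e. esize (xs e) \<le> g (esize e)"
    using poly_bounded_dsize[OF xs] by blast
  have "ptime (\<lambda>e. rev (snd (fold ?F (xs e) (xs e, []))))"
  proof (rule ptime_rev, rule ptime_snd,
      rule ptime_fold_bound[where g = "\<lambda>n. g n + 1 + (1 + g n * (g n + 1))"])
    fix e i
    assume i: "i \<le> length (xs e)"
    have "esize (fold ?F zs (ys, yss)) \<le> esize ys + 1 + (esize yss + length zs * (esize ys + 1))"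
      for zs ys :: "'b list" and yss
    proof (induction zs arbitrary: ys yss)
      case (Cons z zs)
      have "esize (tl ys) \<le> esize ys" by (cases ys) auto
      then have *: "length zs * esize (tl ys) \<le> length zs * esize ys" by (rule mult_le_mono2)
      then show ?case
        using Cons.IH[of "tl ys" "ys # yss"] \<open>esize (tl ys) \<le> esize ys\<close>
        by simp (use * in linarith)
    qed simp
    from this[of "take i (xs e)" "xs e" "[]"] i
    have "esize (fold ?F (take i (xs e)) (xs e, [])) \<le>
        esize (xs e) + 1 + (1 + i * (esize (xs e) + 1))" by simp
    also have "\<dots> \<le> g (esize e) + 1 + (1 + g (esize e) * (g (esize e) + 1))"
      using i g(2)[of e] length_le_dsize[of "xs e"] by (intro add_mono mult_mono) auto
    finally show "esize (fold ?F (take i (xs e)) (xs e, [])) \<le> \<dots>" .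
  qed (intro ptime_intros poly_bounded_intros xs g)+
  moreover have "rev (snd (fold ?F ys (ys, yss))) = rev yss @ sfx ys" for ys :: "'b list" and yss
    by (induction ys arbitrary: yss) auto
  ultimately show ?thesis by simp
qed

section \<open>Binary successor\<close>

function bits :: "nat \<Rightarrow> bool list" where
  "bits m = (if m = 0 then [] else odd m # bits (m div 2))"
  by auto
termination by (relation "measure id") auto

declare bits.simps [simp del]

text \<open>This identity lets arithmetic be programmed with list operations, through
  \<open>ptime_coerce\<close>.\<close>

lemma enc_bits: "enc (bits m) = enc m"
proof (induction m rule: less_induct)
  case (less m)
  then show ?case
    by (cases "m = 0") (auto simp: bits.simps[of m] nat_enc enc_nat.simps[of m] bool_enc
        bits.simps[of 0] enc_nat.simps[of 0])
qed

text \<open>Carry propagation: the state consists of the carry and of the output bits in reverse,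
  and a carry left at the end becomes a new most significant bit. The initial carry is arbitrary for
  the sake of the induction.\<close>

lemma bits_Suc:
  "bits (m + of_bool c) = (let p = fold (\<lambda>b p. (b \<and> fst p, (b \<noteq> fst p) # snd p)) (bits m) (c, [])
     in rev (if fst p then True # snd p else snd p))"
proof -
  let ?F = "\<lambda>b p. (b \<and> fst p, (b \<noteq> fst p) # snd p)"
  have "rev acc @ bits (m + of_bool c) = (let p = fold ?F (bits m) (c, acc)
     in rev (if fst p then True # snd p else snd p))" for acc
  proof (induction m arbitrary: c acc rule: less_induct)
    case (less m)
    show ?case
    proof (cases "m = 0")
      case True
      then show ?thesis by (cases c) (simp_all add: bits.simps)
    next
      case False
      have "(m + of_bool c) div 2 = m div 2 + of_bool (odd m \<and> c)"
        by (cases c; cases "odd m") auto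
      moreover have "odd (m + of_bool c) \<longleftrightarrow> odd m \<noteq> c"
        by (cases c) auto
      ultimately have "bits (m + of_bool c) = (odd m \<noteq> c) # bits (m div 2 + of_bool (odd m \<and> c))"
        using False by (subst bits.simps) simp
      moreover have "bits m = odd m # bits (m div 2)"
        using False by (subst bits.simps) simp
      ultimately show ?thesis
        using less.IH[of "m div 2" "(odd m \<noteq> c) # acc" "odd m \<and> c"] False by (simp add: Let_def)
    qed
  qed
  from this[of "[]"] show ?thesis by simp
qed

lemma ptime_Suc [ptime_intros]:
  assumes "ptime f"
  shows "ptime (\<lambda>e. Suc (f e))"
proof -
  let ?p = "\<lambda>e. fold (\<lambda>b p. (b \<and> fst p, (b \<noteq> fst p) # snd p)) (bits (f e)) (True, [])"
  have bits: "ptime (\<lambda>e. bits (f e))"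
    by (rule ptime_coerce[OF assms]) (rule enc_bits)
  have p: "ptime ?p"
  proof (rule ptime_fold_const[where c = 10])
    fix b :: bool and p :: "bool \<times> bool list"
    have [simp]: "esize x \<le> 3" "0 < esize x" for x :: bool by (cases x) auto
    show "esize (b \<and> fst p, (b \<noteq> fst p) # snd p) \<le> esize p + esize b + 10"
      by (cases p; cases "fst p"; cases b) simp_all
  qed (intro ptime_intros bits)+
  show ?thesis
  proof (rule ptime_coerce[of "\<lambda>e. rev (if fst (?p e) then True # snd (?p e) else snd (?p e))"])
    fix e
    show "enc (Suc (f e)) = enc (rev (if fst (?p e) then True # snd (?p e) else snd (?p e)))"
      unfolding enc_bits[symmetric] using bits_Suc[of "f e" True] by (simp add: Let_def)
  qed (intro ptime_intros p)
qed

text \<open>A bit that turns from one to zero shrinks, so the growth comes from the single bit at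
  which the carry stops; the worst case is 0, whose code gains a whole node. The bound keeps
  counters small inside folds.\<close>

lemma dsize_enc_Suc: "esize (Suc m) \<le> esize m + 4"
proof (induction m rule: less_induct)
  case (less m)
  show ?case
  proof (cases "m = 0")
    case False
    have 1: "enc m = Node (enc (odd m)) (enc (m div 2))"
      using False by (simp add: nat_enc bool_enc enc_nat.simps[of m])
    have 2: "enc (Suc m) = Node (enc (even m)) (enc (Suc m div 2))"
      by (simp add: nat_enc bool_enc enc_nat.simps[of "Suc m"])
    show ?thesis
    proof (cases "even m")
      case True
      then show ?thesis unfolding 1 2 by simp
    next
      case odd: False
      then have "Suc m div 2 = Suc (m div 2)" by presburger
      then show ?thesis
        unfolding 1 2 using odd less.IH[of "m div 2"] False by simp
    qed
  qed (simp add: nat_enc enc_nat.simps[of "Suc 0"] enc_nat.simps[of 0] enc_bool_def)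
qed

lemma ptime_0 [ptime_intros]: "ptime (\<lambda>_. 0 :: nat)"
  by (rule ptime_Leaf) (simp add: nat_enc enc_nat.simps[of 0])

lemma ptime_Input [ptime_intros]: "ptime f \<Longrightarrow> ptime (\<lambda>e. Input (f e))"
  by (rule ptime_coerce[of "\<lambda>e. (False, f e)"])
    ((intro ptime_intros)+, auto simp: vertex_enc nat_enc bool_enc)

lemma ptime_Gate [ptime_intros]: "ptime f \<Longrightarrow> ptime g \<Longrightarrow> ptime (\<lambda>e. Gate (f e) (g e))"
  by (rule ptime_coerce[of "\<lambda>e. (True, f e, g e)"])
    ((intro ptime_intros)+, auto simp: vertex_enc nat_enc bool_enc)

text \<open>The prescribed encodings of instances and circuits coincide with the class encodings of
  pairs and lists, so the program for register 0 can be taken as it stands.\<close>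

lemma poly_time_approximableI:
  fixes alg :: "nat \<times> nat list list \<Rightarrow> circuit"
  assumes "ptime alg"
    and "\<And>n \<T> Ts. is_instance n \<T> \<Longrightarrow> P \<T> \<Longrightarrow> represents Ts \<T> \<Longrightarrow>
      is_solution n \<T> (alg (n, Ts)) \<and> real (num_gates (alg (n, Ts))) \<le> \<alpha> \<T> * real (opt n \<T>)"
  shows "poly_time_approximable P \<alpha>"
proof -
  from assms(1) obtain p :: "nat poly" and c where c: "\<And>s a. s 0 = enc a \<Longrightarrow>
     leaves c s 0 (enc (alg a)) (poly p (esize a))"
    unfolding ptime_def by blast
  have list: "enc_list enc = enc" by (simp add: list_enc)
  have inst: "enc_instance n Ts = enc (n, Ts)" for n Ts
    by (simp add: enc_instance_def list_enc nat_enc)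
  have circ: "enc_circuit C = enc C" for C
    by (simp add: enc_circuit_def list_enc vertex_enc)
  show ?thesis
    unfolding poly_time_approximable_def
  proof (intro exI[of _ c] exI[of _ p] allI impI)
    fix n \<T> Ts
    assume *: "is_instance n \<T> \<and> P \<T> \<and> represents Ts \<T>"
    obtain t s' where "exec c ((\<lambda>_. Leaf)(0 := enc (n, Ts))) t s'" "s' 0 = enc (alg (n, Ts))"
      "t + esize (alg (n, Ts)) \<le> poly p (esize (n, Ts))"
      using c[of "(\<lambda>_. Leaf)(0 := enc (n, Ts))" "(n, Ts)"] by auto
    then show "\<exists>t C. returns c (enc_instance n Ts) t (enc_circuit C) \<and>
        t \<le> poly p (dsize (enc_instance n Ts)) \<and> is_solution n \<T> C \<and>
        real (num_gates C) \<le> \<alpha> \<T> * real (opt n \<T>)"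
      using assms(2) * unfolding returns_def inst circ by (metis add_leD1)
  qed
qed

section \<open>Circuits from instruction lists\<close>

type_synonym instr = "nat list \<times> nat list"

definition labels :: "nat list \<Rightarrow> instr list \<Rightarrow> nat list list" where
  "labels V I = map (\<lambda>x. [x]) V @ map (\<lambda>p. fst p @ snd p) I"

text \<open>For a set that labels nothing the value is the length of the list and hence no vertex;
  \<open>supported\<close> excludes this for operands.\<close>

definition position :: "nat list \<Rightarrow> nat list list \<Rightarrow> nat" where
  "position A L = length (takeWhile (\<lambda>l. set l \<noteq> set A) L)"

text \<open>
  The gates come in the order of the instructions, which need not be topological: operands are looked
  up among all labels. Acyclicity follows because labels grow along edges.
\<close>

definition assemble :: "nat list \<Rightarrow> instr list \<Rightarrow> circuit" where
  "assemble V I = map Input V @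
     map (\<lambda>p. Gate (position (fst p) (labels V I)) (position (snd p) (labels V I))) I"

definition avail :: "nat list \<Rightarrow> instr list \<Rightarrow> nat set set" where
  "avail V I = set ` set (labels V I)"

text \<open>Nonempty disjoint operands make the label of a gate strictly larger than the labels of
  its predecessors.\<close>

definition supported :: "nat list \<Rightarrow> instr list \<Rightarrow> instr \<Rightarrow> bool" where
  "supported V I p \<longleftrightarrow> fst p \<noteq> [] \<and> snd p \<noteq> [] \<and> set (fst p) \<inter> set (snd p) = {} \<and>
     set (fst p) \<in> avail V I \<and> set (snd p) \<in> avail V I"

lemma avail_eq: "avail V I = (\<lambda>x. {x}) ` set V \<union> (\<lambda>p. set (fst p) \<union> set (snd p)) ` set I"
  by (auto simp: avail_def labels_def image_image image_Un)

lemma position_avail: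
  assumes "set A \<in> avail V I"
  shows "position A (labels V I) < length (labels V I)"
    and "set (labels V I ! position A (labels V I)) = set A"
proof -
  have "\<exists>l\<in>set (labels V I). \<not> set l \<noteq> set A" using assms by (auto simp: avail_def)
  moreover have "\<exists>l\<in>set L. \<not> P l \<Longrightarrow> length (takeWhile P L) < length L" for P and L :: "nat list list"
    by (induction L) auto
  ultimately show *: "position A (labels V I) < length (labels V I)"
    by (simp add: position_def)
  show "set (labels V I ! position A (labels V I)) = set A"
    using nth_length_takeWhile[OF *[unfolded position_def]] by (simp add: position_def)
qed

text \<open>Repetitions in \<open>V\<close> and \<open>I\<close> do no harm to correctness, because
  an operand always resolves to the first position that carries the right set.\<close>

lemma assemble_correct:
  assumes sup: "\<And>p. p \<in> set I \<Longrightarrow> supported V I p"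
    and V: "set V \<subseteq> {1..n}" and T: "\<T> \<subseteq> avail V I"
  shows "is_solution n \<T> (assemble V I)" "num_gates (assemble V I) = length I"
proof -
  let ?C = "assemble V I" and ?L = "labels V I"
  define S where "S = (\<lambda>v. set (?L ! v))"
  have len: "length ?C = length V + length I" "length ?L = length V + length I"
    by (simp_all add: assemble_def labels_def)
  have inp: "?C ! v = Input (V ! v)" "S v = {V ! v}" if "v < length V" for v
    using that by (simp_all add: assemble_def labels_def nth_append S_def)
  have gate: "?C ! v = Gate (position (fst p) ?L) (position (snd p) ?L)"
      "S v = set (fst p) \<union> set (snd p)" "p \<in> set I"
    if "\<not> v < length V" "v < length ?C" "p = I ! (v - length V)" for v p
    using that by (simp_all add: assemble_def labels_def nth_append S_def)
  have Spos: "S (position A ?L) = set A" "position A ?L < length ?C" if "set A \<in> avail V I" for A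
    using position_avail[OF that] by (simp_all add: S_def len)
  have vs: "variable_sets ?C S"
    unfolding variable_sets_def
  proof (intro allI impI)
    fix v assume v: "v < length ?C"
    show "case ?C ! v of Input i \<Rightarrow> S v = {i}
        | Gate u w \<Rightarrow> S u \<inter> S w = {} \<and> S v = S u \<union> S w"
    proof (cases "v < length V")
      case True
      then show ?thesis by (simp add: inp)
    next
      case False
      define p where "p = I ! (v - length V)"
      note g = gate[OF False v p_def]
      have "set (fst p) \<in> avail V I" "set (snd p) \<in> avail V I" "set (fst p) \<inter> set (snd p) = {}"
        using sup[OF g(3)] by (auto simp: supported_def)
      then show ?thesis
        by (simp add: g Spos)
    qed
  qed
  have edge: "u < length ?C \<and> v < length ?C \<and> card (S u) < card (S v)" if "(u, v) \<in> edges ?C" for u v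
  proof -
    from that obtain a b where v: "v < length ?C" and ab: "?C ! v = Gate a b" "u = a \<or> u = b"
      by (auto simp: edges_def)
    then have nV: "\<not> v < length V" using inp by auto
    define p where "p = I ! (v - length V)"
    note g = gate[OF nV v p_def]
    have p: "set (fst p) \<in> avail V I" "set (snd p) \<in> avail V I" "set (fst p) \<inter> set (snd p) = {}"
       "fst p \<noteq> []" "snd p \<noteq> []"
      using sup[OF g(3)] by (auto simp: supported_def)
    have "u = position (fst p) ?L \<or> u = position (snd p) ?L" using ab g(1) by auto
    moreover have "card (S v) = card (set (fst p)) + card (set (snd p))"
      unfolding g(2) using p by (intro card_Un_disjoint) auto
    moreover have "card (set (fst p)) > 0" "card (set (snd p)) > 0"
      using p by (simp_all add: card_gt_0_iff)
    ultimately show ?thesis using Spos p v by auto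
  qed
  have "edges ?C \<subseteq> measure (\<lambda>v. card (S v))"
    using edge by auto
  then have "acyclic (edges ?C)"
    using wf_acyclic wf_measure wf_subset by blast
  then have dag: "is_dag ?C"
    using edge by (auto simp: is_dag_def)
  have "\<exists>v<length ?C. S v = A" if "A \<in> \<T>" for A
  proof -
    from that T obtain l where "l \<in> set ?L" "A = set l" by (auto simp: avail_def)
    then show ?thesis by (metis S_def in_set_conv_nth len)
  qed
  moreover have "\<forall>i. Input i \<in> set ?C \<longrightarrow> i \<in> {1..n}"
    using V by (auto simp: assemble_def)
  ultimately show "is_solution n \<T> ?C"
    using dag vs unfolding is_solution_def by blast
  have "{v. v < length ?C \<and> (\<exists>a b. ?C ! v = Gate a b)} = {length V..<length V + length I}"
    using inp(1) gate(1)[OF _ _ refl] by (auto simp: len not_less[symmetric])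
  then show "num_gates ?C = length I"
    by (simp add: num_gates_def)
qed

lemma ptime_position [ptime_intros]:
  assumes A: "ptime A" and L: "ptime L"
  shows "ptime (\<lambda>e. position (A e) (L e))"
proof -
  let ?F = "\<lambda>A l p. if fst p then p else if set l = set A then (True, snd p) else (False, Suc (snd p))"
  have "ptime (\<lambda>e. snd (fold (?F (A e)) (L e) (False, 0)))"
  proof (rule ptime_snd, rule ptime_fold_const[where c = 4])
    fix e l and p :: "bool \<times> nat"
    have "esize (Suc (snd p)) \<le> esize (snd p) + 4" by (rule dsize_enc_Suc)
    then show "esize (?F (A e) l p) \<le> esize p + esize l + 4"
      by (cases p) auto
  qed (intro ptime_intros L ptime_comp[OF A])+
  moreover have found: "fold (?F B) L (True, m) = (True, m)" for B L and m :: nat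
    by (induction L) auto
  have "snd (fold (?F B) L (False, m)) = m + position B L" for B L m
  proof (induction L arbitrary: m)
    case (Cons l L)
    then show ?case
      by (cases "set l = set B") (simp_all add: position_def found)
  qed (simp add: position_def)
  ultimately show ?thesis by simp
qed

lemma ptime_labels [ptime_intros]: "ptime V \<Longrightarrow> ptime I \<Longrightarrow> ptime (\<lambda>e. labels (V e) (I e))"
  unfolding labels_def by (intro ptime_intros)

lemma ptime_assemble [ptime_intros]:
  assumes "ptime V" "ptime I"
  shows "ptime (\<lambda>e. assemble (V e) (I e))"
  by (rule ptime2[OF _ assms]) (unfold assemble_def, intro ptime_intros)

text \<open>Adds the elements of xs to S one by one; the labels are the suffixes of xs joined with S.\<close>

definition chain :: "nat list \<Rightarrow> nat list \<Rightarrow> instr list" where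
  "chain S xs = map (\<lambda>s. (take 1 s, tl s @ S)) (sfx xs)"

definition extend :: "nat list \<Rightarrow> nat list \<Rightarrow> instr list" where
  "extend S T = chain S (filter (\<lambda>x. x \<notin> set S) T)"

definition scratch :: "nat list \<Rightarrow> instr list" where
  "scratch T = chain (take 1 T) (tl T)"

lemma ptime_chain [ptime_intros]:
  assumes "ptime S" "ptime xs"
  shows "ptime (\<lambda>e. chain (S e) (xs e))"
  by (rule ptime2[OF _ assms]) (unfold chain_def, intro ptime_intros)

lemma ptime_extend [ptime_intros]: "ptime S \<Longrightarrow> ptime T \<Longrightarrow> ptime (\<lambda>e. extend (S e) (T e))"
  unfolding extend_def by (intro ptime_intros)

lemma ptime_scratch [ptime_intros]: "ptime T \<Longrightarrow> ptime (\<lambda>e. scratch (T e))"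
  unfolding scratch_def by (intro ptime_intros)

text \<open>The claim is relative to any list \<open>I\<close> containing the chain: availability
  only asks which instructions occur somewhere, so the pieces of a plan can be verified separately
  and in any order.\<close>

lemma chain_supported:
  assumes "set (chain S xs) \<subseteq> set I" "S \<noteq> []" "set S \<in> avail V I" "set xs \<subseteq> set V"
    "distinct xs" "set xs \<inter> set S = {}"
  shows "\<forall>p\<in>set (chain S xs). supported V I p" "set xs \<union> set S \<in> avail V I"
proof -
  have "(\<forall>p\<in>set (chain S xs). supported V I p) \<and> set xs \<union> set S \<in> avail V I"
    using assms
  proof (induction xs)
    case Nil
    then show ?case by (simp add: chain_def)
  next
    case (Cons x xs)
    have c: "chain S (x # xs) = ([x], xs @ S) # chain S xs" by (simp add: chain_def)
    have IH: "\<forall>p\<in>set (chain S xs). supported V I p" "set xs \<union> set S \<in> avail V I"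
      using Cons by (auto simp: c)
    have "([x], xs @ S) \<in> set I" using Cons.prems(1) by (simp add: c)
    from imageI[OF this, of "\<lambda>p. set (fst p) \<union> set (snd p)"]
    have "set (x # xs) \<union> set S \<in> avail V I"
      by (simp add: avail_eq)
    moreover have "{x} \<in> avail V I" using Cons.prems(4) by (auto simp: avail_eq)
    moreover have "supported V I ([x], xs @ S)"
      using IH(2) Cons.prems(2,5,6) \<open>{x} \<in> avail V I\<close> by (simp add: supported_def)
    ultimately show ?case
      using IH(1) by (simp add: c)
  qed
  then show "\<forall>p\<in>set (chain S xs). supported V I p" "set xs \<union> set S \<in> avail V I" by blast+
qed

lemma extend_supported:
  assumes "set (extend S T) \<subseteq> set I" "S \<noteq> []" "set S \<in> avail V I" "set T \<subseteq> set V"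
    "distinct T" "set S \<subseteq> set T"
  shows "\<forall>p\<in>set (extend S T). supported V I p" "set T \<in> avail V I"
proof -
  have "set (filter (\<lambda>x. x \<notin> set S) T) \<union> set S = set T" using assms(6) by auto
  then show "\<forall>p\<in>set (extend S T). supported V I p" "set T \<in> avail V I"
    using chain_supported[of S "filter (\<lambda>x. x \<notin> set S) T" I V] assms by (auto simp: extend_def)
qed

lemma scratch_supported:
  assumes "set (scratch T) \<subseteq> set I" "T \<noteq> []" "set T \<subseteq> set V" "distinct T"
  shows "\<forall>p\<in>set (scratch T). supported V I p" "set T \<in> avail V I"
proof -
  from assms(2) obtain x xs where T: "T = x # xs" by (cases T) auto
  have "{x} \<in> avail V I" using assms(3) by (auto simp: T avail_eq)
  then show "\<forall>p\<in>set (scratch T). supported V I p" "set T \<in> avail V I"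
    using chain_supported[of "[x]" xs I V] assms by (auto simp: scratch_def T)
qed

lemma length_extend:
  assumes "distinct T" "distinct S" "set S \<subseteq> set T"
  shows "length (extend S T) = length T - length S"
proof -
  have "length (filter (\<lambda>x. x \<notin> set S) T) = card (set T - set S)"
    using assms(1) by (simp add: distinct_length_filter set_diff_eq Int_def conj_commute)
  also have "\<dots> = length T - length S"
    using assms by (simp add: card_Diff_subset distinct_card)
  finally show ?thesis by (simp add: extend_def chain_def)
qed

lemma length_scratch: "length (scratch T) = length T - 1"
  by (simp add: scratch_def chain_def)

text \<open>The properties of the set of gate labels of a solution on which the lower bounds rest.\<close>

definition gate_family :: "nat set set \<Rightarrow> nat set set \<Rightarrow> bool" where
  "gate_family \<T> \<Gamma> \<longleftrightarrow> finite \<Gamma> \<and> (\<forall>T\<in>\<T>. 2 \<le> card T \<longrightarrow> T \<in> \<Gamma>) \<and>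
     (\<forall>A\<in>\<Gamma>. \<exists>B C. A = B \<union> C \<and> B \<inter> C = {} \<and> finite A \<and> B \<noteq> {} \<and> C \<noteq> {} \<and>
        (card B = 1 \<or> B \<in> \<Gamma>) \<and> (card C = 1 \<or> C \<in> \<Gamma>))"

text \<open>Taking the image of the gates under the labelling counts each label once, however many
  gates carry it. Singletons need no gate, which accounts for the alternatives
  \<open>card B = 1\<close> and \<open>card C = 1\<close>.\<close>

lemma solution_gate_family:
  assumes "is_solution n \<T> C"
  obtains \<Gamma> where "gate_family \<T> \<Gamma>" "card \<Gamma> \<le> num_gates C"
proof -
  from assms obtain S where dag: "is_dag C" and vs: "variable_sets C S"
    and T: "\<And>T. T \<in> \<T> \<Longrightarrow> \<exists>v<length C. S v = T"
    unfolding is_solution_def by blast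
  define G where "G = {v. v < length C \<and> (\<exists>a b. C ! v = Gate a b)}"
  have finG: "finite G" by (simp add: G_def)
  have "finite (edges C)"
    using dag by (auto simp: is_dag_def intro: finite_subset)
  then have wf: "wf (edges C)"
    using dag by (simp add: is_dag_def finite_acyclic_wf)
  have fin: "finite (S v) \<and> S v \<noteq> {}" if "v < length C" for v
    using wf that
  proof (induction v rule: wf_induct_rule)
    case (less v)
    show ?case
    proof (cases "C ! v")
      case (Input i)
      then show ?thesis
        using vs[unfolded variable_sets_def, rule_format, OF less.prems] by simp
    next
      case (Gate u w)
      then have e: "(u, v) \<in> edges C" "(w, v) \<in> edges C"
        using less.prems by (auto simp: edges_def)
      then have "u < length C" "w < length C"
        using dag by (auto simp: is_dag_def)
      then show ?thesis
        using vs[unfolded variable_sets_def, rule_format, OF less.prems] Gate less.IH e by auto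
    qed
  qed
  have one: "card (S v) = 1 \<or> v \<in> G" if "v < length C" for v
    using vs[unfolded variable_sets_def, rule_format, OF that] that
    by (cases "C ! v") (auto simp: G_def)
  show thesis
  proof (rule that[of "S ` G"])
    show "card (S ` G) \<le> num_gates C"
      using card_image_le[OF finG, of S] by (simp add: num_gates_def G_def)
    show "gate_family \<T> (S ` G)"
      unfolding gate_family_def
    proof (intro conjI ballI impI)
      show "finite (S ` G)" using finG by simp
      show "T \<in> S ` G" if "T \<in> \<T>" "2 \<le> card T" for T
      proof -
        from T[OF that(1)] obtain v where "v < length C" "S v = T" by blast
        with one[of v] that(2) show ?thesis by auto
      qed
      fix A assume "A \<in> S ` G"
      then obtain v a b where v: "A = S v" "v < length C" "C ! v = Gate a b"
        by (auto simp: G_def)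
      then have "a < length C" "b < length C"
        using dag by (auto simp: is_dag_def edges_def)
      moreover have "S a \<inter> S b = {}" "S v = S a \<union> S b"
        using vs[unfolded variable_sets_def, rule_format, OF v(2)] v(3) by simp_all
      ultimately show "\<exists>B C. A = B \<union> C \<and> B \<inter> C = {} \<and> finite A \<and> B \<noteq> {} \<and> C \<noteq> {} \<and>
        (card B = 1 \<or> B \<in> S ` G) \<and> (card C = 1 \<or> C \<in> S ` G)"
        using fin[of a] fin[of b] one[of a] one[of b] v(1)
        by (intro exI[of _ "S a"] exI[of _ "S b"]) auto
    qed
  qed
qed

text \<open>The given solution \<open>C\<close> only guarantees that the minimum in
  \<open>opt\<close> is attained; the bound is then applied to the gate labels of an optimal
  solution.\<close>

lemma le_opt:
  assumes "is_solution n \<T> C" and "\<And>\<Gamma>. gate_family \<T> \<Gamma> \<Longrightarrow> r \<le> \<alpha> * real (card \<Gamma>)" and "0 \<le> \<alpha>"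
  shows "r \<le> \<alpha> * real (opt n \<T>)"
proof -
  have "\<exists>D. is_solution n \<T> D \<and> num_gates D = opt n \<T>"
    unfolding opt_def by (rule LeastI_ex) (use assms(1) in blast)
  then obtain D where D: "is_solution n \<T> D" "num_gates D = opt n \<T>" by blast
  from solution_gate_family[OF D(1)] obtain \<Gamma>
    where \<Gamma>: "gate_family \<T> \<Gamma>" "card \<Gamma> \<le> opt n \<T>" using D(2) by auto
  have "r \<le> \<alpha> * real (card \<Gamma>)" by (rule assms(2)[OF \<Gamma>(1)])
  also have "\<dots> \<le> \<alpha> * real (opt n \<T>)" using \<Gamma>(2) assms(3) by (intro mult_left_mono) auto
  finally show ?thesis .
qed

section \<open>Greedy selection\<close>

text \<open>A single pass over the candidates, whose state consists of the elements not yet hit and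
  the candidates chosen so far. One pass suffices when \<open>ok\<close> cannot become true again
  while the list shrinks, see \<open>greedy_exhausted\<close>.\<close>

definition greedy ::
    "('c \<Rightarrow> 't list \<Rightarrow> bool) \<Rightarrow> ('c \<Rightarrow> 't \<Rightarrow> bool) \<Rightarrow> 'c list \<Rightarrow> 't list \<Rightarrow> 't list \<times> 'c list" where
  "greedy ok hit cs r = fold (\<lambda>c p. if ok c (fst p)
     then (filter (\<lambda>t. \<not> hit c t) (fst p), c # snd p) else p) cs (r, [])"

lemma ptime_greedy:
  assumes ok: "ptime (\<lambda>p. ok (fst p) (fst (snd p)) (snd (snd p)))"
    and hit: "ptime (\<lambda>p. hit (fst p) (fst (snd p)) (snd (snd p)))"
    and cs: "ptime cs" and r: "ptime r"
  shows "ptime (\<lambda>e. greedy (ok e) (hit e) (cs e) (r e))"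
  unfolding greedy_def
proof (rule ptime_fold_const[where c = 1])
  fix e c p
  show "esize (if ok e c (fst p) then (filter (\<lambda>t. \<not> hit e c t) (fst p), c # snd p) else p)
      \<le> esize p + esize c + 1"
    using dsize_enc_filter[of "\<lambda>t. \<not> hit e c t" "fst p"] by (cases p) auto
qed (intro ptime_intros ptime3[OF ok] ptime3[OF hit] cs r)+

lemma greedy_invariant:
  assumes "Q (r, [])" and "\<And>c r out. c \<in> set cs \<Longrightarrow> Q (r, out) \<Longrightarrow> ok c r \<Longrightarrow>
    Q (filter (\<lambda>t. \<not> hit c t) r, c # out)"
  shows "Q (greedy ok hit cs r)"
proof -
  have "Q (fold (\<lambda>c p. if ok c (fst p)
     then (filter (\<lambda>t. \<not> hit c t) (fst p), c # snd p) else p) cs p)" if "Q p" for p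
    using that assms(2)
  proof (induction cs arbitrary: p)
    case (Cons c cs)
    then show ?case by (cases p) auto
  qed simp
  then show ?thesis using assms(1) by (simp add: greedy_def)
qed

text \<open>A candidate was tested on the list of its own moment, not on the initial or the final
  one; the filter \<open>P\<close> remembers that list.\<close>

lemma greedy_chosen_rest:
  "(\<forall>c\<in>set (snd (greedy ok hit cs r)). (\<exists>P. ok c (filter P r)) \<and> c \<in> set cs) \<and>
    (\<exists>P. fst (greedy ok hit cs r) = filter P r)"
proof (rule greedy_invariant)
  show "(\<forall>c\<in>set (snd (r, [])). (\<exists>P. ok c (filter P r)) \<and> c \<in> set cs) \<and>
    (\<exists>P. fst (r, []) = filter P r)"
    by (simp, rule exI[of _ "\<lambda>_. True"], simp)
next
  fix c r' out
  assume c: "c \<in> set cs" "ok c r'"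
    and *: "(\<forall>c\<in>set (snd (r', out)). (\<exists>P. ok c (filter P r)) \<and> c \<in> set cs) \<and>
      (\<exists>P. fst (r', out) = filter P r)"
  then obtain P where P: "r' = filter P r" by auto
  have "filter (\<lambda>t. \<not> hit c t) r' = filter (\<lambda>t. P t \<and> \<not> hit c t) r"
    unfolding P filter_filter ..
  moreover have "\<exists>P. ok c (filter P r)" using c(2) unfolding P by (rule exI[of _ P])
  ultimately show "(\<forall>c\<in>set (snd (filter (\<lambda>t. \<not> hit c t) r', c # out)).
      (\<exists>P. ok c (filter P r)) \<and> c \<in> set cs) \<and>
      (\<exists>P. fst (filter (\<lambda>t. \<not> hit c t) r', c # out) = filter P r)"
    using c(1) conjunct1[OF *] unfolding fst_conv snd_conv list.set(2) by blast
qed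

lemma greedy_rest: "\<exists>P. fst (greedy ok hit cs r) = filter P r"
  using greedy_chosen_rest by blast

lemma greedy_subset: "set (fst (greedy ok hit cs r)) \<subseteq> set r"
  using greedy_rest[of ok hit cs r] by auto

lemma greedy_chosen:
  assumes "c \<in> set (snd (greedy ok hit cs r))"
  shows "\<exists>P. ok c (filter P r)" "c \<in> set cs"
  using greedy_chosen_rest[of ok hit cs r] assms by blast+

lemma greedy_hit:
  assumes "t \<in> set r" "t \<notin> set (fst (greedy ok hit cs r))"
  shows "\<exists>c\<in>set (snd (greedy ok hit cs r)). hit c t"
proof -
  have "t \<in> set (fst (greedy ok hit cs r)) \<or> (\<exists>c\<in>set (snd (greedy ok hit cs r)). hit c t)"
    by (rule greedy_invariant[where Q = "\<lambda>p. t \<in> set (fst p) \<or> (\<exists>c\<in>set (snd p). hit c t)"])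
      (use assms(1) in auto)
  then show ?thesis using assms(2) by blast
qed

text \<open>Each choice removes at least \<open>j\<close> elements of the current list, and no
  element is removed twice.\<close>

lemma greedy_count:
  assumes "\<And>c r. distinct r \<Longrightarrow> ok c r \<Longrightarrow> j \<le> length (filter (hit c) r)" "distinct r"
  shows "j * length (snd (greedy ok hit cs r)) + length (fst (greedy ok hit cs r)) \<le> length r"
proof -
  have "j * length (snd (greedy ok hit cs r)) + length (fst (greedy ok hit cs r)) \<le> length r \<and>
      distinct (fst (greedy ok hit cs r))"
  proof (rule greedy_invariant)
    fix c r' and out :: "'a list"
    assume *: "j * length (snd (r', out)) + length (fst (r', out)) \<le> length r \<and> distinct (fst (r', out))"
      and "ok c r'"
    then have "j \<le> length (filter (hit c) r')" using assms(1) by simp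
    moreover have "length (filter (hit c) r') + length (filter (\<lambda>t. \<not> hit c t) r') = length r'"
      by (rule sum_length_filter_compl)
    ultimately show "j * length (snd (filter (\<lambda>t. \<not> hit c t) r', c # out)) +
        length (fst (filter (\<lambda>t. \<not> hit c t) r', c # out)) \<le> length r \<and>
        distinct (fst (filter (\<lambda>t. \<not> hit c t) r', c # out))"
      using * by simp
  qed (use assms(2) in simp)
  then show ?thesis by simp
qed

text \<open>By \<open>anti\<close>, a candidate that has been rejected stays rejected on every
  sublist; by \<open>self\<close>, a chosen one is rejected right after its choice. So nothing
  usable is left after the pass.\<close>

lemma greedy_exhausted:
  assumes anti: "\<And>c P r. ok c (filter P r) \<Longrightarrow> ok c r"
    and self: "\<And>c r. \<not> ok c (filter (\<lambda>t. \<not> hit c t) r)"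
    and c: "c \<in> set cs"
  shows "\<not> ok c (fst (greedy ok hit cs r))"
proof -
  let ?F = "\<lambda>c p. if ok c (fst p) then (filter (\<lambda>t. \<not> hit c t) (fst p), c # snd p) else p"
  have keep: "\<not> ok c (fst (fold ?F cs p))" if "\<not> ok c (fst p)" for cs p
    using that
  proof (induction cs arbitrary: p)
    case (Cons d cs)
    have "\<not> ok c (fst (?F d p))"
      using Cons.prems anti[of c _ "fst p"] by (cases "ok d (fst p)") auto
    from Cons.IH[OF this] show ?case by simp
  qed simp
  have "\<not> ok c (fst (fold ?F cs p))" for p
    using c
  proof (induction cs arbitrary: p)
    case (Cons d cs)
    show ?case
    proof (cases "c = d")
      case True
      then have "\<not> ok c (fst (?F d p))" using self[of d "fst p"] by (cases "ok d (fst p)") auto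
      from keep[OF this, of cs] show ?thesis by simp
    next
      case False
      then have "c \<in> set cs" using Cons.prems by simp
      from Cons.IH[OF this, of "?F d p"] show ?thesis by simp
    qed
  qed simp
  then show ?thesis by (simp add: greedy_def)
qed

section \<open>Tree lists and two counting principles\<close>

definition tree_list :: "nat list list \<Rightarrow> bool" where
  "tree_list Ts \<longleftrightarrow> (\<forall>T\<in>set Ts. distinct T \<and> T \<noteq> []) \<and> distinct (map set Ts)"

lemma tree_listI: "is_instance n \<T> \<Longrightarrow> represents Ts \<T> \<Longrightarrow> tree_list Ts"
  by (auto simp: is_instance_def represents_def tree_list_def)

lemma tree_listD:
  assumes "tree_list Ts" "T \<in> set Ts"
  shows "distinct T" "T \<noteq> []" "card (set T) = length T"
  using assms by (auto simp: tree_list_def distinct_card)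

lemma tree_list_eq: "tree_list Ts \<Longrightarrow> S \<in> set Ts \<Longrightarrow> T \<in> set Ts \<Longrightarrow> set S = set T \<Longrightarrow> S = T"
  by (auto simp: tree_list_def distinct_map inj_on_def)

lemma tree_list_distinct: "tree_list Ts \<Longrightarrow> distinct Ts"
  by (simp add: tree_list_def distinct_map)

lemma card_le_2I:
  assumes "\<And>a b c. a \<in> A \<Longrightarrow> b \<in> A \<Longrightarrow> c \<in> A \<Longrightarrow> a \<noteq> b \<Longrightarrow> a \<noteq> c \<Longrightarrow> b \<noteq> c \<Longrightarrow> False"
  shows "card A \<le> 2"
proof (rule ccontr)
  assume "\<not> card A \<le> 2"
  then have "3 \<le> card A" by simp
  then obtain B where "B \<subseteq> A" "card B = 3" by (rule obtain_subset_with_card_n)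
  then show False using assms by (auto simp: card_3_iff)
qed

lemma card_le_fibers:
  assumes "finite A" "\<And>y. y \<in> f ` A \<Longrightarrow> card {x \<in> A. f x = y} \<le> m"
  shows "card A \<le> m * card (f ` A)"
proof -
  have "card A = (\<Sum>y\<in>f ` A. card {x \<in> A. f x = y})"
    using sum.image_gen[OF assms(1), of "\<lambda>_. 1::nat" f] by simp
  also have "\<dots> \<le> (\<Sum>y\<in>f ` A. m)" using assms(2) by (rule sum_mono)
  finally show ?thesis by (simp add: mult.commute)
qed

section \<open>Trees of arbitrary size\<close>

text \<open>The condition that \<open>S\<close> has at least half the size of \<open>T\<close> is
  phrased with \<open>S @ S\<close>, since \<open>ptime_length_le_length\<close> compares lengths of
  lists.\<close>

definition halves :: "nat list list \<Rightarrow> nat list \<Rightarrow> nat list list" where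
  "halves Ts T = filter (\<lambda>S. set S \<subseteq> set T \<and> \<not> set T \<subseteq> set S \<and> length T \<le> length (S @ S)) Ts"

definition loose :: "nat list list \<Rightarrow> nat list list" where
  "loose Ts = filter (\<lambda>T. 3 \<le> length T \<and> halves Ts T = []) Ts"

type_synonym triple = "nat list \<times> nat list \<times> nat list"

definition triples :: "nat list list \<Rightarrow> triple list" where
  "triples xs = concat (map (\<lambda>a. concat (map (\<lambda>b. map (\<lambda>c. (a, b, c)) xs) xs)) xs)"

definition meet :: "triple \<Rightarrow> nat list" where
  "meet x = filter (\<lambda>i. i \<in> set (fst (snd x)) \<and> i \<in> set (snd (snd x))) (fst x)"

definition overlapping :: "triple \<Rightarrow> nat list list \<Rightarrow> bool" where
  "overlapping x r \<longleftrightarrow> fst x \<in> set r \<and> fst (snd x) \<in> set r \<and> snd (snd x) \<in> set r \<and>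
     fst x \<noteq> fst (snd x) \<and> fst x \<noteq> snd (snd x) \<and> fst (snd x) \<noteq> snd (snd x) \<and>
     length (fst x) \<le> length (meet x @ meet x) \<and> length (fst (snd x)) \<le> length (meet x @ meet x) \<and>
     length (snd (snd x)) \<le> length (meet x @ meet x)"

definition part_of :: "triple \<Rightarrow> nat list \<Rightarrow> bool" where
  "part_of x T \<longleftrightarrow> T = fst x \<or> T = fst (snd x) \<or> T = snd (snd x)"

definition grouping :: "nat list list \<Rightarrow> nat list list \<times> triple list" where
  "grouping Ts = greedy overlapping part_of (triples (loose Ts)) (loose Ts)"

definition half_plan :: "nat list list \<Rightarrow> nat list \<Rightarrow> instr list" where
  "half_plan Ts T = (if 3 \<le> length T
     then concat (map (\<lambda>S. extend S T) (take 1 (halves Ts T))) else scratch T)"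

definition triple_plan :: "triple \<Rightarrow> instr list" where
  "triple_plan x = scratch (meet x) @ extend (meet x) (fst x) @ extend (meet x) (fst (snd x)) @
     extend (meet x) (snd (snd x))"

definition general_plan :: "nat list list \<Rightarrow> instr list" where
  "general_plan Ts = concat (map (half_plan Ts) Ts) @
     concat (map triple_plan (snd (grouping Ts))) @ concat (map scratch (fst (grouping Ts)))"

section \<open>The general algorithm: running time and correctness\<close>

lemma ptime_halves [ptime_intros]:
  assumes "ptime Ts" "ptime T"
  shows "ptime (\<lambda>e. halves (Ts e) (T e))"
  by (rule ptime2[OF _ assms]) (unfold halves_def, intro ptime_intros)

lemma ptime_loose: "ptime loose"
  unfolding loose_def by (intro ptime_intros)

lemma ptime_triples: "ptime triples"
  unfolding triples_def by (intro ptime_intros)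

lemma ptime_meet: "ptime meet"
  unfolding meet_def by (intro ptime_intros)

lemma ptime_grouping: "ptime grouping"
  unfolding grouping_def overlapping_def part_of_def
  by (intro ptime_greedy ptime_intros ptime_comp[OF ptime_meet] ptime_comp[OF ptime_triples] ptime_loose)

lemma ptime_general_plan: "ptime general_plan"
  unfolding general_plan_def half_plan_def triple_plan_def
  by (intro ptime_intros ptime_comp[OF ptime_meet] ptime_grouping)

lemma loose_subset: "set (loose Ts) \<subseteq> set Ts"
  by (auto simp: loose_def)

lemma grouping_tripleD:
  assumes "tree_list Ts" "x \<in> set (snd (grouping Ts))"
  shows "distinct (meet x)" "meet x \<noteq> []"
    and "part_of x T \<Longrightarrow> T \<in> set (loose Ts) \<and> set (meet x) \<subseteq> set T \<and> length T \<le> 2 * length (meet x)"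
proof -
  obtain P where P: "overlapping x (filter P (loose Ts))"
    using greedy_chosen(1)[OF assms(2)[unfolded grouping_def]] by (elim exE)
  have sub: "set (meet x) \<subseteq> set (fst x)" "set (meet x) \<subseteq> set (fst (snd x))"
    "set (meet x) \<subseteq> set (snd (snd x))" by (auto simp: meet_def)
  show T: "part_of x T \<Longrightarrow>
      T \<in> set (loose Ts) \<and> set (meet x) \<subseteq> set T \<and> length T \<le> 2 * length (meet x)" for T
    using P sub by (auto simp: part_of_def overlapping_def)
  have x: "fst x \<in> set (loose Ts)" "length (fst x) \<le> 2 * length (meet x)"
    using T[of "fst x"] by (simp_all add: part_of_def)
  then have "distinct (fst x)" "3 \<le> length (fst x)"
    using tree_listD[OF assms(1)] by (auto simp: loose_def)
  \<comment> \<open>A loose tree has at least three elements, so an intersection containing half of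
    it is not empty.\<close>
  then show "distinct (meet x)" "meet x \<noteq> []"
    using x(2) by (auto simp: meet_def)
qed

lemma set_concat_map_subset: "x \<in> set xs \<Longrightarrow> set (f x) \<subseteq> set (concat (map f xs))"
  by auto

text \<open>The induction on the size is needed because a tree may be built on a smaller tree, which
  must be available first.\<close>

lemma general_plan_avail:
  assumes Ts: "tree_list Ts" and "T \<in> set Ts"
  shows "set T \<in> avail (concat Ts) (general_plan Ts)"
  using assms(2)
proof (induction "length T" arbitrary: T rule: less_induct)
  case less
  let ?V = "concat Ts" and ?I = "general_plan Ts"
  note T = tree_listD[OF Ts less.prems]
  have V: "set T \<subseteq> set ?V" using less.prems by auto
  have half: "set (half_plan Ts T) \<subseteq> set ?I"
    using set_concat_map_subset[OF less.prems, of "half_plan Ts"] by (auto simp: general_plan_def)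
  consider "\<not> 3 \<le> length T" | "3 \<le> length T" "halves Ts T \<noteq> []" | "3 \<le> length T" "halves Ts T = []"
    by blast
  then show ?case
  proof cases
    case 1
    show ?thesis
      by (rule scratch_supported(2)) (use 1 half T V in \<open>auto simp: half_plan_def\<close>)
  next
    case 2
    then obtain S Ss where S: "halves Ts T = S # Ss" by (cases "halves Ts T") auto
    then have "S \<in> set (halves Ts T)" by simp
    then have ST: "S \<in> set Ts" "set S \<subset> set T" by (auto simp: halves_def)
    then have "length S < length T"
      using psubset_card_mono[of "set T" "set S"] tree_listD(3)[OF Ts] T(3) by simp
    then have "set S \<in> avail ?V ?I" using less.hyps ST by blast
    note S' = this
    show ?thesis
      by (rule extend_supported(2)[of S])
        (use S' half T V ST 2 S tree_listD(2)[OF Ts] in \<open>auto simp: half_plan_def\<close>)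
  next
    case 3
    then have L: "T \<in> set (loose Ts)" using less.prems by (simp add: loose_def)
    show ?thesis
    proof (cases "T \<in> set (fst (grouping Ts))")
      case True
      then have "set (scratch T) \<subseteq> set ?I" by (auto simp: general_plan_def)
      then show ?thesis by (rule scratch_supported(2)) (use T V in auto)
    next
      case False
      then obtain x where x: "x \<in> set (snd (grouping Ts))" "part_of x T"
        using greedy_hit[OF L, of overlapping part_of "triples (loose Ts)"]
        unfolding grouping_def[symmetric] by blast
      note m = grouping_tripleD[OF Ts x(1)]
      have plan: "set (triple_plan x) \<subseteq> set ?I"
        using set_concat_map_subset[OF x(1), of triple_plan] by (auto simp: general_plan_def)
      have mT: "set (meet x) \<subseteq> set T" using m(3)[OF x(2)] by blast
      have mI: "set (meet x) \<in> avail ?V ?I"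
        by (rule scratch_supported(2)) (use plan m mT V in \<open>auto simp: triple_plan_def\<close>)
      have "set (extend (meet x) T) \<subseteq> set ?I"
        using plan x(2) by (auto simp: triple_plan_def part_of_def)
      then show ?thesis
        by (rule extend_supported(2)) (use m mI mT T V in auto)
    qed
  qed
qed

lemma general_plan_supported:
  assumes Ts: "tree_list Ts" and p: "p \<in> set (general_plan Ts)"
  shows "supported (concat Ts) (general_plan Ts) p"
proof -
  let ?V = "concat Ts" and ?I = "general_plan Ts"
  have V: "set T \<subseteq> set ?V" if "T \<in> set Ts" for T using that by auto
  consider T where "T \<in> set Ts" "p \<in> set (half_plan Ts T)"
    | x where "x \<in> set (snd (grouping Ts))" "p \<in> set (triple_plan x)"
    | T where "T \<in> set (fst (grouping Ts))" "p \<in> set (scratch T)"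
    using p by (auto simp: general_plan_def)
  then show ?thesis
  proof cases
    case 1
    have I: "set (half_plan Ts T) \<subseteq> set ?I"
      using set_concat_map_subset[OF 1(1), of "half_plan Ts"] by (auto simp: general_plan_def)
    note T = tree_listD[OF Ts 1(1)]
    show ?thesis
    proof (cases "3 \<le> length T")
      case True
      then obtain S where S: "S \<in> set (take 1 (halves Ts T))" "p \<in> set (extend S T)"
        using 1(2) by (auto simp: half_plan_def)
      then have "S \<in> set (halves Ts T)" by (meson in_set_takeD)
      then have ST: "S \<in> set Ts" "set S \<subseteq> set T" by (auto simp: halves_def)
      have "set (extend S T) \<subseteq> set ?I"
        using I S(1) True by (auto simp: half_plan_def)
      then show ?thesis
        using extend_supported(1)[of S T ?I ?V] S(2) ST T V[OF 1(1)]
          general_plan_avail[OF Ts] tree_listD(2)[OF Ts] by blast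
    next
      case False
      then show ?thesis
        using scratch_supported(1)[of T ?I ?V] I 1 T V[OF 1(1)] by (simp add: half_plan_def)
    qed
  next
    case 2
    note m = grouping_tripleD[OF Ts 2(1)]
    have I: "set (triple_plan x) \<subseteq> set ?I"
      using set_concat_map_subset[OF 2(1), of triple_plan] by (auto simp: general_plan_def)
    have x: "part_of x T \<Longrightarrow> T \<in> set Ts \<and> set (meet x) \<subseteq> set T" for T
      using m(3) loose_subset by blast
    from x[of "fst x"] have "set (meet x) \<subseteq> set ?V" by (auto simp: part_of_def)
    then have mm: "\<forall>p\<in>set (scratch (meet x)). supported ?V ?I p" "set (meet x) \<in> avail ?V ?I"
      using scratch_supported[of "meet x" ?I ?V] I m by (simp_all add: triple_plan_def)
    have ex: "\<forall>p\<in>set (extend (meet x) T). supported ?V ?I p" if "part_of x T" for T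
    proof (rule extend_supported(1))
      show "set (extend (meet x) T) \<subseteq> set ?I"
        using I that by (auto simp: triple_plan_def part_of_def)
    qed (use x[OF that] tree_listD[OF Ts] V m mm in auto)
    have parts: "part_of x (fst x)" "part_of x (fst (snd x))" "part_of x (snd (snd x))"
      by (simp_all add: part_of_def)
    show ?thesis
      using 2(2) mm(1) ex[OF parts(1)] ex[OF parts(2)] ex[OF parts(3)]
      by (auto simp: triple_plan_def)
  next
    case 3
    then have "T \<in> set Ts"
      using greedy_subset[of overlapping part_of "triples (loose Ts)" "loose Ts"] loose_subset
      unfolding grouping_def[symmetric] by blast
    moreover have "set (scratch T) \<subseteq> set ?I" using 3 by (auto simp: general_plan_def)
    ultimately show ?thesis
      using scratch_supported(1)[of T ?I ?V] 3(2) tree_listD[OF Ts] V by blast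
  qed
qed

text \<open>A tree of size two costs 1, and here 1 is at most 2k/3 because k is at least 2. A larger
  one adds at most half of its elements to the tree below it. Loose trees receive no instruction at
  this point.\<close>

lemma length_half_plan:
  assumes Ts: "tree_list Ts" and T: "T \<in> set Ts" and k: "length T \<le> k"
  shows "real (length (half_plan Ts T)) \<le>
    (if T \<in> set (loose Ts) \<or> length T < 2 then 0 else 2 / 3 * real k)"
proof -
  note TT = tree_listD[OF Ts T]
  consider "length T < 2" | "length T = 2"
    | "3 \<le> length T" "halves Ts T \<noteq> []" | "3 \<le> length T" "halves Ts T = []"
    by linarith
  then show ?thesis
  proof cases
    case 3
    then obtain S Ss where S: "halves Ts T = S # Ss" by (cases "halves Ts T") auto
    then have "S \<in> set (halves Ts T)" by simp
    then have ST: "S \<in> set Ts" "set S \<subseteq> set T" "length T \<le> 2 * length S" by (auto simp: halves_def)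
    have "length (half_plan Ts T) = length T - length S"
      using 3 S length_extend[OF TT(1) tree_listD(1)[OF Ts ST(1)] ST(2)] by (simp add: half_plan_def)
    then have "2 * length (half_plan Ts T) \<le> k" using ST(3) k by simp
    moreover have "T \<notin> set (loose Ts)" using 3 by (simp add: loose_def)
    ultimately show ?thesis using 3 by simp
  next
    case 4
    then show ?thesis by (simp add: half_plan_def)
  qed (use k in \<open>auto simp: half_plan_def length_scratch loose_def\<close>)
qed

text \<open>With intersection size m and tree sizes a, b, c, the cost is a + b + c - 2m - 1. Each
  size is at most k and at most 2m, so the cost is below 4m, which suffices if 2m is at most k, and
  below 3k - 2m, which suffices otherwise.\<close>

lemma length_triple_plan:
  assumes Ts: "tree_list Ts" and x: "x \<in> set (snd (grouping Ts))"
    and k: "\<And>T. T \<in> set Ts \<Longrightarrow> length T \<le> k"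
  shows "length (triple_plan x) \<le> 2 * k"
proof -
  note m = grouping_tripleD[OF Ts x]
  have "length (extend (meet x) T) = length T - length (meet x) \<and> length T \<le> k \<and>
      length T \<le> 2 * length (meet x) \<and> length (meet x) \<le> length T" if "part_of x T" for T
  proof -
    have T: "T \<in> set Ts" "set (meet x) \<subseteq> set T" "length T \<le> 2 * length (meet x)"
      using m(3)[OF that] loose_subset by auto
    then have "length (meet x) \<le> length T"
      using card_mono[OF _ T(2)] tree_listD(3)[OF Ts T(1)] m(1) by (simp add: distinct_card)
    then show ?thesis
      using T length_extend[OF _ m(1) T(2)] tree_listD(1)[OF Ts T(1)] k by simp
  qed
  from this[of "fst x"] this[of "fst (snd x)"] this[of "snd (snd x)"]
  show ?thesis by (simp add: triple_plan_def part_of_def length_scratch) arith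
qed

text \<open>The larger child of a remaining tree has at least two elements, so it is a gate label,
  and it cannot be a tree, as it would then belong to \<open>halves\<close>. It remains to bound how
  often such a child is shared.\<close>

lemma general_lower_bound:
  assumes Ts: "tree_list Ts" and \<Gamma>: "gate_family (set ` set Ts) \<Gamma>"
  shows "2 * card {T \<in> set Ts. 2 \<le> length T} + length (fst (grouping Ts)) \<le> 2 * card \<Gamma>"
proof -
  let ?N = "{T \<in> set Ts. 2 \<le> length T}" and ?R = "fst (grouping Ts)"
  have RL: "set ?R \<subseteq> set (loose Ts)"
    unfolding grouping_def by (rule greedy_subset)
  have NG: "set ` ?N \<subseteq> \<Gamma>"
    using \<Gamma> tree_listD(3)[OF Ts] by (auto simp: gate_family_def)
  have "\<exists>D. D \<in> \<Gamma> \<and> D \<notin> set ` set Ts \<and> D \<subseteq> set T \<and> length T \<le> 2 * card D" if "T \<in> set ?R" for T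
  proof -
    from that RL have T: "T \<in> set Ts" "3 \<le> length T" "halves Ts T = []" by (auto simp: loose_def)
    then have "set T \<in> \<Gamma>" using NG by auto
    then obtain B C where BC: "set T = B \<union> C" "B \<inter> C = {}" "B \<noteq> {}" "C \<noteq> {}"
      "card B = 1 \<or> B \<in> \<Gamma>" "card C = 1 \<or> C \<in> \<Gamma>" "finite B" "finite C"
      using \<Gamma> unfolding gate_family_def by (metis finite_Un)
    have sum: "card B + card C = length T"
      using BC tree_listD(3)[OF Ts T(1)] by (simp add: card_Un_disjoint)
    have "\<exists>D. (card D = 1 \<or> D \<in> \<Gamma>) \<and> D \<subset> set T \<and> length T \<le> 2 * card D"
    proof (cases "card B \<le> card C")
      case True
      then show ?thesis using sum BC by (intro exI[of _ C]) auto
    next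
      case False
      then show ?thesis using sum BC by (intro exI[of _ B]) auto
    qed
    then obtain D where D: "card D = 1 \<or> D \<in> \<Gamma>" "D \<subset> set T" "length T \<le> 2 * card D" by blast
    have "D \<in> \<Gamma>" using D T(2) by auto
    moreover have "D \<notin> set ` set Ts"
    proof
      assume "D \<in> set ` set Ts"
      then obtain S where S: "S \<in> set Ts" "D = set S" by auto
      then have "S \<in> set (halves Ts T)"
        using D tree_listD(3)[OF Ts S(1)] by (auto simp: halves_def)
      then show False using T(3) by simp
    qed
    ultimately show ?thesis using D by blast
  qed
  then obtain f where f: "\<And>T. T \<in> set ?R \<Longrightarrow> f T \<in> \<Gamma> \<and> f T \<notin> set ` set Ts \<and> f T \<subseteq> set T \<and>
      length T \<le> 2 * card (f T)"
    by metis
  have "card (set ?R) \<le> 2 * card (f ` set ?R)"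
  proof (rule card_le_fibers)
    fix D
    \<comment> \<open>Three trees with the same larger child \<open>D\<close> would form an
      overlapping triple: \<open>D\<close> lies in their intersection and has at least half the size
      of each. The greedy pass has left no such triple.\<close>
    show "card {T \<in> set ?R. f T = D} \<le> 2"
    proof (rule card_le_2I)
      fix A B C
      assume ABC: "A \<in> {T \<in> set ?R. f T = D}" "B \<in> {T \<in> set ?R. f T = D}" "C \<in> {T \<in> set ?R. f T = D}"
        "A \<noteq> B" "A \<noteq> C" "B \<noteq> C"
      let ?x = "(A, B, C)"
      have x: "?x \<in> set (triples (loose Ts))"
        using ABC RL by (auto simp: triples_def)
      have "\<not> overlapping ?x (fst (greedy overlapping part_of (triples (loose Ts)) (loose Ts)))"
        by (rule greedy_exhausted[OF _ _ x]) (auto simp: overlapping_def part_of_def)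
      moreover have "D \<subseteq> set (meet ?x)" using ABC f[of A] f[of B] f[of C] by (auto simp: meet_def)
      then have "card D \<le> length (meet ?x)"
        using card_mono[of "set (meet ?x)" D] card_length[of "meet ?x"] by simp
      then have "length A \<le> 2 * length (meet ?x)" "length B \<le> 2 * length (meet ?x)"
        "length C \<le> 2 * length (meet ?x)"
        using ABC f[of A] f[of B] f[of C] by auto
      ultimately show False
        using ABC unfolding overlapping_def grouping_def by simp
    qed
  qed simp
  moreover have "distinct ?R"
    using greedy_rest[of overlapping part_of "triples (loose Ts)" "loose Ts"] tree_list_distinct[OF Ts]
    by (auto simp: grouping_def loose_def)
  moreover have "card ?N + card (f ` set ?R) \<le> card \<Gamma>"
  proof -
    have fin: "finite \<Gamma>" using \<Gamma> by (simp add: gate_family_def)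
    have "card (set ` ?N) = card ?N"
      by (rule card_image) (use tree_list_eq[OF Ts] in \<open>auto simp: inj_on_def\<close>)
    moreover have "card (set ` ?N \<union> f ` set ?R) = card (set ` ?N) + card (f ` set ?R)"
      using f by (intro card_Un_disjoint) auto
    moreover have "card (set ` ?N \<union> f ` set ?R) \<le> card \<Gamma>"
      using f NG by (intro card_mono[OF fin]) auto
    ultimately show ?thesis by simp
  qed
  ultimately show ?thesis by (simp add: distinct_card)
qed

lemma sum_list_le_length:
  assumes "\<And>x. x \<in> set xs \<Longrightarrow> f x \<le> (c :: real)"
  shows "sum_list (map f xs) \<le> c * real (length xs)"
  using assms by (induction xs) (auto simp: algebra_simps add_mono)

lemma real_length_concat: "real (length (concat (map f xs))) = sum_list (map (\<lambda>x. real (length (f x))) xs)"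
  by (induction xs) auto

text \<open>In units of 2k/3, a tree built on another tree costs at most one unit and so does each
  of the three members of a group. A remaining tree costs at most k, which is 3/2 units: one for the
  tree and one half from the labels outside the family.\<close>

lemma general_plan_cost:
  assumes Ts: "tree_list Ts" and k: "\<And>T. T \<in> set Ts \<Longrightarrow> length T \<le> k"
    and \<Gamma>: "gate_family (set ` set Ts) \<Gamma>"
  shows "real (length (general_plan Ts)) \<le> 2 / 3 * real k * real (card \<Gamma>)"
proof -
  let ?N = "{T \<in> set Ts. 2 \<le> length T}" and ?U = "set (loose Ts)"
    and ?R = "fst (grouping Ts)" and ?X = "snd (grouping Ts)"
  have UN: "?U \<subseteq> ?N" by (auto simp: loose_def)
  have RL: "set ?R \<subseteq> ?U" unfolding grouping_def by (rule greedy_subset)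
  have "real (length (concat (map (half_plan Ts) Ts))) = (\<Sum>T\<in>set Ts. real (length (half_plan Ts T)))"
    using tree_list_distinct[OF Ts] by (simp add: real_length_concat sum_list_distinct_conv_sum_set)
  also have "\<dots> \<le> (\<Sum>T\<in>set Ts. if T \<in> ?U \<or> length T < 2 then 0 else 2 / 3 * real k)"
    using length_half_plan[OF Ts _ k] by (intro sum_mono) blast
  also have "\<dots> = (\<Sum>T\<in>?N - ?U. 2 / 3 * real k)"
    by (rule sum.mono_neutral_cong_right) auto
  also have "\<dots> = 2 / 3 * real k * (real (card ?N) - real (card ?U))"
    using UN card_mono[OF _ UN] by (simp add: card_Diff_subset of_nat_diff)
  finally have 1: "real (length (concat (map (half_plan Ts) Ts))) \<le>
      2 / 3 * real k * (real (card ?N) - real (card ?U))" .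
  have 2: "real (length (concat (map triple_plan ?X))) \<le> 2 * real k * real (length ?X)"
    unfolding real_length_concat
  proof (rule sum_list_le_length)
    fix x assume "x \<in> set ?X"
    from length_triple_plan[OF Ts this k] show "real (length (triple_plan x)) \<le> 2 * real k" by linarith
  qed
  have 3: "real (length (concat (map scratch ?R))) \<le> real k * real (length ?R)"
    unfolding real_length_concat
  proof (rule sum_list_le_length)
    fix T assume "T \<in> set ?R"
    then have "length T \<le> k" using RL loose_subset k by blast
    then show "real (length (scratch T)) \<le> real k" by (simp add: length_scratch)
  qed
  have "distinct (loose Ts)" using tree_list_distinct[OF Ts] by (simp add: loose_def)
  moreover have "3 \<le> length (filter (part_of x) r)" if "distinct r" "overlapping x r" for x r
  proof -
    have "{fst x, fst (snd x), snd (snd x)} \<subseteq> set (filter (part_of x) r)"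
      using that(2) by (auto simp: overlapping_def part_of_def)
    from card_mono[OF _ this] have "card {fst x, fst (snd x), snd (snd x)} \<le> length (filter (part_of x) r)"
      using distinct_card[of "filter (part_of x) r"] that(1) by simp
    then show ?thesis using that(2) by (simp add: overlapping_def)
  qed
  ultimately have "3 * length ?X + length ?R \<le> length (loose Ts)"
    unfolding grouping_def by (intro greedy_count)
  then have cnt: "3 * real (length ?X) + real (length ?R) \<le> real (card ?U)"
    using \<open>distinct (loose Ts)\<close> by (simp add: distinct_card)
  have lb: "2 * real (card ?N) + real (length ?R) \<le> 2 * real (card \<Gamma>)"
    using general_lower_bound[OF Ts \<Gamma>] by linarith
  have "real (length (general_plan Ts)) \<le> 2 / 3 * real k * (real (card ?N) - real (card ?U)) +
      2 * real k * real (length ?X) + real k * real (length ?R)"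
    using 1 2 3 by (simp add: general_plan_def)
  also have "\<dots> = 2 / 3 * real k * (real (card ?N) - real (card ?U) +
      3 * real (length ?X) + 3 / 2 * real (length ?R))"
    by (simp add: algebra_simps)
  also have "\<dots> \<le> 2 / 3 * real k * real (card \<Gamma>)"
    using cnt lb by (intro mult_left_mono) auto
  finally show ?thesis .
qed

lemma card_le_max_tree_size: "finite \<T> \<Longrightarrow> T \<in> \<T> \<Longrightarrow> card T \<le> max_tree_size \<T>"
  by (simp add: max_tree_size_def)

text \<open>The inputs are \<open>concat Ts\<close>. A variable in several trees yields several
  inputs, which is free because only gates are counted.\<close>

lemma plan_approximation:
  assumes "is_instance n \<T>" "represents Ts \<T>"
    and "\<And>p. p \<in> set I \<Longrightarrow> supported (concat Ts) I p"
    and "\<And>T. T \<in> set Ts \<Longrightarrow> set T \<in> avail (concat Ts) I"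
    and "\<And>\<Gamma>. gate_family \<T> \<Gamma> \<Longrightarrow> real (length I) \<le> \<alpha> * real (card \<Gamma>)" "0 \<le> \<alpha>"
  shows "is_solution n \<T> (assemble (concat Ts) I) \<and>
    real (num_gates (assemble (concat Ts) I)) \<le> \<alpha> * real (opt n \<T>)"
proof -
  have \<T>: "\<T> = set ` set Ts" using assms(2) by (auto simp: represents_def)
  have "set (concat Ts) \<subseteq> {1..n}" "\<T> \<subseteq> avail (concat Ts) I"
    using assms(1,4) unfolding \<T> is_instance_def by auto
  from assemble_correct[OF assms(3) this]
  show ?thesis using le_opt[OF _ assms(5,6)] by simp
qed

lemma general_approximation:
  "poly_time_approximable (\<lambda>_. True) (\<lambda>\<T>. 2 / 3 * real (max_tree_size \<T>))"
proof (rule poly_time_approximableI[where alg = "\<lambda>p. assemble (concat (snd p)) (general_plan (snd p))"])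
  show "ptime (\<lambda>p. assemble (concat (snd p)) (general_plan (snd p)))"
    by (intro ptime_intros ptime_comp[OF ptime_general_plan])
  fix n \<T> Ts
  assume inst: "is_instance n \<T>" and rep: "represents Ts \<T>"
  have Ts: "tree_list Ts" using inst rep by (rule tree_listI)
  have \<T>: "\<T> = set ` set Ts" using rep by (auto simp: represents_def)
  have "length T \<le> max_tree_size \<T>" if "T \<in> set Ts" for T
    using card_le_max_tree_size[of \<T> "set T"] that tree_listD(3)[OF Ts that] by (simp add: \<T>)
  then have "real (length (general_plan Ts)) \<le> 2 / 3 * real (max_tree_size \<T>) * real (card \<Gamma>)"
    if "gate_family \<T> \<Gamma>" for \<Gamma>
    using general_plan_cost[OF Ts] that unfolding \<T> by blast
  then show "is_solution n \<T> (assemble (concat (snd (n, Ts))) (general_plan (snd (n, Ts)))) \<and>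
     real (num_gates (assemble (concat (snd (n, Ts))) (general_plan (snd (n, Ts))))) \<le>
     2 / 3 * real (max_tree_size \<T>) * real (opt n \<T>)"
    unfolding snd_conv
    by (intro plan_approximation[OF inst rep general_plan_supported[OF Ts] general_plan_avail[OF Ts]]) auto
qed

section \<open>Charging scheme for trees of size at most four\<close>

lemma card_pairs_of_4: "card A = 4 \<Longrightarrow> card {q. q \<subseteq> A \<and> card q = 2} = 6"
  using n_subsets[of A 2] card.infinite[of A] by (cases "finite A") (auto simp: choose_two)

lemma sum_split_by:
  assumes "finite A" "finite B" "\<And>x. x \<in> A \<Longrightarrow> f x \<in> B"
  shows "(\<Sum>x\<in>A. g x) = (\<Sum>y\<in>B. \<Sum>x\<in>{x \<in> A. f x = y}. g x)"
proof -
  have "f ` A \<subseteq> B" using assms(3) by blast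
  from sum.group[OF assms(1,2) this, of g] show ?thesis by simp
qed

lemma gate_family_mem: "gate_family \<T> \<Gamma> \<Longrightarrow> T \<in> \<T> \<Longrightarrow> 2 \<le> card T \<Longrightarrow> T \<in> \<Gamma>"
  by (simp add: gate_family_def)

lemma gate_familyE:
  assumes "gate_family \<T> \<Gamma>" "A \<in> \<Gamma>"
  obtains B C where "A = B \<union> C" "B \<inter> C = {}" "finite B" "finite C" "0 < card B" "0 < card C"
    "card B + card C = card A" "card B = 1 \<or> B \<in> \<Gamma>" "card C = 1 \<or> C \<in> \<Gamma>"
proof -
  obtain B C where BC: "A = B \<union> C" "B \<inter> C = {}" "finite A" "B \<noteq> {}" "C \<noteq> {}"
    "card B = 1 \<or> B \<in> \<Gamma>" "card C = 1 \<or> C \<in> \<Gamma>"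
    using assms(1)[unfolded gate_family_def, THEN conjunct2, THEN conjunct2, THEN bspec, OF assms(2)]
    by (elim exE conjE)
  have fin: "finite B" "finite C" using BC(1,3) by simp_all
  show thesis
  proof (rule that[OF BC(1,2) fin _ _ _ BC(6,7)])
    show "0 < card B" "0 < card C" using BC(4,5) fin by (simp_all add: card_gt_0_iff)
    show "card B + card C = card A" unfolding BC(1) using fin BC(2) by (simp add: card_Un_disjoint)
  qed
qed

text \<open>
  T2 and T3 are the trees of size two and three, Q the quadruples left by the first phase, K the
  surviving pairs, W the trees to be covered in the third phase and \<pi> their prices.
\<close>

locale cover_prices =
  fixes T2 T3 Q K W :: "nat set set" and \<pi> :: "nat set \<Rightarrow> real"
  assumes fin: "finite T3" "finite Q"
    and T3: "\<And>A. A \<in> T3 \<Longrightarrow> card A = 3"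
    and W: "W = {A \<in> T3 \<union> Q. \<forall>q\<in>T2 \<union> K. \<not> q \<subseteq> A}"
    and price5: "\<And>p Z. card p = 2 \<Longrightarrow> Z \<subseteq> {A \<in> W. p \<subseteq> A} \<Longrightarrow>
      sum \<pi> Z \<le> real (card Z) / 5 + 77 / 60"
begin

lemma finite_W: "finite W"
  using fin by (auto simp: W)

text \<open>A gate for a triple joins a pair with a singleton. The pair is itself a gate label, and
  members of \<open>W\<close> contain neither tree pairs nor surviving pairs.\<close>

lemma triple_pair:
  assumes \<Gamma>: "gate_family \<T> \<Gamma>" and "T3 \<subseteq> \<T>" and A: "A \<in> W" "A \<in> T3"
  shows "\<exists>h. h \<in> \<Gamma> \<and> card h = 2 \<and> h \<subseteq> A \<and> h \<notin> T2 \<and> h \<notin> K"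
proof -
  have "card A = 3" using T3 A(2) by blast
  then have "A \<in> \<Gamma>" using gate_family_mem[OF \<Gamma>] A(2) assms(2) by auto
  obtain B C where BC: "A = B \<union> C" "B \<inter> C = {}"
    "finite B" "finite C" "0 < card B" "0 < card C" "card B + card C = card A"
    "card B = 1 \<or> B \<in> \<Gamma>" "card C = 1 \<or> C \<in> \<Gamma>"
    by (rule gate_familyE[OF \<Gamma> \<open>A \<in> \<Gamma>\<close>])
  have no: "h \<notin> T2 \<and> h \<notin> K" if "h \<subseteq> A" for h
    using A(1) that unfolding W by blast
  consider "card B = 1" "card C = 2" | "card B = 2" "card C = 1"
    using BC \<open>card A = 3\<close> by linarith
  then show ?thesis
  proof cases
    case 1
    then show ?thesis using BC no[of C] by (intro exI[of _ C]) simp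
  next
    case 2
    then show ?thesis using BC no[of B] by (intro exI[of _ B]) simp
  qed
qed

text \<open>Each covered triple is charged to one hidden pair inside it. The trees charged to the
  same pair all contain it, so \<open>price5\<close> bounds each class, with 77/60 left to the pair
  itself.\<close>

lemma triples_only:
  assumes \<Gamma>: "gate_family \<T> \<Gamma>" and "T3 \<subseteq> \<T>" and "Q = {}"
  shows "sum \<pi> W \<le> real (card T3) / 5 + 77 / 60 * real (card {A \<in> \<Gamma>. card A = 2 \<and> A \<notin> T2})"
proof -
  let ?H = "{A \<in> \<Gamma>. card A = 2 \<and> A \<notin> T2}"
  have finH: "finite ?H" using \<Gamma> by (simp add: gate_family_def)
  have WT: "W \<subseteq> T3" using assms(3) unfolding W by blast
  define h where "h A = (SOME y. y \<in> ?H \<and> y \<subseteq> A)" for A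
  have h: "h A \<in> ?H \<and> h A \<subseteq> A" if "A \<in> W" for A
    unfolding h_def
  proof (rule someI_ex)
    have "A \<in> T3" using that WT by blast
    from triple_pair[OF \<Gamma> assms(2) that this] show "\<exists>y. y \<in> ?H \<and> y \<subseteq> A" by simp blast
  qed
  have "sum \<pi> W = (\<Sum>y\<in>?H. sum \<pi> {A \<in> W. h A = y})"
    by (rule sum_split_by[OF finite_W finH]) (use h in blast)
  also have "\<dots> \<le> (\<Sum>y\<in>?H. real (card {A \<in> W. h A = y}) / 5 + 77 / 60)"
  proof (rule sum_mono)
    fix y assume "y \<in> ?H"
    then have y: "card y = 2" by blast
    show "sum \<pi> {A \<in> W. h A = y} \<le> real (card {A \<in> W. h A = y}) / 5 + 77 / 60"
      by (rule price5[OF y]) (use h in blast)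
  qed
  also have "\<dots> = (\<Sum>y\<in>?H. real (card {A \<in> W. h A = y})) / 5 + 77 / 60 * real (card ?H)"
    by (simp add: sum.distrib sum_divide_distrib)
  also have "(\<Sum>y\<in>?H. real (card {A \<in> W. h A = y})) = real (card W)"
    using sum_split_by[OF finite_W finH, of h "\<lambda>_. 1 :: real", OF conjunct1[OF h]] by simp
  also have "real (card W) \<le> real (card T3)" using card_mono[OF fin(1) WT] by simp
  finally show ?thesis by simp
qed

end

text \<open>The linear accounting of \<open>extra_cost\<close>. Here \<open>yi\<close> and
  \<open>yo\<close> count the quadruples that \<open>\<Gamma>\<close> splits into two available
  pairs and into pairs not both available, \<open>x\<close> those above a hidden triple; the endings
  \<open>c\<close>, \<open>n\<close>, \<open>w\<close> stand for completed, not completed, and to be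
  covered. A quadruple may spend 9/10. Those in \<open>yi\<close> spend 4/5. Those in
  \<open>yo\<close> spend at most 6/5; the excess 3/10 falls at most four times on a pair counted by
  \<open>p2\<close>, and 6/5 + 77/120 < 19/10. Those in \<open>x\<close> spend at most 3/2; the
  excess 3/5 falls at most twice on a triple, and 6/5 + 1/2 < 19/10.\<close>

lemma budget:
  fixes k p1 k' h p2 yi c xc yc xn yn x yo q n t r e xw yw :: nat and pw px py :: real
  assumes "k = p1 + k'" "h = p1 + p2" "5 * k' \<le> 4 * yi + 6 * c" "c = xc + yc" "x = xc + xn" "yo = yc + yn"
    "q = x + (yi + yo)" "n = xn + yn" "r \<le> t" "x \<le> 2 * e" "yo \<le> 4 * p2" "xw \<le> xn" "yw \<le> yn"
    "pw = px + py" "px \<le> real xw / 2 + real e / 2"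
    "py \<le> real yw / 5 + 9 / 10 * real r + 77 / 120 * real p2"
  shows "real k + pw + real n \<le> 9 / 10 * (real t + real q) + 19 / 10 * (real h + real e)"
proof -
  have *: "5 * real k' \<le> 4 * real yi + 6 * real c" "real r \<le> real t" "real x \<le> 2 * real e"
    "real yo \<le> 4 * real p2" "real xw \<le> real xn" "real yw \<le> real yn"
    using assms by linarith+
  have **: "0 \<le> real p1" "0 \<le> real p2" "0 \<le> real yi" "0 \<le> real e" "0 \<le> real xc" by simp_all
  show ?thesis
    using * ** assms(14-16) unfolding assms(1,2,4-8) of_nat_add by (simp add: field_simps)
qed

text \<open>\<open>tri\<close> is the outcome of the first phase and \<open>core\<close> that of the
  second. \<open>Q3\<close> ensures that a triple below a remaining quadruple is never a tree, hence
  counts as a hidden label.\<close>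

locale quad_cover = cover_prices +
  assumes Q4: "\<And>A. A \<in> Q \<Longrightarrow> card A = 4"
    and Q3: "\<And>A S. A \<in> Q \<Longrightarrow> S \<in> T3 \<Longrightarrow> \<not> S \<subseteq> A"
    and tri: "\<And>\<tau>. card \<tau> = 3 \<Longrightarrow> card {A \<in> Q. \<tau> \<subseteq> A} \<le> 2"
    and finK: "finite K" and K2: "\<And>q. q \<in> K \<Longrightarrow> card q = 2" and KT2: "K \<inter> T2 = {}"
    and core: "\<And>q. q \<in> K \<Longrightarrow> 5 \<le> card {A \<in> Q. q \<subseteq> A \<and> A - q \<in> T2 \<union> K}"
    and price2: "\<And>p Z. card p = 2 \<Longrightarrow> Z \<subseteq> {A \<in> W. p \<subseteq> A} \<Longrightarrow>
      sum \<pi> Z \<le> real (card Z) / 2 + 1 / 2"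
begin

definition completed :: "nat set set" where
  "completed = {A \<in> Q. \<exists>q\<in>T2 \<union> K. q \<subseteq> A \<and> A - q \<in> T2 \<union> K}"

lemma completedD: "A \<in> completed \<Longrightarrow> A \<notin> W"
proof
  assume "A \<in> completed" "A \<in> W"
  then obtain q where "q \<in> T2 \<union> K" "q \<subseteq> A" unfolding completed_def by blast
  with \<open>A \<in> W\<close> show False unfolding W by blast
qed

text \<open>Count incidences between pairs of \<open>K - H\<close> and the quadruples they complete.
  Each pair has at least five. A completed quadruple has six pairs, but in \<open>Y\<close> the two
  halves chosen by \<open>sp\<close> lie in \<open>H \<union> T2\<close> and so outside
  \<open>K - H\<close>, which leaves four.\<close>

lemma core_size:
  assumes "finite Y" "Y \<subseteq> completed"
    and sp: "\<And>A. A \<in> Y \<Longrightarrow> sp A \<subseteq> A \<and> card (sp A) = 2 \<and> sp A \<in> H \<union> T2 \<and> A - sp A \<in> H \<union> T2"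
  shows "5 * card (K - H) \<le> 4 * card Y + 6 * card (completed - Y)"
proof -
  let ?R = "\<lambda>q A. q \<subseteq> A \<and> A - q \<in> T2 \<union> K"
  let ?D = "\<lambda>A. {q \<in> K - H. ?R q A}"
  have fincomp: "finite completed" using fin by (simp add: completed_def)
  have pairs: "finite {q. q \<subseteq> A \<and> card q = 2}" "card {q. q \<subseteq> A \<and> card q = 2} = 6"
    if "A \<in> Q" for A
  proof -
    have "0 < card A" using Q4[OF that] by simp
    then have "finite A" by (rule card_ge_0_finite)
    then show "finite {q. q \<subseteq> A \<and> card q = 2}" by simp
    show "card {q. q \<subseteq> A \<and> card q = 2} = 6" by (rule card_pairs_of_4[OF Q4[OF that]])
  qed
  have D: "?D A \<subseteq> {q. q \<subseteq> A \<and> card q = 2}" for A using K2 by blast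
  have all: "card (?D A) \<le> 6" if "A \<in> Q" for A
    using card_mono[OF pairs(1)[OF that] D] pairs(2)[OF that] by simp
  have four: "card (?D A) \<le> 4" if "A \<in> Y" for A
  proof -
    have A: "A \<in> Q" using that assms(2) unfolding completed_def by blast
    let ?P = "{q. q \<subseteq> A \<and> card q = 2}"
    note s = sp[OF that]
    have "finite (sp A)" using s by (intro card_ge_0_finite) simp
    then have c2: "card (A - sp A) = 2" using s Q4[OF A] by (simp add: card_Diff_subset)
    have "sp A \<noteq> {}" using s by auto
    then have ne: "sp A \<noteq> A - sp A" by blast
    have sub: "{sp A, A - sp A} \<subseteq> ?P" using s c2 by simp
    have "q \<noteq> sp A \<and> q \<noteq> A - sp A" if "q \<in> ?D A" for q
    proof -
      have "q \<notin> H \<union> T2" using that KT2 by blast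
      with s show ?thesis by metis
    qed
    then have "?D A \<subseteq> ?P - {sp A, A - sp A}" using D by blast
    from card_mono[OF _ this] have "card (?D A) \<le> card (?P - {sp A, A - sp A})"
      using pairs(1)[OF A] by simp
    also have "\<dots> = card ?P - card {sp A, A - sp A}"
      using sub by (intro card_Diff_subset) auto
    also have "\<dots> = 4"
      using ne pairs(2)[OF A] by simp
    finally show ?thesis .
  qed
  have none: "?D A = {}" if "A \<in> Q" "A \<notin> completed" for A
    using that unfolding completed_def by blast
  have "5 * card (K - H) = (\<Sum>q\<in>K - H. 5)" by simp
  also have "\<dots> \<le> (\<Sum>q\<in>K - H. card {A \<in> Q. ?R q A})"
    by (rule sum_mono) (use core in blast)
  also have "\<dots> = (\<Sum>A\<in>Q. card (?D A))"
    using sum.swap_restrict[of "K - H" Q "\<lambda>_ _. 1::nat" ?R] finK fin(2) by simp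
  also have "\<dots> = (\<Sum>A\<in>completed. card (?D A))"
  proof (rule sum.mono_neutral_right[OF fin(2)])
    show "completed \<subseteq> Q" by (auto simp: completed_def)
    show "\<forall>A\<in>Q - completed. card (?D A) = 0"
    proof
      fix A assume "A \<in> Q - completed"
      then have "?D A = {}" using none by blast
      then show "card (?D A) = 0" by (simp only: card.empty)
    qed
  qed
  also have "\<dots> = (\<Sum>A\<in>completed - Y. card (?D A)) + (\<Sum>A\<in>Y. card (?D A))"
    by (rule sum.subset_diff[OF assms(2) fincomp])
  also have "\<dots> \<le> (\<Sum>A\<in>completed - Y. 6) + (\<Sum>A\<in>Y. 4)"
  proof (intro add_mono sum_mono)
    fix A assume "A \<in> completed - Y"
    then have "A \<in> Q" by (simp add: completed_def)
    then show "card (?D A) \<le> 6" by (rule all)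
  qed (rule four)
  finally show ?thesis by simp
qed

text \<open>The sizes of the two children are 3 + 1 or 2 + 2, and \<open>Q3\<close> excludes a tree
  as the larger child in the first case.\<close>

lemma quad_split:
  assumes \<Gamma>: "gate_family \<T> \<Gamma>" and "Q \<subseteq> \<T>" and A: "A \<in> Q"
  shows "(\<exists>\<tau>\<in>\<Gamma>. card \<tau> = 3 \<and> \<tau> \<notin> T3 \<and> \<tau> \<subseteq> A) \<or>
    (\<exists>s\<in>\<Gamma>. A - s \<in> \<Gamma> \<and> s \<subseteq> A \<and> card s = 2 \<and> card (A - s) = 2)"
proof -
  have "card A = 4" using Q4 A by blast
  then have "A \<in> \<Gamma>" using gate_family_mem[OF \<Gamma>] A assms(2) by auto
  obtain B C where BC: "A = B \<union> C" "B \<inter> C = {}"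
    "finite B" "finite C" "0 < card B" "0 < card C" "card B + card C = card A"
    "card B = 1 \<or> B \<in> \<Gamma>" "card C = 1 \<or> C \<in> \<Gamma>"
    by (rule gate_familyE[OF \<Gamma> \<open>A \<in> \<Gamma>\<close>])
  consider "card C = 3" | "card B = 3" | "card B = 2" "card C = 2"
    using BC \<open>card A = 4\<close> by linarith
  then show ?thesis
  proof cases
    case 1
    then have "C \<in> \<Gamma>" "C \<subseteq> A" using BC by auto
    with 1 Q3[OF A, of C] show ?thesis by blast
  next
    case 2
    then have "B \<in> \<Gamma>" "B \<subseteq> A" using BC by auto
    with 2 Q3[OF A, of B] show ?thesis by blast
  next
    case 3
    moreover have "A - B = C" using BC by auto
    ultimately show ?thesis using BC by (intro disjI2 bexI[of _ B]) auto
  qed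
qed

text \<open>\<open>X\<close> takes every quadruple above a hidden triple, whatever its actual split,
  so the ones in \<open>Y\<close> must be split into two pairs. \<open>H\<close> is confined to
  pairs of occurring variables because the pruning starts from those; this loses nothing, as both
  halves of a tree lie in \<open>V\<close>.\<close>

lemma extra_cost:
  assumes \<Gamma>: "gate_family \<T> \<Gamma>" and sub: "T3 \<subseteq> \<T>" "Q \<subseteq> \<T>"
    and V: "\<And>A. A \<in> T3 \<union> Q \<Longrightarrow> A \<subseteq> V"
    and H: "H = {A \<in> \<Gamma>. card A = 2 \<and> A \<notin> T2 \<and> A \<subseteq> V}"
    and E: "E = {A \<in> \<Gamma>. card A = 3 \<and> A \<notin> T3}"
    and lost: "\<And>Y sp. Y \<subseteq> Q \<Longrightarrow>
      (\<And>A. A \<in> Y \<Longrightarrow> sp A \<subseteq> A \<and> sp A \<in> H \<union> T2 \<and> A - sp A \<in> H \<union> T2) \<Longrightarrow>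
      card {A \<in> Y. \<not> (sp A \<in> T2 \<union> K \<and> A - sp A \<in> T2 \<union> K)} \<le> 4 * card (H - K)"
  shows "real (card K) + sum \<pi> W + real (card (Q - completed)) \<le>
    9 / 10 * (real (card T3) + real (card Q)) + 19 / 10 * (real (card H) + real (card E))"
proof -
  have finH: "finite H" "finite E" using \<Gamma> by (simp_all add: gate_family_def H E)
  define X where "X = {A \<in> Q. \<exists>\<tau>\<in>E. \<tau> \<subseteq> A}"
  define Y where "Y = Q - X"
  have finXY: "finite X" "finite Y" using fin by (simp_all add: X_def Y_def)
  define tau where "tau A = (SOME \<tau>. \<tau> \<in> E \<and> \<tau> \<subseteq> A)" for A
  have tau: "tau A \<in> E \<and> tau A \<subseteq> A" if "A \<in> X" for A
    unfolding tau_def by (rule someI_ex) (use that in \<open>unfold X_def, blast\<close>)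
  define sp where "sp A = (SOME s. s \<subseteq> A \<and> card s = 2 \<and> s \<in> H \<union> T2 \<and> A - s \<in> H \<union> T2 \<and>
      card (A - s) = 2)" for A
  have sp: "sp A \<subseteq> A \<and> card (sp A) = 2 \<and> sp A \<in> H \<union> T2 \<and> A - sp A \<in> H \<union> T2 \<and> card (A - sp A) = 2"
    if "A \<in> Y" for A
    unfolding sp_def
  proof (rule someI_ex)
    have A: "A \<in> Q" "A \<notin> X" using that by (auto simp: Y_def)
    have "\<not> (\<exists>\<tau>\<in>\<Gamma>. card \<tau> = 3 \<and> \<tau> \<notin> T3 \<and> \<tau> \<subseteq> A)"
      using A unfolding X_def E by blast
    with quad_split[OF \<Gamma> sub(2) A(1)] obtain s where
      s: "s \<in> \<Gamma>" "A - s \<in> \<Gamma>" "s \<subseteq> A" "card s = 2" "card (A - s) = 2" by blast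
    have "s \<subseteq> V" "A - s \<subseteq> V" using V A(1) s(3) by blast+
    with s show "\<exists>s. s \<subseteq> A \<and> card s = 2 \<and> s \<in> H \<union> T2 \<and> A - s \<in> H \<union> T2 \<and> card (A - s) = 2"
      by (intro exI[of _ s]) (simp add: H)
  qed
  define Yin where "Yin = {A \<in> Y. sp A \<in> T2 \<union> K \<and> A - sp A \<in> T2 \<union> K}"
  define Yout where "Yout = {A \<in> Y. \<not> (sp A \<in> T2 \<union> K \<and> A - sp A \<in> T2 \<union> K)}"
  have Yout: "card Yout \<le> 4 * card (H - K)"
    unfolding Yout_def
  proof (rule lost)
    show "Y \<subseteq> Q" by (simp add: Y_def)
  qed (use sp in blast)
  have Yin: "Yin \<subseteq> completed"
  proof
    fix A assume "A \<in> Yin"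
    then have A: "A \<in> Y" "A \<in> Q" "sp A \<in> T2 \<union> K" "A - sp A \<in> T2 \<union> K" by (simp_all add: Yin_def Y_def)
    with sp[OF A(1)] show "A \<in> completed" unfolding completed_def by blast
  qed
  have finY: "finite Yin" "finite Yout" using finXY by (simp_all add: Yin_def Yout_def)
  have comp: "completed \<subseteq> Q" by (auto simp: completed_def)

  have X2: "card X \<le> 2 * card E"
  proof -
    have "card X \<le> 2 * card (tau ` X)"
    proof (rule card_le_fibers[OF finXY(1)])
      fix \<tau> assume "\<tau> \<in> tau ` X"
      then have "\<tau> \<in> E" using tau by blast
      then have "card \<tau> = 3" by (simp add: E)
      have "{A \<in> X. tau A = \<tau>} \<subseteq> {A \<in> Q. \<tau> \<subseteq> A}" using tau unfolding X_def by blast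
      from card_mono[OF _ this] show "card {A \<in> X. tau A = \<tau>} \<le> 2"
        using tri[OF \<open>card \<tau> = 3\<close>] fin(2) by simp
    qed
    moreover have "card (tau ` X) \<le> card E" by (rule card_mono[OF finH(2)]) (use tau in blast)
    ultimately show ?thesis by simp
  qed

  have K5: "5 * card (K - H) \<le> 4 * card Yin + 6 * card (completed - Yin)"
    using finY(1) Yin by (rule core_size) (use sp in \<open>unfold Yin_def, blast\<close>)

  \<comment> \<open>All quadruples charged to a triple share any fixed pair of it, so
    \<open>price2\<close> applies. For one or two quadruples it is smaller than the bound of
    \<open>price5\<close>.\<close>
  have piX: "sum \<pi> (X \<inter> W) \<le> real (card (X \<inter> W)) / 2 + real (card E) / 2"
  proof -
    let ?Z = "\<lambda>\<tau>. {A \<in> X \<inter> W. tau A = \<tau>}"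
    have "sum \<pi> (X \<inter> W) = (\<Sum>\<tau>\<in>E. sum \<pi> (?Z \<tau>))"
      by (rule sum_split_by) (use finXY finH tau in auto)
    also have "\<dots> \<le> (\<Sum>\<tau>\<in>E. real (card (?Z \<tau>)) / 2 + 1 / 2)"
    proof (rule sum_mono)
      fix \<tau> assume "\<tau> \<in> E"
      then have "2 \<le> card \<tau>" by (simp add: E)
      then obtain p where p: "p \<subseteq> \<tau>" "card p = 2" by (rule obtain_subset_with_card_n)
      show "sum \<pi> (?Z \<tau>) \<le> real (card (?Z \<tau>)) / 2 + 1 / 2"
        by (rule price2[OF p(2)]) (use tau p(1) in blast)
    qed
    also have "\<dots> = (\<Sum>\<tau>\<in>E. real (card (?Z \<tau>))) / 2 + real (card E) / 2"
      by (simp add: sum.distrib sum_divide_distrib)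
    also have "(\<Sum>\<tau>\<in>E. real (card (?Z \<tau>))) = real (card (X \<inter> W))"
      using sum_split_by[of "X \<inter> W" E tau "\<lambda>_. 1 :: real"] tau finXY finH by simp
    finally show ?thesis .
  qed

  define R where "R = W \<inter> T3"
  have finR: "finite R" using fin by (simp add: R_def)
  have RQ: "A \<notin> Q" if "A \<in> R" for A
    using that T3[of A] Q4[of A] by (auto simp: R_def)
  define h where "h A = (SOME y. y \<in> H - K \<and> y \<subseteq> A)" for A
  have h: "h A \<in> H - K \<and> h A \<subseteq> A" if A: "A \<in> R" for A
    unfolding h_def
  proof (rule someI_ex)
    have "A \<in> W" "A \<in> T3" using A by (auto simp: R_def)
    from triple_pair[OF \<Gamma> sub(1) this] obtain y where
      y: "y \<in> \<Gamma>" "card y = 2" "y \<subseteq> A" "y \<notin> T2" "y \<notin> K" by blast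
    moreover have "y \<subseteq> V" using V \<open>A \<in> T3\<close> y(3) by blast
    ultimately show "\<exists>y. y \<in> H - K \<and> y \<subseteq> A" by (intro exI[of _ y]) (simp add: H)
  qed
  define YW where "YW = Y \<inter> W"
  have finYW: "finite YW" using finXY by (simp add: YW_def)
  have spW: "sp A \<in> H - K" "A - sp A \<in> H - K" "sp A \<noteq> A - sp A" if "A \<in> YW" for A
  proof -
    have A: "A \<in> Y" and no: "q \<notin> T2 \<union> K" if "q \<subseteq> A" for q
      using \<open>A \<in> YW\<close> that unfolding YW_def W by blast+
    note s = sp[OF A[OF order_refl]]
    show "sp A \<in> H - K" using s no[of "sp A"] by blast
    show "A - sp A \<in> H - K" using s no[of "A - sp A"] by blast
    have "sp A \<noteq> {}" using s by auto
    then show "sp A \<noteq> A - sp A" by blast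
  qed
  let ?Yh = "\<lambda>y. {A \<in> YW. sp A = y \<or> A - sp A = y}" and ?Rh = "\<lambda>y. {A \<in> R. h A = y}"
  \<comment> \<open>Each quadruple of \<open>YW\<close> lies in exactly two classes, those of its
    two distinct halves, so both halves can carry half of its price.\<close>
  have double: "(\<Sum>y\<in>H - K. sum g (?Yh y)) = 2 * sum g YW" for g :: "nat set \<Rightarrow> real"
  proof -
    have "sum g (?Yh y) = sum g {A \<in> YW. sp A = y} + sum g {A \<in> YW. A - sp A = y}" for y
    proof -
      have "?Yh y = {A \<in> YW. sp A = y} \<union> {A \<in> YW. A - sp A = y}" by auto
      moreover have "{A \<in> YW. sp A = y} \<inter> {A \<in> YW. A - sp A = y} = {}" using spW(3) by blast
      ultimately show ?thesis using finYW by (simp add: sum.union_disjoint)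
    qed
    moreover have "(\<Sum>y\<in>H - K. sum g {A \<in> YW. sp A = y}) = sum g YW"
      using sum_split_by[of YW "H - K" sp g] spW finYW finH by simp
    moreover have "(\<Sum>y\<in>H - K. sum g {A \<in> YW. A - sp A = y}) = sum g YW"
      using sum_split_by[of YW "H - K" "\<lambda>A. A - sp A" g] spW finYW finH by simp
    ultimately show ?thesis by (simp add: sum.distrib)
  qed
  have single: "(\<Sum>y\<in>H - K. sum g (?Rh y)) = sum g R" for g :: "nat set \<Rightarrow> real"
    using sum_split_by[of R "H - K" h g] h finR finH by simp
  have piYR: "sum \<pi> YW + sum \<pi> R \<le>
      real (card YW) / 5 + 9 / 10 * real (card R) + 77 / 120 * real (card (H - K))"
  proof -
    have each: "sum \<pi> (?Yh y) / 2 + sum \<pi> (?Rh y) \<le>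
        real (card (?Yh y)) / 10 + 9 / 10 * real (card (?Rh y)) + 77 / 120" if y: "y \<in> H - K" for y
    proof -
      have y2: "card y = 2" using y by (simp add: H)
      have YR: "?Yh y \<inter> ?Rh y = {}" using RQ unfolding YW_def Y_def by blast
      have "A \<in> W \<and> y \<subseteq> A" if "A \<in> ?Yh y" for A
        using that sp[of A] unfolding YW_def by blast
      moreover have "A \<in> W \<and> y \<subseteq> A" if "A \<in> ?Rh y" for A
        using that h[of A] unfolding R_def by blast
      ultimately have subs: "?Yh y \<union> ?Rh y \<subseteq> {A \<in> W. y \<subseteq> A}" by blast
      have 1: "sum \<pi> (?Yh y) + sum \<pi> (?Rh y) \<le> (real (card (?Yh y)) + real (card (?Rh y))) / 5 + 77 / 60"
        using price5[OF y2 subs] finYW finR YR by (simp add: sum.union_disjoint card_Un_disjoint)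
      have 2: "sum \<pi> (?Rh y) \<le> real (card (?Rh y)) / 5 + 77 / 60"
        by (rule price5[OF y2]) (use subs in blast)
      show ?thesis
      proof (cases "?Rh y = {}")
        case True
        have "sum \<pi> (?Rh y) = 0" "card (?Rh y) = 0" unfolding True by simp_all
        with 1 show ?thesis by simp
      next
        case False
        then have "1 \<le> real (card (?Rh y))"
          using finR by (simp add: card_gt_0_iff Suc_le_eq)
        \<comment> \<open>Quadruples enter with half their price, triples with the full price. Half
          the sum of the two bounds is a/10 + b/5 + 77/60, and since b is at least 1, the surplus
          77/120 is absorbed by 7b/10.\<close>
        moreover have "u / 2 + v \<le> a / 10 + 9 / 10 * b + 77 / 120"
          if "u + v \<le> (a + b) / 5 + 77 / 60" "v \<le> b / 5 + 77 / 60" "1 \<le> b" for u v a b :: real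
          using that by argo
        ultimately show ?thesis using 1 2 by blast
      qed
    qed
    have "2 * sum \<pi> YW / 2 + sum \<pi> R = (\<Sum>y\<in>H - K. sum \<pi> (?Yh y) / 2 + sum \<pi> (?Rh y))"
      unfolding sum.distrib sum_divide_distrib[symmetric] double single ..
    also have "\<dots> \<le> (\<Sum>y\<in>H - K. real (card (?Yh y)) / 10 + 9 / 10 * real (card (?Rh y)) + 77 / 120)"
      using each by (rule sum_mono)
    also have "\<dots> = (\<Sum>y\<in>H - K. real (card (?Yh y))) / 10 + 9 / 10 * (\<Sum>y\<in>H - K. real (card (?Rh y))) +
        77 / 120 * real (card (H - K))"
      by (simp add: sum.distrib sum_divide_distrib sum_distrib_left)
    also have "(\<Sum>y\<in>H - K. real (card (?Yh y))) = 2 * real (card YW)"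
      using double[of "\<lambda>_. 1"] by simp
    also have "(\<Sum>y\<in>H - K. real (card (?Rh y))) = real (card R)"
      using single[of "\<lambda>_. 1"] by simp
    finally show ?thesis by simp
  qed

  have WX: "X \<inter> W \<subseteq> X - completed" using completedD by blast
  have Y_eq: "Y = Yin \<union> Yout" "Yin \<inter> Yout = {}" unfolding Yin_def Yout_def by blast+
  have WY: "YW \<subseteq> Yout - completed"
    using completedD Yin Y_eq unfolding YW_def by blast
  have XQ: "X \<subseteq> Q" "X \<inter> Y = {}" "Q = X \<union> Y" unfolding X_def Y_def by blast+
  have "W \<subseteq> T3 \<union> Q" unfolding W by blast
  then have W_eq: "W = (X \<inter> W) \<union> (YW \<union> R)" using XQ unfolding YW_def R_def by blast
  have sumW: "sum \<pi> W = sum \<pi> (X \<inter> W) + (sum \<pi> YW + sum \<pi> R)"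
  proof -
    have "(X \<inter> W) \<inter> (YW \<union> R) = {}" "YW \<inter> R = {}"
      using RQ XQ unfolding YW_def by blast+
    then have "sum \<pi> ((X \<inter> W) \<union> (YW \<union> R)) = sum \<pi> (X \<inter> W) + (sum \<pi> YW + sum \<pi> R)"
      using finXY finYW finR by (simp add: sum.union_disjoint)
    then show ?thesis using W_eq by simp
  qed
  have fW: "card (X \<inter> W) \<le> card (X - completed)" "card YW \<le> card (Yout - completed)"
    by (rule card_mono[OF _ WX], simp add: finXY) (rule card_mono[OF _ WY], simp add: finY)
  have fc: "card (completed - Yin) = card (X \<inter> completed) + card (Yout \<inter> completed)"
  proof -
    have "completed - Yin = (X \<inter> completed) \<union> (Yout \<inter> completed)"
      using comp Y_eq XQ by blast
    moreover have "(X \<inter> completed) \<inter> (Yout \<inter> completed) = {}" using Y_eq XQ by blast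
    ultimately show ?thesis using finXY finY by (simp add: card_Un_disjoint)
  qed
  have fn: "card (Q - completed) = card (X - completed) + card (Yout - completed)"
  proof -
    have "Q - completed = (X - completed) \<union> (Yout - completed)"
      using Yin Y_eq XQ by blast
    moreover have "(X - completed) \<inter> (Yout - completed) = {}" using Y_eq XQ by blast
    ultimately show ?thesis using finXY finY by (simp add: card_Un_disjoint)
  qed
  have fXY: "card X = card (X \<inter> completed) + card (X - completed)"
    "card Yout = card (Yout \<inter> completed) + card (Yout - completed)"
    using finXY finY card_Int_Diff by blast+
  have fQ: "card Q = card X + (card Yin + card Yout)"
  proof -
    have "Q = X \<union> (Yin \<union> Yout)" using Y_eq XQ by blast
    moreover have "X \<inter> (Yin \<union> Yout) = {}" "Yin \<inter> Yout = {}" using Y_eq XQ by blast+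
    ultimately show ?thesis using finXY finY by (simp add: card_Un_disjoint)
  qed
  have fK: "card K = card (K \<inter> H) + card (K - H)" "card H = card (K \<inter> H) + card (H - K)"
    using finK finH card_Int_Diff[of K H] card_Int_Diff[of H K] by (simp_all add: Int_commute)
  have fR: "card R \<le> card T3" using fin by (intro card_mono) (auto simp: R_def)
  show ?thesis
    by (rule budget[OF fK K5 fc fXY fQ fn fR X2 Yout fW sumW piX piYR])
qed

end

section \<open>Pair covers and the pair core\<close>

text \<open>The bridge from lengths of lists in the program to cardinalities of families in the
  charging scheme.\<close>

lemma length_filter_card:
  assumes "distinct (map set xs)"
  shows "length (filter (\<lambda>x. P (set x)) xs) = card {A \<in> set ` set xs. P A}"
proof -
  have "{A \<in> set ` set xs. P A} = set ` set (filter (\<lambda>x. P (set x)) xs)" by auto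
  moreover have "inj_on set (set (filter (\<lambda>x. P (set x)) xs))"
    using assms by (auto simp: distinct_map inj_on_def)
  moreover have "distinct (filter (\<lambda>x. P (set x)) xs)"
    using assms by (simp add: distinct_map)
  ultimately show ?thesis
    by (simp add: card_image distinct_card del: set_filter)
qed

lemma length_card_sets: "distinct (map set xs) \<Longrightarrow> length xs = card (set ` set xs)"
  using length_filter_card[of xs "\<lambda>_. True"] by simp

section \<open>Enumerating the pairs and triples of variables\<close>

definition uniq :: "nat list list \<Rightarrow> nat list list" where
  "uniq xs = fold (\<lambda>x acc. if \<exists>y\<in>set acc. set y = set x then acc else x # acc) xs []"

lemma ptime_uniq: "ptime uniq"
  unfolding uniq_def
  by (rule ptime_fold_const[where c = 1]) ((intro ptime_intros)+, simp)

lemma uniq: "distinct (map set (uniq xs))" "set ` set (uniq xs) = set ` set xs" "set (uniq xs) \<subseteq> set xs"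
proof -
  let ?F = "\<lambda>x acc. if \<exists>y\<in>set acc. set y = set x then acc else x # acc"
  have "distinct (map set (fold ?F xs acc)) \<and>
      set ` set (fold ?F xs acc) = set ` set xs \<union> set ` set acc \<and>
      set (fold ?F xs acc) \<subseteq> set xs \<union> set acc" if "distinct (map set acc)" for acc
    using that
  proof (induction xs arbitrary: acc)
    case (Cons x xs)
    show ?case
    proof (cases "\<exists>y\<in>set acc. set y = set x")
      case True
      then have "set x \<in> set ` set acc" by (metis imageI)
      then show ?thesis using Cons.IH[OF Cons.prems] True by auto
    next
      case False
      then have "distinct (map set (x # acc))" using Cons.prems by auto
      from Cons.IH[OF this] show ?thesis using False by auto
    qed
  qed simp
  from this[of "[]"]
  show "distinct (map set (uniq xs))" "set ` set (uniq xs) = set ` set xs" "set (uniq xs) \<subseteq> set xs"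
    by (simp_all add: uniq_def)
qed

definition all_pairs :: "nat list \<Rightarrow> nat list list" where
  "all_pairs V = uniq (concat (map (\<lambda>x. map (\<lambda>y. [x, y]) (filter (\<lambda>y. y \<noteq> x) V)) V))"

text \<open>The same triple is listed repeatedly. This does no harm to a list of greedy candidates;
  pairs are freed of repetitions because the surviving ones are all built and their number is paid
  for.\<close>

definition all_triples :: "nat list \<Rightarrow> nat list list" where
  "all_triples V = concat (map (\<lambda>p. map (\<lambda>z. z # p) (filter (\<lambda>z. z \<notin> set p) V)) (all_pairs V))"

lemma ptime_all_pairs: "ptime all_pairs"
  unfolding all_pairs_def
  by (intro ptime_comp[OF ptime_uniq] ptime_intros)

lemma ptime_all_triples: "ptime all_triples"
  unfolding all_triples_def
  by (intro ptime_intros ptime_all_pairs)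

lemma all_pairsD:
  assumes "q \<in> set (all_pairs V)"
  shows "length q = 2" "distinct q" "set q \<subseteq> set V"
  using subsetD[OF uniq(3) assms[unfolded all_pairs_def]] by auto

lemma all_pairs_complete:
  assumes "card p = 2" "p \<subseteq> set V"
  shows "p \<in> set ` set (all_pairs V)"
proof -
  obtain x y where p: "p = {x, y}" "x \<noteq> y" using assms(1) by (auto simp: card_2_iff)
  have "[x, y] \<in> set (concat (map (\<lambda>x. map (\<lambda>y. [x, y]) (filter (\<lambda>y. y \<noteq> x) V)) V))"
    using p assms(2) by auto
  from imageI[OF this, of set] show ?thesis
    unfolding all_pairs_def uniq(2) by (simp add: p)
qed

lemma all_triplesD:
  assumes "q \<in> set (all_triples V)"
  shows "length q = 3" "distinct q" "set q \<subseteq> set V"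
proof -
  from assms obtain p z where q: "q = z # p" "p \<in> set (all_pairs V)" "z \<in> set V" "z \<notin> set p"
    by (auto simp: all_triples_def)
  then show "length q = 3" "distinct q" "set q \<subseteq> set V"
    using all_pairsD[OF q(2)] by simp_all
qed

lemma all_triples_complete:
  assumes "card p = 3" "p \<subseteq> set V"
  shows "\<exists>q\<in>set (all_triples V). set q = p"
proof -
  obtain x y z where p: "p = {x, y, z}" "x \<noteq> y" "x \<noteq> z" "y \<noteq> z" using assms(1) by (auto simp: card_3_iff)
  have "{x, y} \<in> set ` set (all_pairs V)"
    using p assms(2) by (intro all_pairs_complete) auto
  then obtain q where q: "q \<in> set (all_pairs V)" "set q = {x, y}" by auto
  have "z # q \<in> set (all_triples V)"
    unfolding all_triples_def
    by (rule subsetD[OF set_concat_map_subset[OF q(1)]]) (use q p assms(2) in simp)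
  moreover have "set (z # q) = p" using q p by auto
  ultimately show ?thesis by blast
qed

section \<open>Greedy covers with falling thresholds\<close>

definition cover :: "nat \<Rightarrow> nat list list \<Rightarrow> nat list list \<Rightarrow> nat list list \<times> nat list list" where
  "cover j = greedy (\<lambda>c r. j \<le> length (filter (\<lambda>t. set c \<subseteq> set t) r)) (\<lambda>c t. set c \<subseteq> set t)"

lemma ptime_cover [ptime_intros]: "ptime cs \<Longrightarrow> ptime r \<Longrightarrow> ptime (\<lambda>e. cover j (cs e) (r e))"
  unfolding cover_def by (rule ptime_greedy) (intro ptime_intros | assumption)+

lemma cover_count:
  "distinct r \<Longrightarrow> j * length (snd (cover j cs r)) + length (fst (cover j cs r)) \<le> length r"
  unfolding cover_def by (rule greedy_count)

lemma cover_exhausted: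
  assumes "1 \<le> j" "c \<in> set cs"
  shows "length (filter (\<lambda>t. set c \<subseteq> set t) (fst (cover j cs r))) < j"
proof -
  have "\<not> j \<le> length (filter (\<lambda>t. set c \<subseteq> set t) (fst (cover j cs r)))"
    unfolding cover_def
  proof (rule greedy_exhausted[OF _ _ assms(2)])
    fix c :: "nat list" and P and r :: "nat list list"
    have "length (filter (\<lambda>t. set c \<subseteq> set t) (filter P r)) \<le> length (filter (\<lambda>t. set c \<subseteq> set t) r)"
      by (induction r) auto
    then show "j \<le> length (filter (\<lambda>t. set c \<subseteq> set t) r)"
      if "j \<le> length (filter (\<lambda>t. set c \<subseteq> set t) (filter P r))"
      using that by linarith
    show "\<not> j \<le> length (filter (\<lambda>t. set c \<subseteq> set t) (filter (\<lambda>t. \<not> set c \<subseteq> set t) r))"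
      using assms(1) by (simp add: filter_False)
  qed
  then show ?thesis by simp
qed

lemma cover_subset: "set (fst (cover j cs r)) \<subseteq> set r"
  unfolding cover_def by (rule greedy_subset)

lemma cover_chosen: "c \<in> set (snd (cover j cs r)) \<Longrightarrow> c \<in> set cs"
  unfolding cover_def by (rule greedy_chosen(2))

lemma cover_hit:
  "t \<in> set r \<Longrightarrow> t \<notin> set (fst (cover j cs r)) \<Longrightarrow> \<exists>c\<in>set (snd (cover j cs r)). set c \<subseteq> set t"
  unfolding cover_def by (rule greedy_hit)

lemma cover_distinct:
  assumes "distinct (map set r)"
  shows "distinct (map set (fst (cover j cs r)))"
proof -
  obtain P where "fst (cover j cs r) = filter P r"
    using greedy_rest unfolding cover_def by blast
  then show ?thesis using assms by (simp add: distinct_map_filter)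
qed

primrec cover_down :: "nat \<Rightarrow> nat list list \<Rightarrow> nat list list \<Rightarrow> nat list list" where
  "cover_down 0 cs r = []"
| "cover_down (Suc j) cs r = snd (cover (Suc j) cs r) @ cover_down j cs (fst (cover (Suc j) cs r))"

lemma ptime_cover_down:
  "ptime cs \<Longrightarrow> ptime r \<Longrightarrow> ptime (\<lambda>e. cover_down j (cs e) (r e))"
proof (induction j arbitrary: r)
  case (Suc j)
  show ?case
    unfolding cover_down.simps by (intro ptime_intros Suc)
qed (simp add: ptime_Nil)

lemma cover_down_chosen: "c \<in> set (cover_down j cs r) \<Longrightarrow> c \<in> set cs"
  by (induction j arbitrary: r) (auto dest: cover_chosen)

text \<open>The last threshold is 1, at which any candidate inside an uncovered tree may be
  chosen.\<close>

lemma cover_down_hit: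
  assumes "t \<in> set r" "c \<in> set cs" "set c \<subseteq> set t" "1 \<le> j"
  shows "\<exists>c\<in>set (cover_down j cs r). set c \<subseteq> set t"
  using assms(4,1)
proof (induction j arbitrary: r rule: dec_induct)
  case base
  have "t \<notin> set (fst (cover 1 cs r))"
    using cover_exhausted[OF order_refl assms(2), of r] assms(3) by (auto simp: filter_empty_conv)
  then show ?case using cover_hit[OF base] by simp
next
  case (step j)
  show ?case
  proof (cases "t \<in> set (fst (cover (Suc j) cs r))")
    case True
    from step.IH[OF this] show ?thesis by auto
  next
    case False
    from cover_hit[OF step.prems this] show ?thesis by auto
  qed
qed

text \<open>A tree covered at threshold i has price 1/i, and everything that reaches threshold 1 has
  price 1. After threshold j + 1 at most j remaining trees contain a given candidate; lowering their
  rate from 1/j to 1/(j + 1) loses at most 1/(j + 1), and these losses add up to the harmonic tail.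
  The second bound holds because at most one tree containing the candidate gets past threshold 2,
  and all others cost at most 1/2.\<close>

lemma cover_down_prices:
  assumes "1 \<le> j" "distinct (map set r)"
  shows "\<exists>\<pi> :: nat set \<Rightarrow> real. real (length (cover_down j cs r)) \<le> sum \<pi> (set ` set r) \<and>
    (\<forall>c\<in>set cs. \<forall>Z. Z \<subseteq> {A \<in> set ` set r. set c \<subseteq> A} \<longrightarrow>
       sum \<pi> Z \<le> real (card Z) / real j + (\<Sum>i=2..j. 1 / real i) \<and>
       (2 \<le> j \<longrightarrow> sum \<pi> Z \<le> real (card Z) / 2 + 1 / 2))"
  using assms
proof (induction j arbitrary: r rule: dec_induct)
  case base
  have "distinct r" using base by (simp add: distinct_map)
  from cover_count[OF this, of 1 cs] have "length (cover_down 1 cs r) \<le> length r" by simp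
  then have "real (length (cover_down 1 cs r)) \<le> sum (\<lambda>_. 1) (set ` set r)"
    using length_card_sets[OF base] by simp
  then show ?case by (intro exI[of _ "\<lambda>_. 1"]) simp
next
  case (step j)
  define r' where "r' = fst (cover (Suc j) cs r)"
  let ?R = "set ` set r" and ?R' = "set ` set r'"
  have dr: "distinct r" using step.prems by (simp add: distinct_map)
  have d': "distinct (map set r')" unfolding r'_def by (rule cover_distinct[OF step.prems])
  have sub: "?R' \<subseteq> ?R" using cover_subset[of "Suc j" cs r] by (auto simp: r'_def)
  from step.IH[OF d'] obtain \<pi> :: "nat set \<Rightarrow> real"
    where *: "real (length (cover_down j cs r')) \<le> sum \<pi> ?R' \<and>
    (\<forall>c\<in>set cs. \<forall>Z. Z \<subseteq> {A \<in> ?R'. set c \<subseteq> A} \<longrightarrow>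
       sum \<pi> Z \<le> real (card Z) / real j + (\<Sum>i=2..j. 1 / real i) \<and>
       (2 \<le> j \<longrightarrow> sum \<pi> Z \<le> real (card Z) / 2 + 1 / 2))" by (rule exE)
  note \<pi> = conjunct1[OF *] and Z = conjunct2[OF *, THEN bspec, THEN spec, THEN mp]
  define \<rho> where "\<rho> A = (if A \<in> ?R' then \<pi> A else 1 / real (Suc j))" for A
  have split: "sum \<rho> Z = sum \<pi> (Z \<inter> ?R') + (real (card Z) - real (card (Z \<inter> ?R'))) / real (Suc j)"
    if "finite Z" for Z
  proof -
    have "sum \<rho> Z = sum \<rho> (Z \<inter> ?R') + sum \<rho> (Z - ?R')"
      using that by (rule sum.Int_Diff)
    also have "sum \<rho> (Z \<inter> ?R') = sum \<pi> (Z \<inter> ?R')" by (rule sum.cong) (auto simp: \<rho>_def)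
    also have "sum \<rho> (Z - ?R') = sum (\<lambda>_. 1 / real (Suc j)) (Z - ?R')"
      by (rule sum.cong) (auto simp: \<rho>_def)
    also have "\<dots> = (real (card Z) - real (card (Z \<inter> ?R'))) / real (Suc j)"
      using card_Int_Diff[OF that, of ?R'] by simp
    finally show ?thesis .
  qed
  show ?case
  proof (intro exI[of _ \<rho>] conjI ballI allI impI)
    have "Suc j * length (snd (cover (Suc j) cs r)) + length r' \<le> length r"
      using cover_count[OF dr, of "Suc j" cs] by (simp only: r'_def)
    from of_nat_mono[OF this, where 'a = real]
    have "real (length (snd (cover (Suc j) cs r))) * real (Suc j) \<le> real (card ?R) - real (card ?R')"
      unfolding length_card_sets[OF step.prems] length_card_sets[OF d'] of_nat_add of_nat_mult
      by (simp only: mult.commute le_diff_eq)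
    then have "real (length (snd (cover (Suc j) cs r))) \<le> (real (card ?R) - real (card ?R')) / real (Suc j)"
      by (subst pos_le_divide_eq) auto
    moreover have "sum \<rho> ?R = sum \<pi> ?R' + (real (card ?R) - real (card ?R')) / real (Suc j)"
      using split[of ?R] sub by (simp add: Int_absorb1)
    ultimately show "real (length (cover_down (Suc j) cs r)) \<le> sum \<rho> ?R"
      using \<pi> by (simp add: r'_def)
  next
    fix c Z
    assume c: "c \<in> set cs" and ZR: "Z \<subseteq> {A \<in> ?R. set c \<subseteq> A}"
    have finZ: "finite Z" using ZR by (rule finite_subset) simp
    let ?Z = "Z \<inter> ?R'"
    have "?Z \<subseteq> {A \<in> ?R'. set c \<subseteq> A}" using ZR by auto
    note Z' = Z[OF c this]
    have "card ?Z \<le> card {A \<in> ?R'. set c \<subseteq> A}"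
      using ZR by (intro card_mono) auto
    also have "\<dots> = length (filter (\<lambda>t. set c \<subseteq> set t) r')"
      using length_filter_card[OF d', of "\<lambda>A. set c \<subseteq> A"] by simp
    also have "\<dots> < Suc j"
      using cover_exhausted[OF _ c, of "Suc j" r] by (simp add: r'_def)
    finally have small: "real (card ?Z) \<le> real j" by simp
    have jpos: "0 < real j" using step.hyps by simp
    have le: "real (card ?Z) \<le> real (card Z)" using finZ by (simp add: card_mono)
    have "real (card ?Z) / real j - real (card ?Z) / real (Suc j) = real (card ?Z) / real j * (1 / real (Suc j))"
      using jpos by (simp add: field_simps)
    also have "\<dots> \<le> 1 * (1 / real (Suc j))"
      using small jpos by (intro mult_right_mono) (auto simp: divide_le_eq)
    finally have "real (card ?Z) / real j \<le> real (card ?Z) / real (Suc j) + 1 / real (Suc j)" by simp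
    moreover have "(\<Sum>i=2..Suc j. 1 / real i) = (\<Sum>i=2..j. 1 / real i) + 1 / real (Suc j)"
      using step.hyps by simp
    ultimately show "sum \<rho> Z \<le> real (card Z) / real (Suc j) + (\<Sum>i=2..Suc j. 1 / real i)"
      using split[OF finZ] conjunct1[OF Z'] by (simp add: diff_divide_distrib)
    \<comment> \<open>For \<open>j = 1\<close> at most one tree is left, and its price is 1 = 1/2 +
      1/2.\<close>
    have "sum \<pi> ?Z \<le> real (card ?Z) / 2 + 1 / 2"
    proof (cases "j = 1")
      case True
      then show ?thesis using conjunct1[OF Z'] small by simp
    next
      case False
      then show ?thesis using conjunct2[OF Z'] step.hyps by simp
    qed
    moreover have "(real (card Z) - real (card ?Z)) / real (Suc j) \<le> (real (card Z) - real (card ?Z)) / 2"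
      using le step.hyps by (intro divide_left_mono) auto
    ultimately show "sum \<rho> Z \<le> real (card Z) / 2 + 1 / 2"
      using split[OF finZ] by (simp add: diff_divide_distrib)
  qed
qed

section \<open>Pruning the pairs to a stable family\<close>

definition core_step :: "nat list list \<Rightarrow> nat list list \<Rightarrow> nat list list \<Rightarrow> nat list list" where
  "core_step P Qs K = filter (\<lambda>q. 5 \<le> length (filter (\<lambda>T. set q \<subseteq> set T \<and>
     (\<exists>b\<in>set (P @ K). set b = set (filter (\<lambda>x. x \<notin> set q) T))) Qs)) K"

text \<open>The fold over \<open>K\<close> merely counts rounds: a round that changes anything
  removes a pair, so \<open>length K\<close> rounds reach a stable list.\<close>

definition core :: "nat list list \<Rightarrow> nat list list \<Rightarrow> nat list list \<Rightarrow> nat list list" where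
  "core P Qs K = fold (\<lambda>_ K. core_step P Qs K) K K"

lemma ptime_core_step [ptime_intros]:
  assumes "ptime P" "ptime Qs" "ptime K"
  shows "ptime (\<lambda>e. core_step (P e) (Qs e) (K e))"
  by (rule ptime3[OF _ assms]) (unfold core_step_def, intro ptime_intros)

lemma ptime_core [ptime_intros]:
  assumes "ptime P" "ptime Qs" "ptime K"
  shows "ptime (\<lambda>e. core (P e) (Qs e) (K e))"
proof (rule ptime3[OF _ assms])
  show "ptime (\<lambda>p. core (fst p) (fst (snd p)) (snd (snd p)))"
    unfolding core_def
  proof (rule ptime_fold_const[where c = 0])
    fix e :: "nat list list \<times> nat list list \<times> nat list list" and x :: "nat list" and acc
    show "esize (core_step (fst e) (fst (snd e)) acc) \<le> esize acc + esize x + 0"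
      unfolding core_step_def by (rule order_trans[OF dsize_enc_filter]) simp
  qed (intro ptime_intros)+
qed

lemma core_step_count:
  assumes "distinct (map set Qs)"
  shows "length (filter (\<lambda>T. set q \<subseteq> set T \<and>
     (\<exists>b\<in>set (P @ K). set b = set (filter (\<lambda>x. x \<notin> set q) T))) Qs) =
     card {A \<in> set ` set Qs. set q \<subseteq> A \<and> A - set q \<in> set ` set P \<union> set ` set K}"
proof -
  have "(\<exists>b\<in>set (P @ K). set b = set (filter (\<lambda>x. x \<notin> set q) T)) \<longleftrightarrow>
      set T - set q \<in> set ` set P \<union> set ` set K" for T
    by (auto simp: set_diff_eq image_iff)
  then show ?thesis
    using length_filter_card[OF assms, of "\<lambda>A. set q \<subseteq> A \<and> A - set q \<in> set ` set P \<union> set ` set K"]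
    by simp
qed

lemma core_subset: "\<exists>F. core P Qs K = filter F K"
proof -
  have "\<exists>F. fold (\<lambda>_ K. core_step P Qs K) xs L = filter F L" for xs :: "nat list list" and L
  proof (induction xs arbitrary: L)
    case Nil
    show ?case by (simp, rule exI[of _ "\<lambda>_. True"], simp)
  next
    case (Cons x xs)
    obtain F where F: "core_step P Qs L = filter F L" unfolding core_step_def by blast
    obtain G where "fold (\<lambda>_ K. core_step P Qs K) xs (core_step P Qs L) = filter G (core_step P Qs L)"
      using Cons.IH by blast
    then have "fold (\<lambda>_ K. core_step P Qs K) (x # xs) L = filter (\<lambda>q. F q \<and> G q) L"
      by (simp add: F filter_filter)
    then show ?case by (rule exI[of _ "\<lambda>q. F q \<and> G q"])
  qed
  then show ?thesis unfolding core_def .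
qed

lemma length_filter_neq: "filter P xs \<noteq> xs \<Longrightarrow> length (filter P xs) < length xs"
  using length_filter_less[of _ xs P] by (auto simp: filter_id_conv)

lemma core_stable: "core_step P Qs (core P Qs K) = core P Qs K"
proof -
  let ?f = "core_step P Qs"
  have fixed: "fold (\<lambda>_ K. ?f K) xs L = L" if "?f L = L" for xs :: "nat list list" and L
    by (induction xs) (simp_all add: that)
  have "?f (fold (\<lambda>_ K. ?f K) xs L) = fold (\<lambda>_ K. ?f K) xs L" if "length L \<le> length xs"
    for xs :: "nat list list" and L
    using that
  proof (induction xs arbitrary: L)
    case Nil
    then show ?case by (simp add: core_step_def)
  next
    case (Cons x xs)
    show ?case
    proof (cases "?f L = L")
      case True
      then show ?thesis by (simp only: fixed)
    next
      case False
      then have "length (?f L) < length L"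
        unfolding core_step_def by (rule length_filter_neq)
      then have "length (?f L) \<le> length xs" using Cons.prems by simp
      from Cons.IH[OF this] show ?thesis by simp
    qed
  qed
  then show ?thesis by (simp add: core_def)
qed

text \<open>
  Every pair has few partners when it is discarded. Hence a hidden solution with pairs from H loses
  at most four of its quadruples for each pair of H that is discarded.
\<close>

lemma lost_step:
  fixes P Q Y H K K' :: "nat set set"
  assumes fin: "finite Q" "finite H" and Y: "Y \<subseteq> Q" and K': "K' \<subseteq> K"
    and sp: "\<And>A. A \<in> Y \<Longrightarrow> sp A \<subseteq> A \<and> sp A \<in> H \<union> P \<and> A - sp A \<in> H \<union> P"
    and D: "\<And>q. q \<in> K - K' \<Longrightarrow> card {A \<in> Q. q \<subseteq> A \<and> A - q \<in> P \<union> K} \<le> 4"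
    and IH: "card {A \<in> Y. \<not> (sp A \<in> P \<union> K \<and> A - sp A \<in> P \<union> K)} \<le> 4 * card (H - K)"
  shows "card {A \<in> Y. \<not> (sp A \<in> P \<union> K' \<and> A - sp A \<in> P \<union> K')} \<le> 4 * card (H - K')"
proof -
  let ?lost = "\<lambda>K. {A \<in> Y. \<not> (sp A \<in> P \<union> K \<and> A - sp A \<in> P \<union> K)}"
  let ?D = "\<lambda>q. {A \<in> Q. q \<subseteq> A \<and> A - q \<in> P \<union> K}"
  define B where "B = H \<inter> (K - K')"
  have finB: "finite B" using fin by (simp add: B_def)
  \<comment> \<open>If \<open>A\<close> was not lost before, one of its halves lies in
    \<open>H\<close> and is discarded in this round while the complement is still available. So
    \<open>A\<close> is among the at most four quadruples of a pair in \<open>B\<close>.\<close>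
  have "A \<in> ?lost K \<union> (\<Union>q\<in>B. ?D q)" if A: "A \<in> ?lost K'" for A
  proof (cases "A \<in> ?lost K")
    case False
    have AY: "A \<in> Y" using A by simp
    note s = sp[OF AY]
    have in_K: "sp A \<in> P \<union> K" "A - sp A \<in> P \<union> K" using False AY by simp_all
    from A have "sp A \<notin> P \<union> K' \<or> A - sp A \<notin> P \<union> K'" by simp
    then obtain q where "q \<in> B" "q \<subseteq> A" "A - q \<in> P \<union> K"
    proof
      assume "sp A \<notin> P \<union> K'"
      then have "sp A \<in> B" using s in_K unfolding B_def by blast
      then show thesis using that s in_K by blast
    next
      assume "A - sp A \<notin> P \<union> K'"
      then have "A - sp A \<in> B" using s in_K unfolding B_def by blast
      moreover have "A - (A - sp A) = sp A" using s by blast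
      ultimately show thesis using that[of "A - sp A"] in_K by simp
    qed
    then show ?thesis using AY Y by blast
  qed simp
  then have "?lost K' \<subseteq> ?lost K \<union> (\<Union>q\<in>B. ?D q)" by (rule subsetI)
  moreover have "finite (?lost K \<union> (\<Union>q\<in>B. ?D q))"
    using finite_subset[OF Y fin(1)] fin finB by simp
  ultimately have "card (?lost K') \<le> card (?lost K \<union> (\<Union>q\<in>B. ?D q))"
    by (intro card_mono)
  also have "\<dots> \<le> card (?lost K) + card (\<Union>q\<in>B. ?D q)"
    by (rule card_Un_le)
  also have "card (\<Union>q\<in>B. ?D q) \<le> (\<Sum>q\<in>B. card (?D q))"
    using finB by (rule card_UN_le)
  also have "(\<Sum>q\<in>B. card (?D q)) \<le> (\<Sum>q\<in>B. 4)"
    by (rule sum_mono) (rule D, simp add: B_def)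
  also have "(\<Sum>q\<in>B. 4) = 4 * card B" by simp
  finally have "card (?lost K') \<le> 4 * (card (H - K) + card B)" using IH by simp
  also have "card (H - K) + card B = card ((H - K) \<union> B)"
    using fin by (intro card_Un_disjoint[symmetric]) (auto simp: B_def)
  also have "(H - K) \<union> B = H - K'" using K' by (auto simp: B_def)
  finally show ?thesis .
qed

text \<open>At the start all of \<open>H\<close> is present and nothing is lost; every round
  preserves the invariant \<open>B\<close> by \<open>lost_step\<close>.\<close>

lemma core_lost:
  assumes Qs: "distinct (map set Qs)" and Y: "Y \<subseteq> set ` set Qs" and H: "finite H" "H \<subseteq> set ` set K"
    and sp: "\<And>A. A \<in> Y \<Longrightarrow> sp A \<subseteq> A \<and> sp A \<in> H \<union> set ` set P \<and> A - sp A \<in> H \<union> set ` set P"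
  shows "card {A \<in> Y. \<not> (sp A \<in> set ` set P \<union> set ` set (core P Qs K) \<and>
      A - sp A \<in> set ` set P \<union> set ` set (core P Qs K))} \<le> 4 * card (H - set ` set (core P Qs K))"
proof -
  define B where "B L \<longleftrightarrow> card {A \<in> Y. \<not> (sp A \<in> set ` set P \<union> set ` set L \<and>
      A - sp A \<in> set ` set P \<union> set ` set L)} \<le> 4 * card (H - set ` set L)" for L
  have step: "B (core_step P Qs L)" if "B L" for L
    unfolding B_def
  proof (rule lost_step[where K = "set ` set L" and Q = "set ` set Qs"])
    show "set ` set (core_step P Qs L) \<subseteq> set ` set L" by (auto simp: core_step_def)
    fix q assume "q \<in> set ` set L - set ` set (core_step P Qs L)"
    then obtain l where l: "l \<in> set L" "q = set l" "l \<notin> set (core_step P Qs L)" by blast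
    then have "\<not> 5 \<le> card {A \<in> set ` set Qs. q \<subseteq> A \<and> A - q \<in> set ` set P \<union> set ` set L}"
      unfolding core_step_def core_step_count[OF Qs] by simp
    then show "card {A \<in> set ` set Qs. q \<subseteq> A \<and> A - q \<in> set ` set P \<union> set ` set L} \<le> 4" by simp
  qed (use Y H(1) sp that[unfolded B_def] in simp_all)
  have iter: "B (fold (\<lambda>_ K. core_step P Qs K) xs L)" if "B L" for xs :: "nat list list" and L
    using that by (induction xs arbitrary: L) (simp_all add: step)
  have "{A \<in> Y. \<not> (sp A \<in> set ` set P \<union> set ` set K \<and> A - sp A \<in> set ` set P \<union> set ` set K)} = {}"
    (is "?L = {}")
  proof (rule equals0I)
    fix A assume A: "A \<in> ?L"
    then have "A \<in> Y" by simp
    from sp[OF this] A H(2) show False by (simp add: subset_iff) blast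
  qed
  then have "B K" unfolding B_def by (simp only: card.empty)
  from iter[OF this, of K] show ?thesis unfolding core_def B_def .
qed

section \<open>Trees of size at most four\<close>

definition sized :: "nat \<Rightarrow> nat list list \<Rightarrow> nat list list" where
  "sized j Ts = filter (\<lambda>T. length T = j) Ts"

definition quads :: "nat list list \<Rightarrow> nat list list" where
  "quads Ts = filter (\<lambda>T. length T = 4 \<and> \<not> (\<exists>S\<in>set (sized 3 Ts). set S \<subseteq> set T)) Ts"

definition shared :: "nat list list \<Rightarrow> nat list list \<times> nat list list" where
  "shared Ts = cover 3 (all_triples (concat Ts)) (quads Ts)"

definition fresh_pairs :: "nat list list \<Rightarrow> nat list list" where
  "fresh_pairs Ts = filter (\<lambda>q. \<not> (\<exists>S\<in>set (sized 2 Ts). set S = set q)) (all_pairs (concat Ts))"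

definition pair_core :: "nat list list \<Rightarrow> nat list list" where
  "pair_core Ts = core (sized 2 Ts) (fst (shared Ts)) (fresh_pairs Ts)"

definition base :: "nat list list \<Rightarrow> nat list list" where
  "base Ts = sized 2 Ts @ pair_core Ts"

definition bare :: "nat list list \<Rightarrow> nat list list" where
  "bare Ts = filter (\<lambda>T. \<not> (\<exists>q\<in>set (base Ts). set q \<subseteq> set T)) (sized 3 Ts @ fst (shared Ts))"

definition covering :: "nat list list \<Rightarrow> nat list list" where
  "covering Ts = cover_down 5 (all_pairs (concat Ts)) (bare Ts)"

definition sub_plan :: "nat list list \<Rightarrow> nat list \<Rightarrow> instr list" where
  "sub_plan Ss T = concat (map (\<lambda>S. extend S T) (take 1 (filter (\<lambda>S. set S \<subseteq> set T) Ss)))"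

definition joins :: "nat list list \<Rightarrow> nat list \<Rightarrow> nat list \<Rightarrow> bool" where
  "joins B T b \<longleftrightarrow> set b \<subseteq> set T \<and> (\<exists>b'\<in>set B. set b' = set (filter (\<lambda>x. x \<notin> set b) T))"

definition join_plan :: "nat list list \<Rightarrow> nat list \<Rightarrow> instr list" where
  "join_plan B T = map (\<lambda>b. (b, filter (\<lambda>x. x \<notin> set b) T)) (take 1 (filter (joins B T) B))"

text \<open>Trees of size one are inputs and trees of size two belong to \<open>base\<close>, so
  neither needs instructions here. Joins use pairs of \<open>base\<close> only, in accordance with
  \<open>completed\<close>.\<close>

definition tree_plan :: "nat list list \<Rightarrow> nat list \<Rightarrow> instr list" where
  "tree_plan Ts T =
     (if length T = 3 then sub_plan (base Ts @ covering Ts) T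
      else if length T = 4 then
        (if \<exists>S\<in>set (sized 3 Ts @ snd (shared Ts)). set S \<subseteq> set T
           then sub_plan (sized 3 Ts @ snd (shared Ts)) T
         else if \<exists>b\<in>set (base Ts). joins (base Ts) T b then join_plan (base Ts) T
         else sub_plan (base Ts @ covering Ts) T)
      else [])"

definition quad_plan :: "nat list list \<Rightarrow> instr list" where
  "quad_plan Ts = concat (map scratch (base Ts @ covering Ts)) @
     concat (map scratch (snd (shared Ts))) @ concat (map (tree_plan Ts) Ts)"

lemma ptime_sized [ptime_intros]: "ptime f \<Longrightarrow> ptime (\<lambda>e. sized j (f e))"
  unfolding sized_def by (intro ptime_intros)

lemma ptime_quads: "ptime quads"
  unfolding quads_def by (intro ptime_intros)

lemma ptime_shared: "ptime shared"
  unfolding shared_def by (intro ptime_intros ptime_comp[OF ptime_all_triples] ptime_quads)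

lemma ptime_fresh_pairs: "ptime fresh_pairs"
  unfolding fresh_pairs_def by (intro ptime_intros ptime_comp[OF ptime_all_pairs])

lemma ptime_pair_core: "ptime pair_core"
  unfolding pair_core_def by (intro ptime_intros ptime_shared ptime_fresh_pairs)

lemma ptime_base: "ptime base"
  unfolding base_def by (intro ptime_intros ptime_pair_core)

lemma ptime_bare: "ptime bare"
  unfolding bare_def by (intro ptime_intros ptime_comp[OF ptime_base] ptime_shared)

lemma ptime_covering: "ptime covering"
  unfolding covering_def
  by (intro ptime_cover_down ptime_comp[OF ptime_all_pairs] ptime_intros ptime_bare)

lemma ptime_sub_plan [ptime_intros]:
  assumes "ptime Ss" "ptime T"
  shows "ptime (\<lambda>e. sub_plan (Ss e) (T e))"
  by (rule ptime2[OF _ assms]) (unfold sub_plan_def, intro ptime_intros)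

lemma ptime_joins [ptime_intros]:
  assumes "ptime B" "ptime T" "ptime b"
  shows "ptime (\<lambda>e. joins (B e) (T e) (b e))"
  by (rule ptime3[OF _ assms]) (unfold joins_def, intro ptime_intros)

lemma ptime_join_plan [ptime_intros]:
  assumes "ptime B" "ptime T"
  shows "ptime (\<lambda>e. join_plan (B e) (T e))"
  by (rule ptime2[OF _ assms]) (unfold join_plan_def, intro ptime_intros)

lemma ptime_quad_plan: "ptime quad_plan"
  unfolding quad_plan_def tree_plan_def
  by (intro ptime_intros ptime_comp[OF ptime_base] ptime_comp[OF ptime_covering]
      ptime_comp[OF ptime_shared] ptime_base ptime_covering ptime_shared)

lemma sub_plan_cases:
  assumes "\<exists>S\<in>set Ss. set S \<subseteq> set T"
  obtains S where "S \<in> set Ss" "set S \<subseteq> set T" "sub_plan Ss T = extend S T"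
proof -
  have "filter (\<lambda>S. set S \<subseteq> set T) Ss \<noteq> []" using assms by (auto simp: filter_empty_conv)
  then obtain S xs where S: "filter (\<lambda>S. set S \<subseteq> set T) Ss = S # xs"
    by (cases "filter (\<lambda>S. set S \<subseteq> set T) Ss") auto
  then have "S \<in> set (filter (\<lambda>S. set S \<subseteq> set T) Ss)" by (metis list.set_intros(1))
  then have "S \<in> set Ss" "set S \<subseteq> set T" by simp_all
  then show thesis using that[of S] S by (simp add: sub_plan_def)
qed

lemma join_plan_cases:
  assumes "\<exists>b\<in>set B. joins B T b"
  obtains b where "b \<in> set B" "joins B T b" "join_plan B T = [(b, filter (\<lambda>x. x \<notin> set b) T)]"
proof -
  have "filter (joins B T) B \<noteq> []" using assms by (auto simp: filter_empty_conv)
  then obtain b xs where b: "filter (joins B T) B = b # xs" by (cases "filter (joins B T) B") auto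
  then have "b \<in> set (filter (joins B T) B)" by (metis list.set_intros(1))
  then have "b \<in> set B" "joins B T b" by simp_all
  then show thesis using that[of b] b by (simp add: join_plan_def)
qed

text \<open>A triple of the first phase costs two gates and serves at least three quadruples, so
  each of these costs at most 1 + 2/3. A remaining quadruple may cost 1 + 9/10, which is the origin
  of the ratio.\<close>

lemma quad_budget:
  fixes t2 t3 t4 k c m q n h h' e g l :: nat and w :: real
  assumes "real k + w + real n \<le> 9 / 10 * (real t3 + real q) + 19 / 10 * (real h + real e)" "h \<le> h'"
    "t2 + t3 + t4 + h' + e \<le> g" "l \<le> t2 + k + c + 2 * m + t3 + t4 + n" "3 * m + q \<le> t4" "real c \<le> w"
  shows "real l \<le> 19 / 10 * real g"
proof -
  have "real t2 + real t3 + real t4 + real h + real e \<le> real g" "3 * real m + real q \<le> real t4"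
    "real l \<le> real t2 + real k + real c + 2 * real m + real t3 + real t4 + real n"
    using assms by linarith+
  then show ?thesis using assms(1,6) by (simp add: field_simps)
qed

context
  fixes Ts :: "nat list list"
  assumes Ts: "tree_list Ts" and small: "\<And>T. T \<in> set Ts \<Longrightarrow> length T \<le> 4"
begin

abbreviation "trees2 \<equiv> set ` set (sized 2 Ts)"
abbreviation "trees3 \<equiv> set ` set (sized 3 Ts)"
abbreviation "rest \<equiv> set ` set (fst (shared Ts))"
abbreviation "kept \<equiv> set ` set (pair_core Ts)"
abbreviation "basis \<equiv> set ` set (base Ts)"
abbreviation "to_cover \<equiv> set ` set (bare Ts)"

lemma sizedD: "T \<in> set (sized j Ts) \<longleftrightarrow> T \<in> set Ts \<and> length T = j"
  by (auto simp: sized_def)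

lemma sized_distinct: "distinct (map set (sized j Ts))"
  using Ts by (simp add: tree_list_def sized_def distinct_map_filter)

lemma quads_distinct: "distinct (map set (quads Ts))"
  using Ts by (simp add: tree_list_def quads_def distinct_map_filter)

lemma shared_quads: "set (fst (shared Ts)) \<subseteq> set (quads Ts)"
  unfolding shared_def by (rule cover_subset)

lemma shared_distinct: "distinct (map set (fst (shared Ts)))"
  unfolding shared_def by (rule cover_distinct[OF quads_distinct])

lemma quadsD:
  assumes "T \<in> set (fst (shared Ts))"
  shows "T \<in> set Ts" "length T = 4" "\<And>S. S \<in> set (sized 3 Ts) \<Longrightarrow> \<not> set S \<subseteq> set T"
  using subsetD[OF shared_quads assms] by (auto simp: quads_def)

lemma pair_coreD:
  assumes "q \<in> set (pair_core Ts)"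
  shows "length q = 2" "distinct q" "set q \<subseteq> set (concat Ts)" "set q \<notin> trees2"
proof -
  obtain F where "pair_core Ts = filter F (fresh_pairs Ts)"
    unfolding pair_core_def using core_subset by blast
  with assms have q: "q \<in> set (fresh_pairs Ts)" by simp
  then have "q \<in> set (all_pairs (concat Ts))" by (simp add: fresh_pairs_def)
  from all_pairsD[OF this] show "length q = 2" "distinct q" "set q \<subseteq> set (concat Ts)" .
  show "set q \<notin> trees2" using q by (auto simp: fresh_pairs_def)
qed

lemma pair_core_distinct: "distinct (map set (pair_core Ts))"
proof -
  obtain F where "pair_core Ts = filter F (fresh_pairs Ts)"
    unfolding pair_core_def using core_subset by blast
  then show ?thesis
    using uniq(1) by (simp add: fresh_pairs_def all_pairs_def distinct_map_filter)
qed

lemma pairsD: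
  assumes "q \<in> set (base Ts @ covering Ts)"
  shows "length q = 2" "distinct q" "set q \<subseteq> set (concat Ts)"
proof -
  consider "q \<in> set (sized 2 Ts)" | "q \<in> set (pair_core Ts)" | "q \<in> set (covering Ts)"
    using assms by (auto simp: base_def)
  then have "length q = 2 \<and> distinct q \<and> set q \<subseteq> set (concat Ts)"
  proof cases
    case 1
    then show ?thesis using tree_listD(1)[OF Ts] by (auto simp: sizedD)
  next
    case 2
    then show ?thesis using pair_coreD by simp
  next
    case 3
    then have "q \<in> set (all_pairs (concat Ts))"
      unfolding covering_def by (rule cover_down_chosen)
    from all_pairsD[OF this] show ?thesis by blast
  qed
  then show "length q = 2" "distinct q" "set q \<subseteq> set (concat Ts)" by simp_all
qed

lemma tripletsD:
  assumes "q \<in> set (sized 3 Ts @ snd (shared Ts))"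
  shows "length q = 3" "distinct q" "set q \<subseteq> set (concat Ts)"
proof -
  consider "q \<in> set (sized 3 Ts)" | "q \<in> set (snd (shared Ts))"
    using assms by auto
  then have "length q = 3 \<and> distinct q \<and> set q \<subseteq> set (concat Ts)"
  proof cases
    case 1
    then show ?thesis using tree_listD(1)[OF Ts] by (auto simp: sizedD)
  next
    case 2
    then have "q \<in> set (all_triples (concat Ts))"
      unfolding shared_def by (rule cover_chosen)
    from all_triplesD[OF this] show ?thesis by blast
  qed
  then show "length q = 3" "distinct q" "set q \<subseteq> set (concat Ts)" by simp_all
qed

text \<open>A tree without a pair of \<open>base\<close> is in \<open>bare\<close>, and the cover
  reaches all of \<open>bare\<close> because every pair of its variables is a candidate.\<close>

lemma pair_exists:
  assumes "T \<in> set (sized 3 Ts) \<or> T \<in> set (fst (shared Ts))"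
  shows "\<exists>S\<in>set (base Ts @ covering Ts). set S \<subseteq> set T"
proof (cases "\<exists>q\<in>set (base Ts). set q \<subseteq> set T")
  case False
  then have W: "T \<in> set (bare Ts)" using assms by (auto simp: bare_def)
  have T: "T \<in> set Ts" "3 \<le> length T" using assms quadsD by (auto simp: sizedD)
  then have "2 \<le> card (set T)" using tree_listD(3)[OF Ts] by simp
  then obtain p where p: "p \<subseteq> set T" "card p = 2" by (rule obtain_subset_with_card_n)
  have "p \<subseteq> set (concat Ts)" using p(1) T(1) by auto
  then obtain c where c: "c \<in> set (all_pairs (concat Ts))" "set c = p"
    using all_pairs_complete[OF p(2)] by blast
  have "\<exists>c\<in>set (covering Ts). set c \<subseteq> set T"
    unfolding covering_def by (rule cover_down_hit[OF W c(1)]) (use p c in simp_all)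
  then show ?thesis by auto
qed auto

lemma not_shared_triplet:
  assumes "T \<in> set Ts" "length T = 4" "T \<notin> set (fst (shared Ts))"
  shows "\<exists>S\<in>set (sized 3 Ts @ snd (shared Ts)). set S \<subseteq> set T"
proof (cases "T \<in> set (quads Ts)")
  case True
  from cover_hit[OF this assms(3)[unfolded shared_def]] show ?thesis
    unfolding shared_def[symmetric] by auto
next
  case False
  then show ?thesis using assms by (auto simp: quads_def)
qed

lemma scratch_in_plan:
  assumes "q \<in> set (base Ts @ covering Ts) \<or> q \<in> set (snd (shared Ts))"
  shows "\<forall>p\<in>set (scratch q). supported (concat Ts) (quad_plan Ts) p"
    "set q \<in> avail (concat Ts) (quad_plan Ts)"
proof -
  have "set (scratch q) \<subseteq> set (quad_plan Ts)"
    using assms set_concat_map_subset[of q "base Ts @ covering Ts" scratch]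
      set_concat_map_subset[of q "snd (shared Ts)" scratch] by (auto simp: quad_plan_def)
  moreover have "q \<noteq> []" "distinct q" "set q \<subseteq> set (concat Ts)"
    using assms pairsD[of q] tripletsD[of q] by (auto simp del: set_concat)
  ultimately show "\<forall>p\<in>set (scratch q). supported (concat Ts) (quad_plan Ts) p"
    "set q \<in> avail (concat Ts) (quad_plan Ts)"
    using scratch_supported[of q "quad_plan Ts" "concat Ts"] by simp_all
qed

lemma sub_plan_length:
  assumes "\<exists>S\<in>set Ss. set S \<subseteq> set T" "T \<in> set Ts" "\<And>S. S \<in> set Ss \<Longrightarrow> length S = j \<and> distinct S"
  shows "length (sub_plan Ss T) = length T - j"
proof -
  obtain S where S: "S \<in> set Ss" "set S \<subseteq> set T" "sub_plan Ss T = extend S T"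
    by (rule sub_plan_cases[OF assms(1)])
  with assms(3)[OF S(1)] show ?thesis
    using length_extend[OF tree_listD(1)[OF Ts assms(2)] _ S(2)] by simp
qed

lemma sub_plan_ok:
  assumes ex: "\<exists>S\<in>set Ss. set S \<subseteq> set T" and T: "T \<in> set Ts"
    and I: "set (sub_plan Ss T) \<subseteq> set (quad_plan Ts)"
    and av: "\<And>S. S \<in> set Ss \<Longrightarrow> S \<noteq> [] \<and> set S \<in> avail (concat Ts) (quad_plan Ts)"
  shows "(\<forall>p\<in>set (sub_plan Ss T). supported (concat Ts) (quad_plan Ts) p) \<and>
    set T \<in> avail (concat Ts) (quad_plan Ts)"
proof -
  obtain S where S: "S \<in> set Ss" "set S \<subseteq> set T" "sub_plan Ss T = extend S T"
    by (rule sub_plan_cases[OF ex])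
  have V: "set T \<subseteq> set (concat Ts)" using T by auto
  show ?thesis
    using extend_supported[of S T "quad_plan Ts" "concat Ts"] I[unfolded S(3)] av[OF S(1)] V
      tree_listD(1)[OF Ts T] S(2) unfolding S(3) by blast
qed

text \<open>The induction on the size serves a single case, a quadruple built on a tree of size
  three.\<close>

lemma tree_plan_ok:
  assumes T: "T \<in> set Ts"
  shows "(\<forall>p\<in>set (tree_plan Ts T). supported (concat Ts) (quad_plan Ts) p) \<and>
    set T \<in> avail (concat Ts) (quad_plan Ts)"
  using T
proof (induction "length T" arbitrary: T rule: less_induct)
  case less
  note T = less.prems
  let ?V = "concat Ts" and ?I = "quad_plan Ts"
  have I: "set (tree_plan Ts T) \<subseteq> set ?I"
    using set_concat_map_subset[OF T, of "tree_plan Ts"] by (auto simp: quad_plan_def)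
  have pair_av: "S \<noteq> [] \<and> set S \<in> avail ?V ?I" if "S \<in> set (base Ts @ covering Ts)" for S
    using scratch_in_plan(2)[of S] pairsD(1)[OF that] that by auto
  have "length T \<le> 4" "0 < length T" using small[OF T] tree_listD(2)[OF Ts T] by simp_all
  then consider "length T = 1" | "length T = 2" | "length T = 3" | "length T = 4" by linarith
  then show ?case
  proof cases
    case 1
    then obtain x where x: "T = [x]" by (auto simp: length_Suc_conv)
    then have "x \<in> set ?V" using T by force
    then have "set T \<in> avail ?V ?I" by (auto simp: avail_eq x)
    then show ?thesis by (simp add: tree_plan_def x)
  next
    case 2
    then have "T \<in> set (base Ts @ covering Ts)" using T by (simp add: base_def sizedD)
    then show ?thesis using scratch_in_plan(2)[of T] 2 by (simp add: tree_plan_def)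
  next
    case 3
    then have eq: "tree_plan Ts T = sub_plan (base Ts @ covering Ts) T" by (simp add: tree_plan_def)
    have "\<exists>S\<in>set (base Ts @ covering Ts). set S \<subseteq> set T"
      using 3 T by (intro pair_exists) (simp add: sizedD)
    from sub_plan_ok[OF this T I[unfolded eq] pair_av] show ?thesis unfolding eq .
  next
    case 4
    show ?thesis
    proof (cases "\<exists>S\<in>set (sized 3 Ts @ snd (shared Ts)). set S \<subseteq> set T")
      case True
      then have eq: "tree_plan Ts T = sub_plan (sized 3 Ts @ snd (shared Ts)) T"
        using 4 by (simp add: tree_plan_def)
      have "S \<noteq> [] \<and> set S \<in> avail ?V ?I" if "S \<in> set (sized 3 Ts @ snd (shared Ts))" for S
      proof
        show "S \<noteq> []" using tripletsD(1)[OF that] by auto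
        show "set S \<in> avail ?V ?I"
        proof (cases "S \<in> set (sized 3 Ts)")
          case True
          then have "S \<in> set Ts" "length S < length T" using 4 by (simp_all add: sizedD)
          then show ?thesis using less.hyps by blast
        next
          case False
          then show ?thesis using that scratch_in_plan(2)[of S] by simp
        qed
      qed
      from sub_plan_ok[OF True T I[unfolded eq] this] show ?thesis unfolding eq .
    next
      case no3: False
      show ?thesis
      proof (cases "\<exists>b\<in>set (base Ts). joins (base Ts) T b")
        case True
        then have eq: "tree_plan Ts T = join_plan (base Ts) T"
          using 4 no3 by (auto simp: tree_plan_def)
        obtain b where b: "b \<in> set (base Ts)" "joins (base Ts) T b"
          "join_plan (base Ts) T = [(b, filter (\<lambda>x. x \<notin> set b) T)]"
          by (rule join_plan_cases[OF True])
        let ?c = "filter (\<lambda>x. x \<notin> set b) T"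
        obtain b' where b': "b' \<in> set (base Ts)" "set b' = set ?c" "set b \<subseteq> set T"
          using b(2) by (auto simp: joins_def)
        have av: "b \<noteq> []" "b' \<noteq> []" "set b \<in> avail ?V ?I" "set ?c \<in> avail ?V ?I"
          using pair_av[of b] pair_av[of b'] b(1) b'(1,2) by simp_all
        then have "?c \<noteq> []" using b'(2) by (metis set_empty)
        then have sup: "supported ?V ?I (b, ?c)"
          using av unfolding supported_def fst_conv snd_conv by auto
        have "(b, ?c) \<in> set ?I" using I unfolding eq b(3) by simp
        from imageI[OF this, of "\<lambda>p. set (fst p) \<union> set (snd p)"]
        have "set b \<union> set ?c \<in> avail ?V ?I" unfolding avail_eq fst_conv snd_conv by (rule UnI2)
        moreover have "set b \<union> set ?c = set T" using b'(3) by auto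
        ultimately show ?thesis using sup unfolding eq b(3) by simp
      next
        case False
        then have eq: "tree_plan Ts T = sub_plan (base Ts @ covering Ts) T"
          using 4 no3 by (auto simp: tree_plan_def)
        have "T \<in> set (fst (shared Ts))" using not_shared_triplet[OF T 4] no3 by blast
        then have "\<exists>S\<in>set (base Ts @ covering Ts). set S \<subseteq> set T" by (intro pair_exists) simp
        from sub_plan_ok[OF this T I[unfolded eq] pair_av] show ?thesis unfolding eq .
      qed
    qed
  qed
qed

lemma quad_plan_supported:
  assumes "p \<in> set (quad_plan Ts)"
  shows "supported (concat Ts) (quad_plan Ts) p"
proof -
  consider q where "q \<in> set (base Ts @ covering Ts) \<or> q \<in> set (snd (shared Ts))" "p \<in> set (scratch q)"
    | T where "T \<in> set Ts" "p \<in> set (tree_plan Ts T)"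
    using assms by (auto simp: quad_plan_def)
  then show ?thesis
    using scratch_in_plan(1) tree_plan_ok by cases blast+
qed

lemma quad_plan_avail: "T \<in> set Ts \<Longrightarrow> set T \<in> avail (concat Ts) (quad_plan Ts)"
  using tree_plan_ok by blast

lemma length_sized: "length (sized j Ts) = card {T \<in> set Ts. length T = j}"
  using tree_list_distinct[OF Ts] distinct_card[of "sized j Ts"] by (simp add: sized_def)

text \<open>Only a quadruple built on a single pair needs a second gate, and this is what the last
  summand pays for.\<close>

lemma tree_plan_length:
  assumes T: "T \<in> set Ts"
  shows "length (tree_plan Ts T) \<le> of_bool (length T = 3) + of_bool (length T = 4) +
    of_bool (T \<in> set (fst (shared Ts)) \<and> \<not> (\<exists>b\<in>set (base Ts). joins (base Ts) T b))"
proof -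
  have pairs: "length S = 2 \<and> distinct S" if "S \<in> set (base Ts @ covering Ts)" for S
    using pairsD[OF that] by blast
  have trip: "length S = 3 \<and> distinct S" if "S \<in> set (sized 3 Ts @ snd (shared Ts))" for S
    using tripletsD[OF that] by blast
  consider "length T = 3" | "length T = 4" "\<exists>S\<in>set (sized 3 Ts @ snd (shared Ts)). set S \<subseteq> set T"
    | "length T = 4" "\<not> (\<exists>S\<in>set (sized 3 Ts @ snd (shared Ts)). set S \<subseteq> set T)"
      "\<exists>b\<in>set (base Ts). joins (base Ts) T b"
    | "length T = 4" "\<not> (\<exists>S\<in>set (sized 3 Ts @ snd (shared Ts)). set S \<subseteq> set T)"
      "\<not> (\<exists>b\<in>set (base Ts). joins (base Ts) T b)"
    | "length T \<noteq> 3" "length T \<noteq> 4"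
    by blast
  then show ?thesis
  proof cases
    case 1
    then have "\<exists>S\<in>set (base Ts @ covering Ts). set S \<subseteq> set T"
      using T by (intro pair_exists) (simp add: sizedD)
    from sub_plan_length[OF this T pairs] show ?thesis using 1 by (simp add: tree_plan_def)
  next
    case 2
    from sub_plan_length[OF 2(2) T trip] have "length (tree_plan Ts T) = 1"
      using 2 unfolding tree_plan_def by (simp only: if_True if_False) simp
    then show ?thesis using 2(1) by simp
  next
    case 3
    obtain b where "join_plan (base Ts) T = [(b, filter (\<lambda>x. x \<notin> set b) T)]"
      by (rule join_plan_cases[OF 3(3)])
    then have "length (tree_plan Ts T) = 1"
      using 3 unfolding tree_plan_def by (simp only: if_True if_False) simp
    then show ?thesis using 3(1) by simp
  next
    case 4
    have sh: "T \<in> set (fst (shared Ts))" using not_shared_triplet[OF T 4(1)] 4(2) by blast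
    then have "\<exists>S\<in>set (base Ts @ covering Ts). set S \<subseteq> set T" by (intro pair_exists) simp
    from sub_plan_length[OF this T pairs] have "length (tree_plan Ts T) = 2"
      using 4 unfolding tree_plan_def by (simp only: if_True if_False) simp
    then show ?thesis using 4(1,3) sh by simp
  qed (simp add: tree_plan_def)
qed

lemma quad_plan_length:
  "length (quad_plan Ts) \<le> length (sized 2 Ts) + length (pair_core Ts) + length (covering Ts) +
     2 * length (snd (shared Ts)) + length (sized 3 Ts) + length (sized 4 Ts) +
     card {T \<in> set (fst (shared Ts)). \<not> (\<exists>b\<in>set (base Ts). joins (base Ts) T b)}"
proof -
  let ?N = "\<lambda>T. T \<in> set (fst (shared Ts)) \<and> \<not> (\<exists>b\<in>set (base Ts). joins (base Ts) T b)"
  have len: "length (concat (map scratch xs)) = j * length xs"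
    if "\<And>x. x \<in> set xs \<Longrightarrow> length x = Suc j" for xs j
    using that by (induction xs) (auto simp: length_scratch)
  have 1: "length (concat (map scratch (base Ts @ covering Ts))) =
      length (sized 2 Ts) + length (pair_core Ts) + length (covering Ts)"
    using len[of "base Ts @ covering Ts" 1] pairsD(1) by (simp add: base_def numeral_2_eq_2)
  have 2: "length (concat (map scratch (snd (shared Ts)))) = 2 * length (snd (shared Ts))"
    using tripletsD(1) by (intro len) simp
  have "length (concat (map (tree_plan Ts) Ts)) = (\<Sum>T\<in>set Ts. length (tree_plan Ts T))"
    using tree_list_distinct[OF Ts]
    by (simp add: length_concat sum_list_distinct_conv_sum_set comp_def)
  also have "\<dots> \<le> (\<Sum>T\<in>set Ts. of_bool (length T = 3) + of_bool (length T = 4) + of_bool (?N T))"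
    by (rule sum_mono) (rule tree_plan_length)
  also have "\<dots> = card {T \<in> set Ts. length T = 3} + card {T \<in> set Ts. length T = 4} +
      card {T \<in> set Ts. ?N T}"
    by (simp add: sum.distrib sum_of_bool_eq Int_def)
  also have "{T \<in> set Ts. ?N T} = {T. ?N T}" using quadsD(1) by blast
  finally show ?thesis
    using 1 2 by (simp add: quad_plan_def length_sized)
qed

section \<open>Interpreting the program in the charging scheme\<close>

lemma image_set_filter: "set ` set (filter (\<lambda>x. P (set x)) xs) = {A \<in> set ` set xs. P A}"
  by auto

lemma base_image: "basis = trees2 \<union> kept"
  by (simp add: base_def image_Un)

lemma bare_image: "to_cover = {A \<in> trees3 \<union> rest.
    \<forall>q\<in>trees2 \<union> kept. \<not> q \<subseteq> A}"
proof -
  have "bare Ts = filter (\<lambda>T. \<forall>q\<in>basis. \<not> q \<subseteq> set T) (sized 3 Ts @ fst (shared Ts))"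
    unfolding bare_def by (rule filter_cong) auto
  then show ?thesis
    using image_set_filter[of "\<lambda>A. \<forall>q\<in>basis. \<not> q \<subseteq> A" "sized 3 Ts @ fst (shared Ts)"]
    by (simp only: base_image set_append image_Un)
qed

lemma bare_distinct: "distinct (map set (bare Ts))"
proof -
  have "set S \<noteq> set T" if "S \<in> set (sized 3 Ts)" "T \<in> set (fst (shared Ts))" for S T
    using quadsD(3)[OF that(2,1)] by blast
  then have "distinct (map set (sized 3 Ts @ fst (shared Ts)))"
    using sized_distinct shared_distinct by auto
  then show ?thesis unfolding bare_def by (rule distinct_map_filter)
qed

lemma covering_prices:
  obtains \<pi> :: "nat set \<Rightarrow> real" where
    "cover_prices trees2 trees3 rest
       kept to_cover \<pi>"
    "real (length (covering Ts)) \<le> sum \<pi> to_cover"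
    "\<forall>p Z. card p = 2 \<longrightarrow> Z \<subseteq> {A \<in> to_cover. p \<subseteq> A} \<longrightarrow>
       sum \<pi> Z \<le> real (card Z) / 2 + 1 / 2"
proof -
  have one: "(1::nat) \<le> 5" by simp
  from cover_down_prices[OF one bare_distinct, of "all_pairs (concat Ts)"] obtain \<pi> :: "nat set \<Rightarrow> real"
    where *: "real (length (cover_down 5 (all_pairs (concat Ts)) (bare Ts))) \<le> sum \<pi> to_cover \<and>
    (\<forall>c\<in>set (all_pairs (concat Ts)). \<forall>Z. Z \<subseteq> {A \<in> to_cover. set c \<subseteq> A} \<longrightarrow>
       sum \<pi> Z \<le> real (card Z) / real 5 + (\<Sum>i=2..5. 1 / real i) \<and>
       (2 \<le> (5::nat) \<longrightarrow> sum \<pi> Z \<le> real (card Z) / 2 + 1 / 2))" by (rule exE)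
  note Z = conjunct2[OF *, THEN bspec, THEN spec, THEN mp]
  \<comment> \<open>Here the constant arises: 1/2 + 1/3 + 1/4 + 1/5.\<close>
  have "{2..5::nat} = {2, 3, 4, 5}" by auto
  then have H5: "(\<Sum>i=2..5. 1 / real i) = 77 / 60" by simp
  have prices: "sum \<pi> Z \<le> real (card Z) / 5 + 77 / 60 \<and> sum \<pi> Z \<le> real (card Z) / 2 + 1 / 2"
    if p: "card p = 2" and ZW: "Z \<subseteq> {A \<in> to_cover. p \<subseteq> A}" for p Z
  \<comment> \<open>The cover only considers pairs of occurring variables. Any other pair lies in no
    tree, so \<open>Z\<close> is empty and both bounds are trivial.\<close>
  proof (cases "Z = {}")
    case False
    then obtain A where "A \<in> Z" by (meson ex_in_conv)
    then have A: "A \<in> to_cover" "p \<subseteq> A" using subsetD[OF ZW] by simp_all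
    from A(1) obtain T where T: "T \<in> set (bare Ts)" "A = set T" by (elim imageE)
    then have "T \<in> set (sized 3 Ts) \<or> T \<in> set (fst (shared Ts))" by (auto simp: bare_def)
    then have "T \<in> set Ts" using quadsD(1) sizedD by blast
    then have "set T \<subseteq> set (concat Ts)" by auto
    then have "p \<subseteq> set (concat Ts)" using A(2) T(2) by (simp only: order_trans)
    from all_pairs_complete[OF p this] obtain c where c: "p = set c" "c \<in> set (all_pairs (concat Ts))"
      by (elim imageE)
    from Z[OF c(2), of Z] ZW show ?thesis unfolding c(1) H5 by simp
  qed simp
  show thesis
  proof (rule that)
    show "cover_prices trees2 trees3 rest
       kept to_cover \<pi>"
    proof
      show "card A = 3" if "A \<in> trees3" for A
        using that tree_listD(3)[OF Ts] by (auto simp: sizedD)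
      show "to_cover = {A \<in> trees3 \<union> rest.
        \<forall>q\<in>trees2 \<union> kept. \<not> q \<subseteq> A}" by (rule bare_image)
      show "sum \<pi> Z \<le> real (card Z) / 5 + 77 / 60" if "card p = 2" "Z \<subseteq> {A \<in> to_cover. p \<subseteq> A}" for p Z
        using prices[OF that] by (rule conjunct1)
    qed simp_all
    show "real (length (covering Ts)) \<le> sum \<pi> to_cover"
      using conjunct1[OF *] unfolding covering_def .
    show "\<forall>p Z. card p = 2 \<longrightarrow> Z \<subseteq> {A \<in> to_cover. p \<subseteq> A} \<longrightarrow> sum \<pi> Z \<le> real (card Z) / 2 + 1 / 2"
      using prices by simp
  qed
qed

text \<open>Labels of different sizes differ, and within one size trees and hidden labels are
  separated, so all of these labels are distinct members of \<open>\<Gamma>\<close>.\<close>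

lemma gate_count:
  assumes \<Gamma>: "gate_family (set ` set Ts) \<Gamma>"
  shows "length (sized 2 Ts) + length (sized 3 Ts) + length (sized 4 Ts) +
     card {A \<in> \<Gamma>. card A = 2 \<and> A \<notin> trees2} +
     card {A \<in> \<Gamma>. card A = 3 \<and> A \<notin> trees3} \<le> card \<Gamma>"
proof -
  have fin: "finite \<Gamma>" using \<Gamma> by (simp add: gate_family_def)
  have sub: "set ` set (sized j Ts) \<subseteq> {A \<in> \<Gamma>. card A = j}" if "2 \<le> j" for j
    using that gate_family_mem[OF \<Gamma>] tree_listD(3)[OF Ts] by (auto simp: sizedD)
  have part: "length (sized j Ts) + card {A \<in> \<Gamma>. card A = j \<and> A \<notin> set ` set (sized j Ts)} =
      card {A \<in> \<Gamma>. card A = j}" if "2 \<le> j" for j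
  proof -
    have "{A \<in> \<Gamma>. card A = j} = set ` set (sized j Ts) \<union>
        {A \<in> \<Gamma>. card A = j \<and> A \<notin> set ` set (sized j Ts)}"
      using sub[OF that] by blast
    moreover have "card (set ` set (sized j Ts) \<union> {A \<in> \<Gamma>. card A = j \<and> A \<notin> set ` set (sized j Ts)}) =
        card (set ` set (sized j Ts)) + card {A \<in> \<Gamma>. card A = j \<and> A \<notin> set ` set (sized j Ts)}"
      using fin by (intro card_Un_disjoint) auto
    ultimately show ?thesis using length_card_sets[OF sized_distinct] by simp
  qed
  have "card ({A \<in> \<Gamma>. card A = 2} \<union> ({A \<in> \<Gamma>. card A = 3} \<union> {A \<in> \<Gamma>. card A = 4})) =
      card {A \<in> \<Gamma>. card A = 2} + (card {A \<in> \<Gamma>. card A = 3} + card {A \<in> \<Gamma>. card A = 4})"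
    using fin by (subst card_Un_disjoint, simp, simp, force, subst card_Un_disjoint) auto
  moreover have "card ({A \<in> \<Gamma>. card A = 2} \<union> ({A \<in> \<Gamma>. card A = 3} \<union> {A \<in> \<Gamma>. card A = 4})) \<le> card \<Gamma>"
    using fin by (intro card_mono) auto
  ultimately show ?thesis using part[of 2] part[of 3] part[of 4] by simp
qed

lemma uncompleted_image:
  "card {T \<in> set (fst (shared Ts)). \<not> (\<exists>b\<in>set (base Ts). joins (base Ts) T b)} =
   card (rest - {A \<in> rest.
      \<exists>q\<in>basis. q \<subseteq> A \<and> A - q \<in> basis})"
proof -
  have "(\<exists>b\<in>set (base Ts). joins (base Ts) T b) \<longleftrightarrow>
      (\<exists>q\<in>basis. q \<subseteq> set T \<and> set T - q \<in> basis)" for T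
    unfolding joins_def by (auto simp: set_diff_eq image_iff)
  then have "{T \<in> set (fst (shared Ts)). \<not> (\<exists>b\<in>set (base Ts). joins (base Ts) T b)} =
      set (filter (\<lambda>T. \<not> (\<exists>q\<in>basis. q \<subseteq> set T \<and> set T - q \<in> basis))
        (fst (shared Ts)))" by auto
  moreover have "distinct (fst (shared Ts))" using shared_distinct by (simp add: distinct_map)
  ultimately have "card {T \<in> set (fst (shared Ts)). \<not> (\<exists>b\<in>set (base Ts). joins (base Ts) T b)} =
      length (filter (\<lambda>T. \<not> (\<exists>q\<in>basis. q \<subseteq> set T \<and> set T - q \<in> basis))
        (fst (shared Ts)))"
    by (simp add: distinct_card del: set_filter)
  also have "\<dots> = card {A \<in> rest.
      \<not> (\<exists>q\<in>basis. q \<subseteq> A \<and> A - q \<in> basis)}"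
    by (rule length_filter_card[OF shared_distinct])
  also have "{A \<in> rest.
      \<not> (\<exists>q\<in>basis. q \<subseteq> A \<and> A - q \<in> basis)} =
      rest - {A \<in> rest.
      \<exists>q\<in>basis. q \<subseteq> A \<and> A - q \<in> basis}"
    by (simp only: set_diff_eq mem_Collect_eq) blast
  finally show ?thesis .
qed

lemma shared_count: "3 * length (snd (shared Ts)) + length (fst (shared Ts)) \<le> length (sized 4 Ts)"
proof -
  have "distinct (quads Ts)" using quads_distinct by (simp add: distinct_map)
  then have "3 * length (snd (shared Ts)) + length (fst (shared Ts)) \<le> length (quads Ts)"
    unfolding shared_def by (rule cover_count)
  also have "quads Ts = filter (\<lambda>T. \<not> (\<exists>S\<in>set (sized 3 Ts). set S \<subseteq> set T)) (sized 4 Ts)"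
    by (simp add: quads_def sized_def conj_commute)
  also have "length \<dots> \<le> length (sized 4 Ts)" by (rule length_filter_le)
  finally show ?thesis .
qed

text \<open>A list that \<open>core_step\<close> leaves unchanged is one whose members all pass its
  test.\<close>

lemma pair_core_core:
  assumes "q \<in> kept"
  shows "5 \<le> card {A \<in> rest. q \<subseteq> A \<and>
     A - q \<in> trees2 \<union> kept}"
proof -
  from assms obtain l where l: "l \<in> set (pair_core Ts)" "q = set l" by blast
  from l(1) have "l \<in> set (core_step (sized 2 Ts) (fst (shared Ts)) (pair_core Ts))"
    unfolding pair_core_def core_stable .
  then show ?thesis
    unfolding core_step_def core_step_count[OF shared_distinct] l(2) by simp
qed

text \<open>The first phase ends only when no triple of occurring variables lies in three remaining
  quadruples, and other triples lie in none.\<close>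

lemma triple_sharing:
  assumes "card \<tau> = 3"
  shows "card {A \<in> rest. \<tau> \<subseteq> A} \<le> 2"
proof (cases "\<tau> \<subseteq> set (concat Ts)")
  case True
  then obtain c where c: "c \<in> set (all_triples (concat Ts))" "set c = \<tau>"
    using all_triples_complete[OF assms] by blast
  have "length (filter (\<lambda>t. set c \<subseteq> set t) (fst (shared Ts))) < 3"
    unfolding shared_def by (rule cover_exhausted[OF _ c(1)]) simp
  then show ?thesis
    using length_filter_card[OF shared_distinct, of "\<lambda>A. \<tau> \<subseteq> A"] c(2) by simp
next
  case False
  have "\<not> \<tau> \<subseteq> A" if "A \<in> rest" for A
  proof
    assume "\<tau> \<subseteq> A"
    moreover have "A \<subseteq> set (concat Ts)" using that quadsD(1) by auto
    ultimately show False using False by blast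
  qed
  then have "{A \<in> rest. \<tau> \<subseteq> A} = {}" by blast
  then show ?thesis by (simp only: card.empty)
qed

lemma quad_plan_cost:
  assumes \<Gamma>: "gate_family (set ` set Ts) \<Gamma>"
  shows "real (length (quad_plan Ts)) \<le> 19 / 10 * real (card \<Gamma>)"
proof -
  let ?V = "set (concat Ts)"
  obtain \<pi> :: "nat set \<Rightarrow> real" where \<pi>: "cover_prices trees2 trees3 rest kept to_cover \<pi>"
    and cov: "real (length (covering Ts)) \<le> sum \<pi> to_cover"
    and price2: "\<forall>p Z. card p = 2 \<longrightarrow> Z \<subseteq> {A \<in> to_cover. p \<subseteq> A} \<longrightarrow> sum \<pi> Z \<le> real (card Z) / 2 + 1 / 2"
    by (rule covering_prices)
  interpret cover_prices trees2 trees3 rest kept to_cover \<pi> by (rule \<pi>)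
  interpret quad_cover trees2 trees3 rest kept to_cover \<pi>
  proof
    show "card A = 4" if "A \<in> rest" for A
      using that quadsD(1,2) tree_listD(3)[OF Ts] by auto
    show "\<not> S \<subseteq> A" if "A \<in> rest" "S \<in> trees3" for A S
      using that quadsD(3) by auto
    show "card {A \<in> rest. \<tau> \<subseteq> A} \<le> 2" if "card \<tau> = 3" for \<tau>
      using that by (rule triple_sharing)
    show "finite kept" by simp
    show "card q = 2" if "q \<in> kept" for q
      using that pair_coreD(1,2) by (auto simp: distinct_card)
    show "kept \<inter> trees2 = {}" using pair_coreD(4) by blast
    show "5 \<le> card {A \<in> rest. q \<subseteq> A \<and> A - q \<in> trees2 \<union> kept}" if "q \<in> kept" for q
      using that by (rule pair_core_core)
    show "sum \<pi> Z \<le> real (card Z) / 2 + 1 / 2" if "card p = 2" "Z \<subseteq> {A \<in> to_cover. p \<subseteq> A}" for p Z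
      using price2 that by simp
  qed
  define H where "H = {A \<in> \<Gamma>. card A = 2 \<and> A \<notin> trees2 \<and> A \<subseteq> ?V}"
  define E where "E = {A \<in> \<Gamma>. card A = 3 \<and> A \<notin> trees3}"
  have fin\<Gamma>: "finite \<Gamma>" using \<Gamma> by (simp add: gate_family_def)
  have "H \<subseteq> set ` set (fresh_pairs Ts)"
  proof
    fix p assume "p \<in> H"
    then have p: "card p = 2" "p \<subseteq> ?V" "p \<notin> trees2" by (simp_all add: H_def)
    from all_pairs_complete[OF p(1,2)] obtain c where "c \<in> set (all_pairs (concat Ts))" "p = set c" by blast
    with p(3) have "c \<in> set (fresh_pairs Ts)" by (auto simp: fresh_pairs_def image_iff)
    then show "p \<in> set ` set (fresh_pairs Ts)" using \<open>p = set c\<close> by blast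
  qed
  note H' = this
  have extra: "real (card kept) + sum \<pi> to_cover + real (card (rest - completed)) \<le>
      9 / 10 * (real (card trees3) + real (card rest)) + 19 / 10 * (real (card H) + real (card E))"
  proof (rule extra_cost[OF \<Gamma> _ _ _ H_def E_def])
    show "trees3 \<subseteq> set ` set Ts" by (auto simp: sizedD)
    show "rest \<subseteq> set ` set Ts" using quadsD(1) by blast
    show "A \<subseteq> ?V" if "A \<in> trees3 \<union> rest" for A using that quadsD(1) by (auto simp: sizedD)
    show "card {A \<in> Y. \<not> (sp A \<in> trees2 \<union> kept \<and> A - sp A \<in> trees2 \<union> kept)} \<le> 4 * card (H - kept)"
      if "Y \<subseteq> rest" "\<And>A. A \<in> Y \<Longrightarrow> sp A \<subseteq> A \<and> sp A \<in> H \<union> trees2 \<and> A - sp A \<in> H \<union> trees2" for Y sp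
      unfolding pair_core_def
      by (rule core_lost[OF shared_distinct that(1) _ H' that(2)]) (simp add: H_def fin\<Gamma>)
  qed
  have "completed = {A \<in> rest. \<exists>q\<in>basis. q \<subseteq> A \<and> A - q \<in> basis}"
    by (simp only: completed_def base_image)
  then have N: "card {T \<in> set (fst (shared Ts)). \<not> (\<exists>b\<in>set (base Ts). joins (base Ts) T b)} =
      card (rest - completed)"
    using uncompleted_image by simp
  have HH: "card H \<le> card {A \<in> \<Gamma>. card A = 2 \<and> A \<notin> trees2}"
    using fin\<Gamma> by (intro card_mono) (auto simp: H_def)
  have cards: "card trees3 = length (sized 3 Ts)" "card rest = length (fst (shared Ts))"
    "card kept = length (pair_core Ts)"
    using length_card_sets sized_distinct shared_distinct pair_core_distinct by metis+
  show ?thesis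
    by (rule quad_budget[OF extra[unfolded cards] HH gate_count[OF \<Gamma>, folded E_def]
          quad_plan_length[unfolded N] shared_count cov])
qed

text \<open>Without quadruples the first phase is void and the pruning discards every pair, since
  none has a partner. The rates become 1 for tree pairs, 6/5 for triples and 77/60 for hidden pairs,
  all below 4/3.\<close>

lemma quad_plan_cost_triples:
  assumes no4: "\<And>T. T \<in> set Ts \<Longrightarrow> length T \<le> 3" and \<Gamma>: "gate_family (set ` set Ts) \<Gamma>"
  shows "real (length (quad_plan Ts)) \<le> 4 / 3 * real (card \<Gamma>)"
proof -
  let ?H = "{A \<in> \<Gamma>. card A = 2 \<and> A \<notin> trees2}"
  obtain \<pi> :: "nat set \<Rightarrow> real" where \<pi>: "cover_prices trees2 trees3 rest kept to_cover \<pi>"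
    and cov: "real (length (covering Ts)) \<le> sum \<pi> to_cover"
    by (rule covering_prices)
  interpret cover_prices trees2 trees3 rest kept to_cover \<pi> by (rule \<pi>)
  have "sized 4 Ts = []" using no4 by (force simp: sized_def filter_empty_conv)
  then have none: "fst (shared Ts) = []" "snd (shared Ts) = []" "length (sized 4 Ts) = 0"
    using shared_count by simp_all
  have "pair_core Ts = []"
  proof (rule ccontr)
    assume "pair_core Ts \<noteq> []"
    then obtain q where "q \<in> kept" by (metis imageI list.set_sel(1))
    from pair_core_core[OF this] show False by (simp add: none)
  qed
  moreover have "sum \<pi> to_cover \<le> real (card trees3) / 5 + 77 / 60 * real (card ?H)"
  proof (rule triples_only[OF \<Gamma>])
    show "trees3 \<subseteq> set ` set Ts" by (auto simp: sizedD)
  qed (simp add: none)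
  moreover have "card trees3 = length (sized 3 Ts)"
    using length_card_sets[OF sized_distinct] by metis
  ultimately have "real (length (quad_plan Ts)) \<le>
      real (length (sized 2 Ts)) + 6 / 5 * real (length (sized 3 Ts)) +
      77 / 60 * real (card ?H)"
    using quad_plan_length cov none by simp
  also have "\<dots> \<le> 4 / 3 * (real (length (sized 2 Ts)) + real (length (sized 3 Ts)) + real (card ?H))"
    by simp
  also have "\<dots> \<le> 4 / 3 * real (card \<Gamma>)"
    using gate_count[OF \<Gamma>] by simp
  finally show ?thesis .
qed

end

section \<open>The approximation guarantees\<close>

lemma quad_plan_approximation:
  assumes "\<And>\<T>. P \<T> \<Longrightarrow> max_tree_size \<T> \<le> 4" "0 \<le> \<alpha>"
    and cost: "\<And>Ts \<Gamma>. tree_list Ts \<Longrightarrow> P (set ` set Ts) \<Longrightarrow>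
      (\<And>T. T \<in> set Ts \<Longrightarrow> length T \<le> max_tree_size (set ` set Ts)) \<Longrightarrow>
      gate_family (set ` set Ts) \<Gamma> \<Longrightarrow> real (length (quad_plan Ts)) \<le> \<alpha> * real (card \<Gamma>)"
  shows "poly_time_approximable P (\<lambda>_. \<alpha>)"
proof (rule poly_time_approximableI[where alg = "\<lambda>p. assemble (concat (snd p)) (quad_plan (snd p))"])
  show "ptime (\<lambda>p. assemble (concat (snd p)) (quad_plan (snd p)))"
    by (intro ptime_intros ptime_comp[OF ptime_quad_plan])
  fix n \<T> Ts
  assume inst: "is_instance n \<T>" and P: "P \<T>" and rep: "represents Ts \<T>"
  have Ts: "tree_list Ts" using inst rep by (rule tree_listI)
  have \<T>: "\<T> = set ` set Ts" using rep by (auto simp: represents_def)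
  have k: "length T \<le> max_tree_size \<T>" if "T \<in> set Ts" for T
    using card_le_max_tree_size[of \<T> "set T"] that tree_listD(3)[OF Ts that] by (simp add: \<T>)
  then have small: "length T \<le> 4" if "T \<in> set Ts" for T
    using assms(1)[OF P] that order_trans by blast
  show "is_solution n \<T> (assemble (concat (snd (n, Ts))) (quad_plan (snd (n, Ts)))) \<and>
     real (num_gates (assemble (concat (snd (n, Ts))) (quad_plan (snd (n, Ts))))) \<le> \<alpha> * real (opt n \<T>)"
    unfolding snd_conv
  proof (rule plan_approximation[OF inst rep _ _ _ assms(2)])
    show "supported (concat Ts) (quad_plan Ts) p" if "p \<in> set (quad_plan Ts)" for p
      using Ts small that by (rule quad_plan_supported)
    show "set T \<in> avail (concat Ts) (quad_plan Ts)" if "T \<in> set Ts" for T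
      using Ts small that by (rule quad_plan_avail)
    show "real (length (quad_plan Ts)) \<le> \<alpha> * real (card \<Gamma>)" if "gate_family \<T> \<Gamma>" for \<Gamma>
      using cost[OF Ts] P k that unfolding \<T> by blast
  qed
qed

theorem theorem3:
  fixes f :: "bool \<Rightarrow> bool \<Rightarrow> bool"
  assumes "abel_semigroup f"
  shows "poly_time_approximable (\<lambda>\<T>. max_tree_size \<T> = 3) (\<lambda>_. 4 / 3)
    \<and> poly_time_approximable (\<lambda>\<T>. max_tree_size \<T> = 4) (\<lambda>_. 19 / 10)
    \<and> poly_time_approximable (\<lambda>_. True) (\<lambda>\<T>. 2 / 3 * real (max_tree_size \<T>))"
proof (intro conjI)
  show "poly_time_approximable (\<lambda>\<T>. max_tree_size \<T> = 3) (\<lambda>_. 4 / 3)"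
  proof (rule quad_plan_approximation)
    fix Ts \<Gamma>
    assume Ts: "tree_list Ts" and k: "max_tree_size (set ` set Ts) = 3"
      and "\<And>T. T \<in> set Ts \<Longrightarrow> length T \<le> max_tree_size (set ` set Ts)"
      and \<Gamma>: "gate_family (set ` set Ts) \<Gamma>"
    then have 3: "length T \<le> 3" if "T \<in> set Ts" for T using that by simp
    then have 4: "length T \<le> 4" if "T \<in> set Ts" for T using that by fastforce
    from Ts 4 3 \<Gamma> show "real (length (quad_plan Ts)) \<le> 4 / 3 * real (card \<Gamma>)"
      by (rule quad_plan_cost_triples)
  qed simp_all
  show "poly_time_approximable (\<lambda>\<T>. max_tree_size \<T> = 4) (\<lambda>_. 19 / 10)"
  proof (rule quad_plan_approximation)
    fix Ts \<Gamma>
    assume Ts: "tree_list Ts" and k: "max_tree_size (set ` set Ts) = 4"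
      and "\<And>T. T \<in> set Ts \<Longrightarrow> length T \<le> max_tree_size (set ` set Ts)"
      and \<Gamma>: "gate_family (set ` set Ts) \<Gamma>"
    then have 4: "length T \<le> 4" if "T \<in> set Ts" for T using that by simp
    from Ts 4 \<Gamma> show "real (length (quad_plan Ts)) \<le> 19 / 10 * real (card \<Gamma>)"
      by (rule quad_plan_cost)
  qed simp_all
  show "poly_time_approximable (\<lambda>_. True) (\<lambda>\<T>. 2 / 3 * real (max_tree_size \<T>))"
    by (rule general_approximation)
qed

end
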